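(* Let $T>0$, $H\in(1/3,1/2)$, $a\in\mathbb R^m$, and let $V_1,\dots,V_d$ be smooth vector fields on $\mathbb R^m$ whose derivatives of all orders $\ge1$ are bounded. Assume there is an integer $n\ge1$ with $[V_{i_1}\cdots V_{i_n}]=0$ for all $(i_1,\dots,i_n)\in\{1,\dots,d\}^n$, and that every Lie bracket of order $\ge2$ of $V_1,\dots,V_d$ is a constant vector field. Let $J_{0,t}$ be the Jacobian of the flow of $dy_t=\sum_{i=1}^dV_i(y_t)\,dB^i_t$ with respect to the initial condition $a$. Then for every $q\ge1$, $$\mathbf E\Big[\sup_{0\le t\le T}|J_{0,t}|^q\Big]<\infty\quad\text{and}\quad\mathbf E\Big[\sup_{0\le t\le T}|J_{0,t}^{-1}|^q\Big]<\infty.$$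
   Context: $B=(B^1,\dots,B^d)$ is a $d$-dimensional fractional Brownian motion with Hurst parameter $H$ (independent centered Gaussian components with covariance $R_H(s,t)=\frac12(s^{2H}+t^{2H}-|t-s|^{2H})$), enhanced by its L\'evy area (a.s. limit of iterated Riemann integrals of piecewise linear approximations along a suitable sequence of partitions); equations are rough differential equations driven by this rough path. For $s\le t$, $\Phi_{s,t}(a)=y^{s,a}_t$ is the solution at time $t$ started from $a$ at time $s$, and $J_{0,t}=\nabla_a\Phi_{0,t}(a)$, an $m\times m$ matrix, which solves $dJ_{0,t}=\sum_i\nabla V_i(y_t)J_{0,t}\,dB^i_t$, $J_{0,0}=I$; $J_{0,t}^{-1}$ is its matrix inverse. Lie brackets: $[V,W]^i=V^l\partial_{x_l}W^i-W^l\partial_{x_l}V^i$, $[U_1]=U_1$, $[U_1\cdots U_k]=[[U_1\cdots U_{k-1}],U_k]$ (order $k$). *)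

theory Defs
  imports "HOL-Probability.Probability"
begin

definition R_H :: "real \<Rightarrow> real \<Rightarrow> real \<Rightarrow> real" where
  "R_H H s t = (s powr (2*H) + t powr (2*H) - \<bar>t - s\<bar> powr (2*H)) / 2"

text \<open>B is a d-dimensional fBm on the probability space M: continuous paths, and the
  family (B i t) is jointly centred Gaussian with covariance E[B i s B j t] = delta_ij R_H(s,t)
  (every finite linear combination is a centred normal variable with the corresponding
  variance; variance 0 means a.s. zero).\<close>
definition fbm :: "'w measure \<Rightarrow> real \<Rightarrow> ('d::finite \<Rightarrow> real \<Rightarrow> 'w \<Rightarrow> real) \<Rightarrow> bool" where
  "fbm M H B \<longleftrightarrow> prob_space M \<and>
     (\<forall>i t. B i t \<in> borel_measurable M) \<and>
     (\<forall>\<omega>\<in>space M. \<forall>i. continuous_on {0..} (\<lambda>t. B i t \<omega>)) \<and>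
     (\<forall>(S::('d \<times> real) set) (c::'d \<times> real \<Rightarrow> real). finite S \<and> S \<subseteq> UNIV \<times> {0..} \<longrightarrow>
        (let X = (\<lambda>\<omega>. \<Sum>p\<in>S. c p * B (fst p) (snd p) \<omega>);
             v = (\<Sum>p\<in>S. \<Sum>p'\<in>S. c p * c p' *
                    (if fst p = fst p' then R_H H (snd p) (snd p') else 0))
         in if v = 0 then (AE \<omega> in M. X \<omega> = 0)
            else distributed M lborel X (\<lambda>x. ennreal (normal_density 0 (sqrt v) x))))"

fun iter_dderiv :: "('a::real_normed_vector \<Rightarrow> 'b::real_normed_vector) \<Rightarrow> 'a list \<Rightarrow> 'a \<Rightarrow> 'b" where
  "iter_dderiv f [] = f"
| "iter_dderiv f (v # vs) = (\<lambda>x. frechet_derivative (iter_dderiv f vs) (at x) v)"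

definition smooth_bdd_derivs :: "('a::real_normed_vector \<Rightarrow> 'b::real_normed_vector) \<Rightarrow> bool" where
  "smooth_bdd_derivs f \<longleftrightarrow>
     (\<forall>vs x. iter_dderiv f vs differentiable (at x)) \<and>
     (\<forall>k\<ge>1. \<exists>C. \<forall>vs x. length vs = k \<longrightarrow>
        norm (iter_dderiv f vs x) \<le> C * (\<Prod>v\<leftarrow>vs. norm v))"

definition lie_bracket :: "('a::real_normed_vector \<Rightarrow> 'a) \<Rightarrow> ('a \<Rightarrow> 'a) \<Rightarrow> 'a \<Rightarrow> 'a" where
  "lie_bracket V W = (\<lambda>x. frechet_derivative W (at x) (V x) - frechet_derivative V (at x) (W x))"

definition lie_word :: "('d \<Rightarrow> 'a::real_normed_vector \<Rightarrow> 'a) \<Rightarrow> 'd list \<Rightarrow> 'a \<Rightarrow> 'a" where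
  "lie_word V is = foldl (\<lambda>W j. lie_bracket W (V j)) (V (hd is)) (tl is)"

definition dyad_pt :: "nat \<Rightarrow> real \<Rightarrow> nat \<Rightarrow> real" where
  "dyad_pt n T k = real k * T / 2 ^ n"

definition dyad_idx :: "nat \<Rightarrow> real \<Rightarrow> real \<Rightarrow> nat" where
  "dyad_idx n T r = min (nat \<lfloor>r * 2 ^ n / T\<rfloor>) (2 ^ n - 1)"

definition pl_slope :: "nat \<Rightarrow> real \<Rightarrow> (real \<Rightarrow> real) \<Rightarrow> real \<Rightarrow> real" where
  "pl_slope n T x r = (let k = dyad_idx n T r in
      (x (dyad_pt n T (Suc k)) - x (dyad_pt n T k)) * 2 ^ n / T)"

definition pl_interp :: "nat \<Rightarrow> real \<Rightarrow> (real \<Rightarrow> real) \<Rightarrow> real \<Rightarrow> real" where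
  "pl_interp n T x r = (let k = dyad_idx n T r in
      x (dyad_pt n T k) + (r - dyad_pt n T k) * pl_slope n T x r)"

definition iter_int_pl :: "nat \<Rightarrow> real \<Rightarrow> (real \<Rightarrow> real) \<Rightarrow> (real \<Rightarrow> real) \<Rightarrow> real \<Rightarrow> real \<Rightarrow> real" where
  "iter_int_pl n T x1 x2 s t =
     integral {s..t} (\<lambda>r. (pl_interp n T x1 r - pl_interp n T x1 s) * pl_slope n T x2 r)"

definition levy_lift :: "real \<Rightarrow> ('d \<Rightarrow> real \<Rightarrow> 'w \<Rightarrow> real) \<Rightarrow> 'd \<Rightarrow> 'd \<Rightarrow> real \<Rightarrow> real \<Rightarrow> 'w \<Rightarrow> real" where
  "levy_lift T B i j s t \<omega> = lim (\<lambda>n. iter_int_pl n T (\<lambda>r. B i r \<omega>) (\<lambda>r. B j r \<omega>) s t)"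

section \<open>Rough differential equations (Davie's definition)\<close>

text \<open>y solves dy = sum_i V_i(y) dx^i on [0,T], y_0 = a, driven by the rough path (x, X),
  X i j s t = int_s^t int_s^r dx^i dx^j.\<close>
definition rde_solution :: "real \<Rightarrow> ('d::finite \<Rightarrow> real \<Rightarrow> real) \<Rightarrow> ('d \<Rightarrow> 'd \<Rightarrow> real \<Rightarrow> real \<Rightarrow> real)
    \<Rightarrow> ('d \<Rightarrow> 'a::real_normed_vector \<Rightarrow> 'a) \<Rightarrow> 'a \<Rightarrow> (real \<Rightarrow> 'a) \<Rightarrow> bool" where
  "rde_solution T x X V a y \<longleftrightarrow> y 0 = a \<and> continuous_on {0..T} y \<and>
     (\<exists>\<theta>>1. \<exists>C. \<forall>s t. 0 \<le> s \<and> s \<le> t \<and> t \<le> T \<longrightarrow>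
        norm (y t - y s - (\<Sum>i\<in>UNIV. (x i t - x i s) *\<^sub>R V i (y s))
               - (\<Sum>i\<in>UNIV. \<Sum>j\<in>UNIV. X i j s t *\<^sub>R frechet_derivative (V j) (at (y s)) (V i (y s))))
        \<le> C * (t - s) powr \<theta>)"

definition jacobian_flow :: "(real^'m \<Rightarrow> 'w \<Rightarrow> real \<Rightarrow> real^'m) \<Rightarrow> 'w \<Rightarrow> real \<Rightarrow> real^'m \<Rightarrow> real^'m^'m" where
  "jacobian_flow y \<omega> t a = matrix (frechet_derivative (\<lambda>b. y b \<omega> t) (at a))"

end

theory Submission
  imports Defs
begin

text \<open>
  Let \<open>E u\<close> be the time-one flow of the field \<open>\<Sum>i. u i V i\<close>. All brackets of order at least two are
  constant, so their span \<open>K\<close> consists of translations, every \<open>V i\<close> changes by a constant vector of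
  \<open>K\<close> under a translation by an element of \<open>K\<close>, and exponentials compose up to such translations:
  \<open>E (-(u + w)) \<circ> E w\<close> and \<open>E (-u)\<close> differ by a constant. Hence for two solutions
  \<open>y\<close>, \<open>z\<close> of the equation driven by \<open>x\<close> the difference \<open>E (-(x t - x 0)) (y t) - E (-(x t - x 0)) (z t)\<close>
  does not depend on t: over a time step it changes by \<open>O(h powr \<theta>)\<close> with \<open>\<theta> > 1\<close>, the area term
  being a common translation in \<open>K\<close>. As \<open>E u\<close> is bi-Lipschitz with constant \<open>exp (C |u| + 1)\<close>, so is
  the flow at time t, with \<open>u = x t - x 0\<close>, and both moments reduce to the exponential moments of the
  supremum of the fractional Brownian motion, obtained by dyadic chaining.
  Only the identity \<open>X i j + X j i = (increment of x i) * (increment of x j)\<close> is needed from the Levy area; it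
  requires that the approximating areas converge, which follows from a second moment computation
  (Wick's formula, and summability of the increment correlations).
\<close>

subsection \<open>Globally Lipschitz differential equations\<close>

text \<open>The obstacle is integrability. The standard pathwise estimate of the Jacobian carries a
  power greater than 2 of the rough path norm in the exponent, which Gaussian tails do not
  integrate. Here the exponent must be linear in the displacement of the path, and it is, because
  Gronwall is applied to a single field \<open>W u\<close> over unit time and never along the rough
  path itself.

  The error of one time step contains the cubic Taylor remainder of \<open>E\<close>. It sums to
  zero under refinement when the increments of \<open>x\<close> decay with an exponent \<alpha> >
  1/3, whereas exponential moments of the scaled increments ask for \<alpha> < H. This is where H >
  1/3 enters.

  The Levy area is a limit that exists off a null set depending on the pair of times. The symmetry
  identity is therefore used only for the countably many pairs of dyadic neighbours, solutions are
  compared at dyadic times, and the remaining times follow by continuity.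

  The Jacobian is reached only through difference quotients of two solutions on one common event, so
  its bounds pass to the supremum over all times at once.\<close>

lemma norm_increment_le:
  fixes f :: "real \<Rightarrow> 'a::real_normed_vector"
  assumes "\<And>t. t \<in> {a..b} \<Longrightarrow> (f has_vector_derivative f' t) (at t within {a..b})"
    and "\<And>t. t \<in> {a..b} \<Longrightarrow> norm (f' t) \<le> C"
    and "s \<in> {a..b}" "t \<in> {a..b}"
  shows "norm (f t - f s) \<le> C * \<bar>t - s\<bar>"
proof -
  have "norm (f t - f s) \<le> C * norm (t - s)"
  proof (rule differentiable_bound[of "{a..b}" f "\<lambda>t h. h *\<^sub>R f' t"])
    fix x assume "x \<in> {a..b}"
    then show "onorm (\<lambda>h. h *\<^sub>R f' x) \<le> C"
      using assms(2)[of x] by (intro onorm_le) (simp add: mult.commute[of C] mult_left_mono)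
  qed (use assms in \<open>auto simp: has_vector_derivative_def\<close>)
  then show ?thesis by simp
qed

text \<open>The quantity exp(-(2M+1)t) (|d|^2 + e^2) does not increase. Squaring avoids the point
  where the norm is not differentiable, and 2e|d| \<le> |d|^2 + e^2 absorbs the inhomogeneity, which
  is where the extra 1 in the rate comes from.\<close>

lemma gronwall_forward:
  fixes d :: "real \<Rightarrow> 'a::real_inner"
  assumes der: "\<And>t. t \<in> {0..1} \<Longrightarrow> (d has_vector_derivative d' t) (at t within {0..1})"
    and le: "\<And>t. t \<in> {0..1} \<Longrightarrow> norm (d' t) \<le> M * norm (d t) + e"
    and M: "0 \<le> M" and e: "0 \<le> e" and r: "r \<in> {0..1}"
  shows "norm (d r) \<le> (norm (d 0) + e) * exp (M + 1)"
proof -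
  define g where "g t = exp (- (2*M+1) * t) * (d t \<bullet> d t + e\<^sup>2)" for t
  define g' where "g' t = exp (- (2*M+1) * t) * (2 * (d t \<bullet> d' t)) - (2*M+1) * exp (- (2*M+1) * t) * (d t \<bullet> d t + e\<^sup>2)" for t
  have g: "(g has_derivative (\<lambda>h. g' t * h)) (at t within {0..r})" if "t \<in> {0..r}" for t
  proof -
    have "(d has_derivative (\<lambda>h. h *\<^sub>R d' t)) (at t within {0..r})"
      using der[of t] that r
      by (auto simp: has_vector_derivative_def intro: has_derivative_subset)
    then show ?thesis unfolding g_def g'_def
      by (auto intro!: derivative_eq_intros simp: algebra_simps inner_commute)
  qed
  have g': "g' t \<le> 0" if "t \<in> {0..r}" for t
  proof -
    have "d t \<bullet> d' t \<le> norm (d t) * norm (d' t)" by (rule norm_cauchy_schwarz)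
    also have "\<dots> \<le> norm (d t) * (M * norm (d t) + e)"
      using le[of t] that r by (intro mult_left_mono) auto
    finally have "2 * (d t \<bullet> d' t) \<le> 2 * M * (norm (d t))\<^sup>2 + 2 * e * norm (d t)"
      by (simp add: power2_eq_square algebra_simps)
    also have "2 * e * norm (d t) \<le> (norm (d t))\<^sup>2 + e\<^sup>2"
      using sum_squares_bound[of e "norm (d t)"] by simp
    finally have "2 * (d t \<bullet> d' t) \<le> (2*M+1) * (d t \<bullet> d t) + e\<^sup>2"
      by (simp add: power2_norm_eq_inner algebra_simps)
    also have "\<dots> \<le> (2*M+1) * (d t \<bullet> d t + e\<^sup>2)"
      using M by (simp add: algebra_simps)
    finally have "exp (- (2*M+1) * t) * (2 * (d t \<bullet> d' t)) \<le> exp (- (2*M+1) * t) * ((2*M+1) * (d t \<bullet> d t + e\<^sup>2))"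
      by (intro mult_left_mono) auto
    then show ?thesis unfolding g'_def by (simp only: algebra_simps) 
  qed
  have "\<exists>x\<in>{0..r}. g r - g 0 = g' x * (r - 0)"
    by (rule mvt_very_simple) (use r g in auto)
  then have "g r \<le> g 0" using g' r
    by (smt (verit) atLeastAtMost_iff mult_nonneg_nonpos2 mult_nonpos_nonneg)
  then have *: "exp (- (2*M+1) * r) * (d r \<bullet> d r + e\<^sup>2) \<le> d 0 \<bullet> d 0 + e\<^sup>2"
    by (simp add: g_def)
  have "d r \<bullet> d r + e\<^sup>2 = exp ((2*M+1) * r) * (exp (- (2*M+1) * r) * (d r \<bullet> d r + e\<^sup>2))"
    using exp_minus_inverse[of "(2*M+1) * r"] by (metis mult.assoc mult_1 mult_minus_left)
  also have "\<dots> \<le> exp ((2*M+1) * r) * (d 0 \<bullet> d 0 + e\<^sup>2)"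
    using * by (intro mult_left_mono) auto
  also have "\<dots> \<le> exp (2 * (M+1)) * (norm (d 0) + e)\<^sup>2"
  proof (rule mult_mono)
    have "(2*M+1) * r \<le> (2*M+1) * 1" using r M by (intro mult_left_mono) auto
    then show "exp ((2*M+1) * r) \<le> exp (2 * (M+1))" by simp
    show "d 0 \<bullet> d 0 + e\<^sup>2 \<le> (norm (d 0) + e)\<^sup>2"
      using e by (simp add: power2_sum power2_norm_eq_inner)
  qed auto
  also have "\<dots> = ((norm (d 0) + e) * exp (M+1))\<^sup>2"
    by (simp only: power_mult_distrib exp_double) (rule mult.commute)
  finally have "(norm (d r))\<^sup>2 + e\<^sup>2 \<le> ((norm (d 0) + e) * exp (M+1))\<^sup>2"
    by (simp only: power2_norm_eq_inner)
  then have "(norm (d r))\<^sup>2 \<le> ((norm (d 0) + e) * exp (M+1))\<^sup>2"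
    using zero_le_power2[of e] by linarith
  then show ?thesis
    by (rule power2_le_imp_le) (use e in auto)
qed

text \<open>Forward Gronwall for the time-reversed curve; it supplies the lower Lipschitz bound of
  the time-one flow.\<close>

lemma gronwall_backward:
  fixes d :: "real \<Rightarrow> 'a::real_inner"
  assumes der: "\<And>t. t \<in> {0..1} \<Longrightarrow> (d has_vector_derivative d' t) (at t within {0..1})"
    and le: "\<And>t. t \<in> {0..1} \<Longrightarrow> norm (d' t) \<le> M * norm (d t)"
    and M: "0 \<le> M"
  shows "norm (d 0) \<le> norm (d 1) * exp (M + 1)"
proof -
  have "norm (d (1 - 1)) \<le> (norm (d (1 - 0)) + 0) * exp (M + 1)"
  proof (rule gronwall_forward[of "\<lambda>t. d (1 - t)" "\<lambda>t. - d' (1 - t)"])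
    fix t :: real assume t: "t \<in> {0..1}"
    have "((\<lambda>t. 1 - t) has_vector_derivative (-1)) (at t within {0..1})"
      by (auto intro!: derivative_eq_intros)
    moreover have "(\<lambda>t::real. 1 - t) ` {0..1} \<subseteq> {0..1}" by auto
    then have "(d has_vector_derivative d' (1 - t)) (at (1 - t) within (\<lambda>t. 1 - t) ` {0..1})"
      using der[of "1 - t"] t by (auto intro: has_vector_derivative_within_subset)
    ultimately have "(d \<circ> (\<lambda>t. 1 - t) has_vector_derivative (-1) *\<^sub>R d' (1 - t)) (at t within {0..1})"
      by (rule vector_diff_chain_within)
    then show "((\<lambda>t. d (1 - t)) has_vector_derivative - d' (1 - t)) (at t within {0..1})"
      by (simp add: o_def)
    show "norm (- d' (1 - t)) \<le> M * norm (d (1 - t)) + 0" using le[of "1 - t"] t by auto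
  qed (use M in auto)
  then show ?thesis by simp
qed

text \<open>The fixed point is sought for the damped function exp(-cs) Y(s). With this weight the
  Picard map contracts on all of [0,1] at once, and no short intervals have to be glued.\<close>

lemma picard_lindelof:
  fixes F :: "real \<Rightarrow> 'a::banach \<Rightarrow> 'a"
  assumes cont: "continuous_on ({0..1} \<times> UNIV) (\<lambda>p. F (fst p) (snd p))"
    and lip: "\<And>t x z. t \<in> {0..1} \<Longrightarrow> norm (F t x - F t z) \<le> L * norm (x - z)"
  obtains Y where "Y 0 = y0"
    and "\<And>t. t \<in> {0..1} \<Longrightarrow> (Y has_vector_derivative F t (Y t)) (at t within {0..1})"
proof -
  \<comment> \<open>Twice the Lipschitz constant gives the contraction factor 1/2; the
    \<open>max\<close> keeps \<open>c\<close> positive.\<close>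
  define c where "c = 2 * max L 1"
  have c: "c > 0" "L \<le> c / 2" by (auto simp: c_def)
  \<comment> \<open>Clamping the time turns functions on [0,1] into bounded continuous functions on
    the whole line, a complete type on which the fixed point theorem applies.\<close>
  define \<tau> where "\<tau> t = max 0 (min 1 t)" for t :: real
  have \<tau>: "\<tau> t \<in> {0..1}" "continuous_on UNIV \<tau>" "t \<in> {0..1} \<Longrightarrow> \<tau> t = t" for t
    unfolding \<tau>_def by (auto intro!: continuous_intros)
  define f where "f z s = F s (exp (c * s) *\<^sub>R z s)" for z and s :: real
  define G where "G z t = exp (- c * \<tau> t) *\<^sub>R (y0 + integral {0..\<tau> t} (f z))" for z and t :: real
  have f_cont: "continuous_on {0..1} (f z)" if "continuous_on {0..1} z" for z
  proof -
    have "continuous_on {0..1} ((\<lambda>p. F (fst p) (snd p)) \<circ> (\<lambda>s. (s, exp (c * s) *\<^sub>R z s)))"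
      by (rule continuous_on_compose)
        (auto intro!: continuous_intros that continuous_on_subset[OF cont])
    then show ?thesis by (simp add: f_def[abs_def] o_def)
  qed
  have int: "(f z) integrable_on {0..r}" if "continuous_on {0..1} z" "r \<in> {0..1}" for z r
    by (rule integrable_continuous_real, rule continuous_on_subset[OF f_cont[OF that(1)]])
      (use that(2) in auto)
  have G_bcontfun: "G z \<in> bcontfun" if "continuous_on {0..1} z" for z
  proof -
    define g where "g r = exp (- c * r) *\<^sub>R (y0 + integral {0..r} (f z))" for r
    have gc: "continuous_on {0..1} g"
      unfolding g_def
      by (intro continuous_intros indefinite_integral_continuous_1 int that) auto
    have "continuous_on UNIV (g \<circ> \<tau>)"
      using \<tau> by (intro continuous_on_compose continuous_on_subset[OF gc]) auto
    moreover have "G z = g \<circ> \<tau>" by (auto simp: G_def g_def)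
    moreover have "bounded (g ` {0..1})"
      by (intro compact_imp_bounded compact_continuous_image gc) auto
    then have "bounded (range (g \<circ> \<tau>))"
      by (rule bounded_subset) (use \<tau>(1) in auto)
    ultimately show ?thesis by (simp add: bcontfun_def)
  qed
  have G_dist: "norm (G z t - G w t) \<le> 1/2 * D"
    if "continuous_on {0..1} z" "continuous_on {0..1} w" "\<And>s. norm (z s - w s) \<le> D" for z w t D
  proof -
    define r where "r = \<tau> t"
    have r: "r \<in> {0..1}" using \<tau> r_def by auto
    have D: "D \<ge> 0" using that(3)[of 0] norm_ge_zero order_trans by blast
    have E: "((\<lambda>s. c / 2 * D * exp (c * s)) has_integral (D / 2 * exp (c * r) - D / 2 * exp (c * 0))) {0..r}"
      by (rule fundamental_theorem_of_calculus)
        (use r in \<open>auto intro!: derivative_eq_intros simp: has_real_derivative_iff_has_vector_derivative[symmetric]\<close>)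
    have "norm (integral {0..r} (\<lambda>s. f z s - f w s)) \<le> integral {0..r} (\<lambda>s. c / 2 * D * exp (c * s))"
    proof (rule integral_norm_bound_integral)
      show "(\<lambda>s. f z s - f w s) integrable_on {0..r}"
        by (intro integrable_diff int that r)
      show "(\<lambda>s. c / 2 * D * exp (c * s)) integrable_on {0..r}" using E by blast
      fix s assume s: "s \<in> {0..r}"
      have "norm (f z s - f w s) \<le> L * norm (exp (c * s) *\<^sub>R z s - exp (c * s) *\<^sub>R w s)"
        unfolding f_def using s r by (intro lip) auto
      also have "\<dots> = L * (exp (c * s) * norm (z s - w s))"
        by (simp add: scaleR_diff_right[symmetric])
      also have "\<dots> \<le> (c/2) * (exp (c * s) * D)"
        using c D that(3)[of s] by (intro mult_mono) auto
      finally show "norm (f z s - f w s) \<le> c / 2 * D * exp (c * s)" by (simp add: mult_ac)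
    qed
    also have "\<dots> \<le> D / 2 * exp (c * r)"
      using integral_unique[OF E] D by simp
    finally have "norm (integral {0..r} (f z) - integral {0..r} (f w)) \<le> D / 2 * exp (c * r)"
      using int that r by (subst integral_diff[symmetric]) auto
    moreover have "G z t - G w t = exp (- c * r) *\<^sub>R (integral {0..r} (f z) - integral {0..r} (f w))"
      by (simp add: G_def r_def scaleR_add_right scaleR_diff_right)
    ultimately have "norm (G z t - G w t) \<le> exp (- c * r) * (D / 2 * exp (c * r))"
      by simp
    also have "\<dots> = D / 2 * (exp (- c * r) * exp (c * r))" by simp
    also have "\<dots> = 1/2 * D" by (simp add: exp_add[symmetric])
    finally show ?thesis .
  qed
  define H where "H z = Bcontfun (G (apply_bcontfun z))" for z
  have cz: "continuous_on S (apply_bcontfun z)" for S and z :: "real \<Rightarrow>\<^sub>C 'a"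
    using apply_bcontfun[of z] continuous_on_subset[of UNIV] by (auto simp: bcontfun_def)
  have H: "apply_bcontfun (H z) = G (apply_bcontfun z)" for z
    unfolding H_def by (rule Bcontfun_inverse) (intro G_bcontfun cz)
  have "\<exists>!z. H z = z"
  proof (rule banach_fix_type[of "1/2"])
    show "\<forall>z w. dist (H z) (H w) \<le> 1/2 * dist z w"
      by (intro allI dist_bound)
        (unfold H dist_norm, rule G_dist[OF cz cz],
          metis dist_norm dist_bounded)
  qed auto
  then obtain z where z: "H z = z" by blast
  define w where "w = apply_bcontfun z"
  have w: "G w = w" using H[of z] z by (simp add: w_def)
  have wc: "continuous_on {0..1} w" using cz w_def by auto
  define Y where "Y t = y0 + integral {0..t} (f w)" for t
  have Yw: "exp (c * t) *\<^sub>R w t = Y t" if "t \<in> {0..1}" for t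
  proof -
    have "w t = exp (- c * t) *\<^sub>R Y t"
      using \<tau>(3)[OF that] by (subst w[symmetric]) (simp add: G_def Y_def)
    then show ?thesis by (simp add: exp_add[symmetric])
  qed
  show thesis
  proof
    show "Y 0 = y0" by (simp add: Y_def)
    fix t :: real assume t: "t \<in> {0..1}"
    have "((\<lambda>u. integral {0..u} (f w)) has_vector_derivative f w t) (at t within {0..1})"
      by (rule integral_has_vector_derivative[OF f_cont[OF wc] t])
    then have "(Y has_vector_derivative f w t) (at t within {0..1})"
      unfolding Y_def using has_vector_derivative_add[OF has_vector_derivative_const] by fastforce
    then show "(Y has_vector_derivative F t (Y t)) (at t within {0..1})"
      by (simp add: f_def Yw[OF t])
  qed
qed

subsection \<open>Flows of fields with constant brackets\<close>

lemma norm_telescope_le: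
  fixes f :: "nat \<Rightarrow> 'a::real_normed_vector"
  assumes "\<And>k. k < n \<Longrightarrow> norm (f (Suc k) - f k) \<le> c"
  shows "norm (f n - f 0) \<le> real n * c"
proof -
  have "norm (f n - f 0) = norm (\<Sum>k<n. f (Suc k) - f k)"
    by (simp add: sum_lessThan_telescope)
  also have "\<dots> \<le> (\<Sum>k<n. c)"
    by (rule sum_norm_le) (use assms in auto)
  finally show ?thesis by simp
qed

text \<open>Over n equal steps the increments add up to at most C/n. This turns the second-order
  estimate of \<open>E_step\<close> into an exact identity.\<close>

lemma quadratic_increments_const:
  fixes f :: "real \<Rightarrow> 'a::real_normed_vector"
  assumes "\<And>s t. 0 \<le> s \<Longrightarrow> s \<le> t \<Longrightarrow> t \<le> 1 \<Longrightarrow> norm (f t - f s) \<le> C * (t - s)\<^sup>2"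
  shows "f 1 = f 0"
proof -
  have *: "norm (f 1 - f 0) \<le> C * inverse (real (Suc n))" for n
  proof -
    let ?N = "real (Suc n)"
    have "norm (f (real (Suc n) / ?N) - f (real 0 / ?N)) \<le> ?N * (C * (1 / ?N)\<^sup>2)"
    proof (rule norm_telescope_le)
      fix k assume "k < Suc n"
      then have "norm (f (real (Suc k) / ?N) - f (real k / ?N)) \<le> C * (real (Suc k) / ?N - real k / ?N)\<^sup>2"
        by (intro assms) (auto simp: field_simps)
      also have "real (Suc k) / ?N - real k / ?N = 1 / ?N" by (simp add: field_simps)
      finally show "norm (f (real (Suc k) / ?N) - f (real k / ?N)) \<le> C * (1 / ?N)\<^sup>2" .
    qed
    moreover have "?N * (C * (1 / ?N)\<^sup>2) = C * inverse ?N"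
      by (simp add: power2_eq_square divide_inverse del: of_nat_Suc)
    ultimately show ?thesis by (simp del: of_nat_Suc)
  qed
  have "(\<lambda>n. C * inverse (real (Suc n))) \<longlonglongrightarrow> C * 0"
    by (intro tendsto_intros LIMSEQ_inverse_real_of_nat)
  then have "norm (f 1 - f 0) \<le> C * 0"
    by (rule LIMSEQ_le_const) (use * in auto)
  then show ?thesis by simp
qed

text \<open>The bracket of a constant field c with \<open>V i\<close> is \<open>V' i x c\<close>. So
  \<open>V'_K\<close> and \<open>V'_in_K\<close> say that bracketing with the fields sends constant
  fields from \<open>K\<close> to constant fields from \<open>K\<close>. In the application
  \<open>K\<close> is the span of the values of all brackets of order at least two.\<close>

locale constant_bracket_fields =
  fixes V :: "'d::finite \<Rightarrow> 'a::euclidean_space \<Rightarrow> 'a" and V' :: "'d \<Rightarrow> 'a \<Rightarrow> 'a \<Rightarrow> 'a"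
    and K :: "'a set" and L :: real
  assumes deriv: "(V i has_derivative V' i x) (at x)"
    and V'_bound: "norm (V' i x v) \<le> L * norm v"
    and V'_lip: "norm (V' i x v - V' i z v) \<le> L * norm (x - z) * norm v"
    and subspace_K: "subspace K"
    and V'_K: "c \<in> K \<Longrightarrow> V' i x c = V' i 0 c"
    and V'_in_K: "c \<in> K \<Longrightarrow> V' i 0 c \<in> K"
    and bracket_const: "V' j x (V i x) - V' i x (V j x) = V' j 0 (V i 0) - V' i 0 (V j 0)"
    and bracket_in_K: "V' j 0 (V i 0) - V' i 0 (V j 0) \<in> K"
begin

definition W :: "real^'d \<Rightarrow> 'a \<Rightarrow> 'a" where "W u x = (\<Sum>i\<in>UNIV. u $ i *\<^sub>R V i x)"
definition DW :: "real^'d \<Rightarrow> 'a \<Rightarrow> 'a \<Rightarrow> 'a" where "DW u x v = (\<Sum>i\<in>UNIV. u $ i *\<^sub>R V' i x v)"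
definition M :: real where "M = real CARD('d) * L"
definition N :: real where "N = (\<Sum>i\<in>UNIV. norm (V i 0))"

lemma linear_V': "linear (V' i x)"
  using deriv has_derivative_linear by blast

lemma L_nonneg: "0 \<le> L"
proof -
  obtain b :: 'a where "b \<in> Basis" using nonempty_Basis by blast
  then show ?thesis using order_trans[OF norm_ge_zero V'_bound[of _ _ b]] by simp
qed

lemma M_nonneg: "0 \<le> M" by (simp add: M_def L_nonneg)
lemma N_nonneg: "0 \<le> N" by (simp add: N_def sum_nonneg)

lemma W_linear: "W (u + w) x = W u x + W w x" "W (s *\<^sub>R u) x = s *\<^sub>R W u x" "W (- u) x = - W u x" "W 0 x = 0"
  by (simp_all add: W_def scaleR_add_left sum.distrib scaleR_sum_right sum_negf)

lemma DW_linear: "DW (u + w) x v = DW u x v + DW w x v" "DW (s *\<^sub>R u) x v = s *\<^sub>R DW u x v" "DW (- u) x v = - DW u x v"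
  by (simp_all add: DW_def scaleR_add_left sum.distrib scaleR_sum_right sum_negf)

lemma linear_DW: "linear (DW u x)"
  unfolding DW_def by (intro linear_compose_sum ballI linear_compose_scale_right linear_V')

lemma W_deriv: "(W u has_derivative DW u x) (at x)"
  unfolding W_def DW_def by (auto intro!: derivative_eq_intros deriv)

lemma norm_weighted_sum_le:
  fixes f :: "'d \<Rightarrow> 'a"
  assumes "\<And>i. norm (f i) \<le> L * b"
  shows "norm (\<Sum>i\<in>UNIV. u $ i *\<^sub>R f i) \<le> M * norm u * b"
proof -
  have "norm (\<Sum>i\<in>UNIV. u $ i *\<^sub>R f i) \<le> (\<Sum>i\<in>(UNIV::'d set). norm u * (L * b))"
    by (rule sum_norm_le) (auto intro!: mult_mono assms component_le_norm_cart)
  then show ?thesis by (simp add: M_def mult_ac)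
qed

lemma DW_bound: "norm (DW u x v) \<le> M * norm u * norm v"
  unfolding DW_def by (rule norm_weighted_sum_le) (rule V'_bound)

lemma DW_lip: "norm (DW u x v - DW u z v) \<le> M * norm u * norm (x - z) * norm v"
proof -
  have "norm (DW u x v - DW u z v) \<le> M * norm u * (norm (x - z) * norm v)"
    unfolding DW_def sum_subtractf[symmetric] scaleR_diff_right[symmetric]
    by (rule norm_weighted_sum_le) (use V'_lip in \<open>simp add: mult.assoc\<close>)
  then show ?thesis by (simp add: mult.assoc)
qed

lemma W_lip: "norm (W u x - W u z) \<le> M * norm u * norm (x - z)"
  by (rule differentiable_bound[of UNIV "W u" "DW u"])
    (auto intro!: onorm_le DW_bound W_deriv)

lemma W_taylor: "norm (W u (x + h) - W u x - DW u x h) \<le> M * norm u * (norm h)\<^sup>2"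
proof -
  have "norm (W u (x + h) - W u x - DW u x (x + h - x)) \<le> norm (x + h - x) * (M * norm u * norm h)"
  proof (rule differentiable_bound_linearization[of x "x + h" "closed_segment x (x+h)" "W u" "DW u" x])
    fix z assume z: "z \<in> closed_segment x (x + h)"
    show "(W u has_derivative DW u z) (at z within closed_segment x (x + h))"
      using W_deriv has_derivative_at_withinI by blast
    have "norm (z - x) \<le> norm h"
      using segment_bound(1)[OF z] by simp
    then have "M * norm u * norm (z - x) * norm v \<le> M * norm u * norm h * norm v" for v :: 'a
      using M_nonneg by (intro mult_right_mono mult_left_mono) auto
    then show "onorm (DW u z - DW u x) \<le> M * norm u * norm h"
      by (intro onorm_le) (use order_trans[OF DW_lip[of u z _ x]] in simp)
  next
    fix t :: real assume "t \<in> {0..1}"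
    then show "x + t *\<^sub>R (x + h - x) \<in> closed_segment x (x + h)"
      by (auto simp: in_segment algebra_simps intro!: exI[of _ t])
  qed auto
  then show ?thesis by (simp add: power2_eq_square mult_ac)
qed

lemma W_growth: "norm (W u x) \<le> norm u * (M * norm x + N)"
proof -
  have "norm (W u 0) \<le> (\<Sum>i\<in>UNIV. norm u * norm (V i 0))"
    unfolding W_def by (rule sum_norm_le) (auto intro!: mult_right_mono component_le_norm_cart)
  then have "norm (W u 0) \<le> norm u * N" by (simp add: N_def sum_distrib_left)
  then show ?thesis using W_lip[of u x 0] norm_triangle_sub[of "W u x" "W u 0"]
    by (simp add: algebra_simps)
qed

lemma DW_K: "c \<in> K \<Longrightarrow> DW u x c = DW u 0 c"
  unfolding DW_def by (intro sum.cong refl arg_cong[where f = "scaleR _"] V'_K)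

lemma DW_in_K: "c \<in> K \<Longrightarrow> DW u 0 c \<in> K"
  unfolding DW_def by (intro subspace_sum subspace_scale subspace_K V'_in_K)

text \<open>Along a line in a direction of \<open>K\<close> the derivative of \<open>W u\<close> is
  the fixed vector \<open>DW u 0 c\<close>, so \<open>W u\<close> is affine there.\<close>

lemma W_shift:
  assumes "c \<in> K"
  shows "W u (x + c) = W u x + DW u 0 c"
proof -
  let ?f = "\<lambda>t::real. W u (x + t *\<^sub>R c) - t *\<^sub>R DW u 0 c"
  have "(?f has_derivative (\<lambda>h. 0)) (at t within UNIV)" for t
  proof -
    have "t *\<^sub>R c \<in> K" for t by (intro subspace_scale subspace_K assms)
    have "((\<lambda>t. W u (x + t *\<^sub>R c)) has_derivative (\<lambda>h. DW u (x + t *\<^sub>R c) (h *\<^sub>R c))) (at t within UNIV)"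
      by (rule has_derivative_compose[where f = "\<lambda>t. x + t *\<^sub>R c" and f' = "\<lambda>h. h *\<^sub>R c"])
        (auto intro!: derivative_eq_intros W_deriv)
    moreover have "DW u (x + t *\<^sub>R c) (h *\<^sub>R c) = h *\<^sub>R DW u 0 c" for h
      by (simp add: linear_cmul[OF linear_DW] DW_K[OF assms, of u "x + t *\<^sub>R c"])
    ultimately show ?thesis by (auto intro!: derivative_eq_intros)
  qed
  then have "?f 1 = ?f 0"
    using has_derivative_zero_unique[of UNIV ?f] by blast
  then show ?thesis by (simp add: algebra_simps)
qed

text \<open>The Lie bracket of the fields \<open>W u\<close> and \<open>W w\<close>. It is a
  constant field, so its value at 0 represents it.\<close>

definition bracket :: "real^'d \<Rightarrow> real^'d \<Rightarrow> 'a" where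
  "bracket u w = DW w 0 (W u 0) - DW u 0 (W w 0)"

lemma DW_W_expand: "DW w x (W u x) = (\<Sum>i\<in>UNIV. \<Sum>j\<in>UNIV. (u $ i * w $ j) *\<^sub>R V' j x (V i x))"
proof -
  have "DW w x (W u x) = (\<Sum>j\<in>UNIV. \<Sum>i\<in>UNIV. (u $ i * w $ j) *\<^sub>R V' j x (V i x))"
    unfolding DW_def W_def
    by (simp add: linear_sum[OF linear_V'] linear_cmul[OF linear_V'] scaleR_sum_right mult.commute)
  then show ?thesis by (subst sum.swap)
qed

lemma DW_W_sum: "DW w x (W u x) - DW u x (W w x) =
    (\<Sum>i\<in>UNIV. \<Sum>j\<in>UNIV. (u $ i * w $ j) *\<^sub>R (V' j x (V i x) - V' i x (V j x)))"
proof -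
  have "DW u x (W w x) = (\<Sum>i\<in>UNIV. \<Sum>j\<in>UNIV. (u $ i * w $ j) *\<^sub>R V' i x (V j x))"
    unfolding DW_W_expand[of u x w] by (subst sum.swap) (simp only: mult.commute)
  then show ?thesis
    by (simp add: DW_W_expand[of w x u] sum_subtractf scaleR_diff_right)
qed

lemma bracket_eq: "DW w x (W u x) - DW u x (W w x) = bracket u w"
  unfolding bracket_def DW_W_sum
  by (intro sum.cong refl arg_cong[where f = "scaleR _"] bracket_const)

lemma bracket_K: "bracket u w \<in> K"
  unfolding bracket_def DW_W_sum
  by (intro subspace_sum subspace_scale subspace_K bracket_in_K)

lemma bracket_bound: "norm (bracket u w) \<le> 2 * M * N * norm u * norm w"
proof -
  have *: "norm (DW w 0 (W u 0)) \<le> M * N * norm u * norm w" for u w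
    using order_trans[OF DW_bound mult_left_mono[OF W_growth[of u 0]], of w 0] M_nonneg
    by (simp add: mult_ac)
  show ?thesis
    unfolding bracket_def
    using norm_triangle_ineq4[of "DW w 0 (W u 0)" "DW u 0 (W w 0)"] *[of w u] *[of u w]
    by (simp add: mult_ac)
qed

section \<open>Time-one maps of the fields and their dependence on the field\<close>

definition solves :: "real^'d \<Rightarrow> (real \<Rightarrow> 'a) \<Rightarrow> bool" where
  "solves u Y \<longleftrightarrow> (\<forall>t\<in>{0..1}. (Y has_vector_derivative W u (Y t)) (at t within {0..1}))"

text \<open>Solutions are prescribed only on [0,1] and may differ elsewhere; the choice is harmless
  because \<open>E\<close> reads the common value at time 1.\<close>

definition flow :: "real^'d \<Rightarrow> 'a \<Rightarrow> real \<Rightarrow> 'a" where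
  "flow u y = (SOME Y. Y 0 = y \<and> solves u Y)"

definition E :: "real^'d \<Rightarrow> 'a \<Rightarrow> 'a" where "E u y = flow u y 1"

lemma continuous_on_W: "continuous_on S (W u)"
  by (intro continuous_at_imp_continuous_on ballI has_derivative_continuous[OF W_deriv])

lemma flow_solves: "flow u y 0 = y" "solves u (flow u y)"
proof -
  have "continuous_on ({0..1} \<times> UNIV) (\<lambda>p. W u (snd (p :: real \<times> 'a)))"
    by (rule continuous_on_compose2[OF continuous_on_W[of UNIV]])
      (auto intro!: continuous_intros)
  then obtain Y where "Y 0 = y" "\<And>t. t \<in> {0..1} \<Longrightarrow> (Y has_vector_derivative W u (Y t)) (at t within {0..1})"
    using picard_lindelof[of "\<lambda>t. W u" "M * norm u" y] W_lip by metis
  then have "\<exists>Y. Y 0 = y \<and> solves u Y" by (auto simp: solves_def)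
  from someI_ex[OF this] show "flow u y 0 = y" "solves u (flow u y)"
    by (auto simp: flow_def)
qed

lemma flow_deriv: "t \<in> {0..1} \<Longrightarrow> (flow u y has_vector_derivative W u (flow u y t)) (at t within {0..1})"
  using flow_solves(2) by (auto simp: solves_def)

text \<open>Gronwall for the distance between a guessed curve and the true one. An estimate for
  \<open>E\<close> thereby reduces to choosing a curve and computing its defect.\<close>

lemma E_approx:
  assumes p: "\<And>t. t \<in> {0..1} \<Longrightarrow> (p has_vector_derivative p' t) (at t within {0..1})"
    and le: "\<And>t. t \<in> {0..1} \<Longrightarrow> norm (p' t - W u (p t)) \<le> e" and "0 \<le> e"
  shows "norm (p 1 - E u y) \<le> (norm (p 0 - y) + e) * exp (M * norm u + 1)"
proof -
  have "norm (p 1 - flow u y 1) \<le> (norm (p 0 - flow u y 0) + e) * exp (M * norm u + 1)"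
  proof (rule gronwall_forward)
    fix t :: real assume t: "t \<in> {0..1}"
    show "((\<lambda>t. p t - flow u y t) has_vector_derivative p' t - W u (flow u y t)) (at t within {0..1})"
      by (intro has_vector_derivative_diff p flow_deriv t)
    have "p' t - W u (flow u y t) = (W u (p t) - W u (flow u y t)) + (p' t - W u (p t))" by simp
    then show "norm (p' t - W u (flow u y t)) \<le> M * norm u * norm (p t - flow u y t) + e"
      using norm_triangle_le[OF add_mono[OF W_lip le[OF t]]] by metis
  qed (use M_nonneg assms in auto)
  then show ?thesis by (simp add: E_def flow_solves)
qed

lemma E_unique:
  assumes "solves u p"
  shows "p 1 = E u (p 0)"
proof -
  have "norm (p 1 - E u (p 0)) \<le> (norm (p 0 - p 0) + 0) * exp (M * norm u + 1)"
    by (rule E_approx[where p' = "\<lambda>t. W u (p t)"]) (use assms in \<open>auto simp: solves_def\<close>)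
  then show ?thesis by simp
qed

lemma E_zero: "E 0 y = y"
  using E_unique[of 0 "\<lambda>_. y"] by (simp add: solves_def W_linear)

lemma E_lip: "norm (E u x - E u y) \<le> norm (x - y) * exp (M * norm u + 1)"
  using E_approx[of "flow u x" "\<lambda>t. W u (flow u x t)" u 0 y] flow_deriv
  by (simp add: E_def flow_solves)

lemma E_lower: "norm (x - y) \<le> norm (E u x - E u y) * exp (M * norm u + 1)"
proof -
  have "norm (flow u x 0 - flow u y 0) \<le> norm (flow u x 1 - flow u y 1) * exp (M * norm u + 1)"
  proof (rule gronwall_backward)
    fix t :: real assume t: "t \<in> {0..1}"
    show "((\<lambda>t. flow u x t - flow u y t) has_vector_derivative W u (flow u x t) - W u (flow u y t)) (at t within {0..1})"
      by (intro has_vector_derivative_diff flow_deriv t)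
  qed (use M_nonneg W_lip in auto)
  then show ?thesis by (simp add: E_def flow_solves)
qed

lemma flow_bound:
  assumes "t \<in> {0..1}" "norm u \<le> r" "norm y \<le> R"
  shows "norm (flow u y t) \<le> (R + r * N) * exp (M * r + 1)"
proof -
  have "norm (flow u y t) \<le> (norm (flow u y 0) + norm u * N) * exp (M * norm u + 1)"
  proof (rule gronwall_forward[OF flow_deriv])
    show "norm (W u (flow u y t)) \<le> M * norm u * norm (flow u y t) + norm u * N" for t
      using W_growth[of u "flow u y t"] by (simp add: algebra_simps)
  qed (use assms M_nonneg N_nonneg in auto)
  also have "\<dots> \<le> (R + r * N) * exp (M * r + 1)"
    using assms M_nonneg N_nonneg order_trans[OF norm_ge_zero assms(2)] order_trans[OF norm_ge_zero assms(3)]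
    by (intro mult_mono add_mono) (auto simp: flow_solves intro!: mult_left_mono mult_mono)
  finally show ?thesis .
qed

lemma flow_speed:
  assumes "t \<in> {0..1}" "norm u \<le> r" "norm y \<le> R"
  shows "norm (W w (flow u y t)) \<le> norm w * (M * ((R + r * N) * exp (M * r + 1)) + N)"
  using M_nonneg flow_bound[OF assms]
  by (intro order_trans[OF W_growth] mult_left_mono add_right_mono) auto

text \<open>This is the equation of the correction in \<open>E_step\<close>, where the bracket acts
  with the remaining time 1 - t as weight; \<open>E_shift\<close> is the case of zero forcing. The
  right-hand side does not involve any base point.\<close>

lemma affine_solution_in_K:
  assumes "\<kappa> \<in> K" "e0 \<in> K"
  obtains e where "e 0 = e0" "\<And>t. t \<in> {0..1} \<Longrightarrow> e t \<in> K"
    "\<And>t. t \<in> {0..1} \<Longrightarrow> (e has_vector_derivative DW u 0 (e t) + (1 - t) *\<^sub>R \<kappa>) (at t within {0..1})"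
    "\<And>t. t \<in> {0..1} \<Longrightarrow> norm (e t) \<le> (norm e0 + norm \<kappa>) * exp (M * norm u + 1)"
proof -
  \<comment> \<open>A linear projection onto \<open>K\<close>. Composing with it makes the
    right-hand side \<open>K\<close>-valued for every argument, so the component of the solution
    outside \<open>K\<close> has derivative zero and stays at its initial value 0.\<close>
  obtain P :: "'a \<Rightarrow> 'a" where P: "range P \<subseteq> K" "linear P" "\<And>v. v \<in> K \<Longrightarrow> P v = v"
    using linear_exists_left_inverse_on[OF linear_id subspace_K] by (auto simp: inj_on_def)
  interpret P: bounded_linear P using P(2) by (simp add: linear_conv_bounded_linear)
  interpret D: bounded_linear "DW u 0" using linear_DW by (simp add: linear_conv_bounded_linear)
  define F where "F t x = DW u 0 (P x) + (1 - t) *\<^sub>R \<kappa>" for t :: real and x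
  have "norm (F t x - F t z) \<le> (M * norm u * onorm P) * norm (x - z)" for t x z
  proof -
    have "norm (F t x - F t z) = norm (DW u 0 (P (x - z)))"
      by (simp add: F_def D.diff P.diff)
    also have "\<dots> \<le> M * norm u * (onorm P * norm (x - z))"
      using M_nonneg by (intro order_trans[OF DW_bound] mult_left_mono onorm P.bounded_linear_axioms) auto
    finally show ?thesis by (simp add: mult_ac)
  qed
  moreover have "continuous_on ({0..1} \<times> UNIV) (\<lambda>p. F (fst p) (snd p))"
    unfolding F_def by (intro continuous_intros D.continuous_on P.continuous_on)
  ultimately obtain e where e: "e 0 = e0"
    "\<And>t. t \<in> {0..1} \<Longrightarrow> (e has_vector_derivative F t (e t)) (at t within {0..1})"
    using picard_lindelof[of F _ e0] by metis
  have FK: "F t x \<in> K" for t x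
    unfolding F_def using P(1) by (intro subspace_add subspace_K DW_in_K subspace_scale assms) auto
  have "((\<lambda>t. e t - P (e t)) has_vector_derivative 0) (at t within {0..1})" if "t \<in> {0..1}" for t
  proof -
    have "((\<lambda>t. e t - P (e t)) has_vector_derivative (F t (e t) - P (F t (e t)))) (at t within {0..1})"
      by (intro has_vector_derivative_diff e that P.has_vector_derivative)
    then show ?thesis using P(3)[OF FK] by simp
  qed
  then obtain c where c: "\<And>t. t \<in> {0..1} \<Longrightarrow> e t - P (e t) = c"
    using has_vector_derivative_zero_constant[of "{0..1::real}" "\<lambda>t. e t - P (e t)"] by (metis convex_real_interval(5))
  have "c = 0" using c[of 0] e(1) P(3)[OF assms(2)] by simp
  then have eP: "P (e t) = e t" if "t \<in> {0..1}" for t using c[OF that] by simp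
  then have eK: "e t \<in> K" if "t \<in> {0..1}" for t using P(1) that by (metis rangeI subsetD)
  have de: "(e has_vector_derivative DW u 0 (e t) + (1 - t) *\<^sub>R \<kappa>) (at t within {0..1})" if "t \<in> {0..1}" for t
    using e(2)[OF that] eP[OF that] by (simp add: F_def)
  have "norm (e t) \<le> (norm (e 0) + norm \<kappa>) * exp (M * norm u + 1)" if t: "t \<in> {0..1}" for t
  proof (rule gronwall_forward[OF de])
    fix t :: real assume t: "t \<in> {0..1}"
    have "norm ((1 - t) *\<^sub>R \<kappa>) \<le> norm \<kappa>"
      using t by (simp add: mult_left_le_one_le)
    then show "norm (DW u 0 (e t) + (1 - t) *\<^sub>R \<kappa>) \<le> M * norm u * norm (e t) + norm \<kappa>"
      by (intro norm_triangle_le add_mono DW_bound)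
  qed (use M_nonneg t in auto)
  then show thesis using that[of e] e(1) eK de by auto
qed

text \<open>Since \<open>W u\<close> is affine along \<open>K\<close>, adding a solution
  \<open>e\<close> of the linear equation to any trajectory gives a trajectory again, and
  \<open>e\<close> is the same for all starting points.\<close>

lemma E_shift:
  assumes "c \<in> K"
  obtains k where "\<And>y. E u (y + c) = E u y + k"
proof -
  have "0 \<in> K" using subspace_K subspace_0 by blast
  then obtain e where e: "e 0 = c" "\<And>t. t \<in> {0..1} \<Longrightarrow> e t \<in> K"
    "\<And>t. t \<in> {0..1} \<Longrightarrow> (e has_vector_derivative DW u 0 (e t) + (1 - t) *\<^sub>R 0) (at t within {0..1})"
    using affine_solution_in_K[OF _ assms, of 0 u] by metis
  have "solves u (\<lambda>t. flow u y t + e t)" for y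
    unfolding solves_def
    by (auto simp: W_shift[OF e(2)] intro!: has_vector_derivative_add flow_deriv e(3)[simplified])
  then have "flow u y 1 + e 1 = E u (flow u y 0 + e 0)" for y
    using E_unique by blast
  then have "E u (y + c) = E u y + e 1" for y
    using e(1) by (simp add: E_def flow_solves)
  then show thesis by (rule that)
qed

text \<open>In the Lie algebra, exp(-(u + \<delta>w)) after exp(\<delta>w) is exp(-u) up to a constant field in
  \<^term>\<open>K\<close>. The curve \<open>p\<close> below is the first-order guess for the flow of -(u + \<delta>w) started at
  y + \<delta> W w y; its correction \<open>e\<close> stays in \<^term>\<open>K\<close> and does not see the starting point
  because the bracket is constant and translations along \<^term>\<open>K\<close> act affinely.\<close>

lemma E_step:
  assumes r: "0 \<le> r"
  obtains C where "0 \<le> C" and "\<And>u w \<delta>. norm u \<le> r \<Longrightarrow> norm w \<le> r \<Longrightarrow> 0 \<le> \<delta> \<Longrightarrow> \<delta> \<le> 1 \<Longrightarrow>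
    \<exists>k. \<forall>y. norm y \<le> R \<longrightarrow> norm (E (- (u + \<delta> *\<^sub>R w)) (y + \<delta> *\<^sub>R W w y) - E (- u) y - k) \<le> C * \<delta>\<^sup>2"
proof -
  define G where "G = r * (M * ((\<bar>R\<bar> + r * N) * exp (M * r + 1)) + N)"
  define Q where "Q = (2 * M * N * r * r) * exp (M * r + 1)"
  define C where "C = (M * r * G\<^sup>2 + M * r * (G + Q)) * exp (M * (2 * r) + 1)"
  have G0: "0 \<le> G" and Q0: "0 \<le> Q"
    using r M_nonneg N_nonneg by (auto simp: G_def Q_def)
  then have C0: "0 \<le> C" using r M_nonneg by (simp add: C_def)
  have main: "\<exists>k. \<forall>y. norm y \<le> R \<longrightarrow> norm (E (- (u + \<delta> *\<^sub>R w)) (y + \<delta> *\<^sub>R W w y) - E (- u) y - k) \<le> C * \<delta>\<^sup>2"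
    if u: "norm u \<le> r" and w: "norm w \<le> r" and \<delta>: "0 \<le> \<delta>" "\<delta> \<le> 1" for u w \<delta>
  proof -
    have "0 \<in> K" using subspace_K subspace_0 by blast
    then obtain e where e: "e 0 = 0" "\<And>t. t \<in> {0..1} \<Longrightarrow> e t \<in> K"
      "\<And>t. t \<in> {0..1} \<Longrightarrow> (e has_vector_derivative DW (- u) 0 (e t) + (1 - t) *\<^sub>R bracket u w) (at t within {0..1})"
      "\<And>t. t \<in> {0..1} \<Longrightarrow> norm (e t) \<le> (norm (0::'a) + norm (bracket u w)) * exp (M * norm (- u) + 1)"
      using affine_solution_in_K[OF bracket_K[of u w], of 0 "- u"] by metis
    have eQ: "norm (e t) \<le> Q" if "t \<in> {0..1}" for t
    proof -
      have "norm (bracket u w) \<le> 2 * M * N * r * r"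
        using u w r M_nonneg N_nonneg
        by (intro order_trans[OF bracket_bound] mult_mono) auto
      then show ?thesis unfolding Q_def
        using u r M_nonneg N_nonneg
        by (intro order_trans[OF e(4)[OF that]] mult_mono) (auto intro!: mult_left_mono)
    qed
    have "norm (E (- (u + \<delta> *\<^sub>R w)) (y + \<delta> *\<^sub>R W w y) - E (- u) y - \<delta> *\<^sub>R e 1) \<le> C * \<delta>\<^sup>2"
      if y: "norm y \<le> R" for y
    proof -
      define Y where "Y = flow (- u) y"
      \<comment> \<open>The part of the displacement \<delta> \<open>W w\<close> that is still to be
        undone at time t. The weight 1 - t makes \<open>p\<close> start at the displaced point and
        end at \<open>E (- u) y\<close> plus the shift \<delta> \<open>e 1\<close>, free of
        \<open>W w\<close>.\<close>
      define h where "h t = ((1 - t) * \<delta>) *\<^sub>R W w (Y t)" for t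
      define p where "p t = Y t + h t + \<delta> *\<^sub>R e t" for t
      define p' where "p' t = - W u (Y t) - \<delta> *\<^sub>R W w (Y t) - ((1 - t) * \<delta>) *\<^sub>R DW w (Y t) (W u (Y t))
          + \<delta> *\<^sub>R (- DW u 0 (e t) + (1 - t) *\<^sub>R bracket u w)" for t
      have Y: "(Y has_vector_derivative - W u (Y t)) (at t within {0..1})" if "t \<in> {0..1}" for t
        using flow_deriv[OF that, of "- u" y] by (simp add: Y_def W_linear)
      have WY: "norm (W w (Y t)) \<le> G" if t: "t \<in> {0..1}" for t
      proof -
        have "norm (W w (Y t)) \<le> norm w * (M * ((\<bar>R\<bar> + r * N) * exp (M * r + 1)) + N)"
          unfolding Y_def using t u y by (intro flow_speed) auto
        also have "\<dots> \<le> G"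
          unfolding G_def using w r M_nonneg N_nonneg by (intro mult_right_mono) auto
        finally show ?thesis .
      qed
      have "norm (p 1 - E (- (u + \<delta> *\<^sub>R w)) (y + \<delta> *\<^sub>R W w y))
          \<le> (norm (p 0 - (y + \<delta> *\<^sub>R W w y)) + \<delta>\<^sup>2 * (M * r * G\<^sup>2 + M * r * (G + Q))) * exp (M * norm (- (u + \<delta> *\<^sub>R w)) + 1)"
      proof (rule E_approx)
        fix t :: real assume t: "t \<in> {0..1}"
        have "((\<lambda>t. W w (Y t)) has_derivative (\<lambda>s. DW w (Y t) (s *\<^sub>R (- W u (Y t))))) (at t within {0..1})"
          using Y[OF t, unfolded has_vector_derivative_def] W_deriv by (rule has_derivative_compose)
        then have WwY: "((\<lambda>t. W w (Y t)) has_vector_derivative - DW w (Y t) (W u (Y t))) (at t within {0..1})"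
          by (simp add: has_vector_derivative_def linear_cmul[OF linear_DW] linear_neg[OF linear_DW])
        have "((\<lambda>t. (1 - t) * \<delta>) has_real_derivative - \<delta>) (at t within {0..1})"
          by (auto intro!: derivative_eq_intros)
        then have "(h has_vector_derivative ((1 - t) * \<delta>) *\<^sub>R (- DW w (Y t) (W u (Y t))) + (- \<delta>) *\<^sub>R W w (Y t)) (at t within {0..1})"
          unfolding h_def by (intro has_vector_derivative_scaleR WwY)
        moreover have "((\<lambda>t. \<delta> *\<^sub>R e t) has_vector_derivative \<delta> *\<^sub>R (DW (- u) 0 (e t) + (1 - t) *\<^sub>R bracket u w)) (at t within {0..1})"
          by (intro bounded_linear.has_vector_derivative[OF bounded_linear_scaleR_right] e(3) t)
        ultimately have "(p has_vector_derivative (- W u (Y t) + (((1 - t) * \<delta>) *\<^sub>R (- DW w (Y t) (W u (Y t))) + (- \<delta>) *\<^sub>R W w (Y t)))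
            + \<delta> *\<^sub>R (DW (- u) 0 (e t) + (1 - t) *\<^sub>R bracket u w)) (at t within {0..1})"
          unfolding p_def by (intro has_vector_derivative_add Y t)
        moreover have "(- W u (Y t) + (((1 - t) * \<delta>) *\<^sub>R (- DW w (Y t) (W u (Y t))) + (- \<delta>) *\<^sub>R W w (Y t)))
            + \<delta> *\<^sub>R (DW (- u) 0 (e t) + (1 - t) *\<^sub>R bracket u w) = p' t"
          by (simp add: p'_def DW_linear)
        ultimately show "(p has_vector_derivative p' t) (at t within {0..1})" by simp
        have hb: "norm (h t) \<le> \<delta> * G"
        proof -
          have "(1 - t) * \<delta> \<le> \<delta>" using t \<delta> by (simp add: mult_left_le_one_le)
          then have "\<bar>(1 - t) * \<delta>\<bar> * norm (W w (Y t)) \<le> \<delta> * G"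
            using t \<delta> WY[OF t] by (intro mult_mono) auto
          then show ?thesis by (simp add: h_def)
        qed
        \<comment> \<open>Differentiating \<open>h\<close> produces \<open>DW w\<close> applied to
          \<open>W u\<close>, whereas the linearised field asks for the opposite order. Their
          difference is the bracket, which the forcing term of \<open>e\<close> cancels, so the
          defect is quadratic in \<delta>.\<close>
        have "DW w (Y t) (W u (Y t)) = bracket u w + DW u (Y t) (W w (Y t))"
          using bracket_eq[of w "Y t" u] by (simp add: algebra_simps)
        moreover have "W u (p t) = W u (Y t + h t) + \<delta> *\<^sub>R DW u 0 (e t)"
          unfolding p_def using W_shift[of "\<delta> *\<^sub>R e t"] e(2)[OF t] subspace_K
          by (simp add: subspace_scale linear_cmul[OF linear_DW])
        moreover have "DW u (Y t) (h t) = ((1 - t) * \<delta>) *\<^sub>R DW u (Y t) (W w (Y t))"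
          by (simp add: h_def linear_cmul[OF linear_DW])
        ultimately have eq: "p' t - W (- (u + \<delta> *\<^sub>R w)) (p t) =
            (W u (Y t + h t) - W u (Y t) - DW u (Y t) (h t)) + \<delta> *\<^sub>R (W w (p t) - W w (Y t))"
          unfolding W_linear p'_def by (simp add: algebra_simps)
        have "norm (W u (Y t + h t) - W u (Y t) - DW u (Y t) (h t)) \<le> M * r * (\<delta> * G)\<^sup>2"
          using u r M_nonneg hb G0 \<delta>
          by (intro order_trans[OF W_taylor] mult_mono power_mono mult_left_mono) auto
        moreover have "norm (\<delta> *\<^sub>R (W w (p t) - W w (Y t))) \<le> \<delta> * (M * r * (\<delta> * (G + Q)))"
        proof -
          have "norm (p t - Y t) \<le> norm (h t) + norm (\<delta> *\<^sub>R e t)"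
            using norm_triangle_ineq[of "h t" "\<delta> *\<^sub>R e t"] by (simp add: p_def)
          also have "\<dots> \<le> \<delta> * (G + Q)"
            using hb eQ[OF t] \<delta> by (simp add: distrib_left add_mono mult_left_mono)
          finally have "norm (W w (p t) - W w (Y t)) \<le> M * r * (\<delta> * (G + Q))"
            using w r M_nonneg by (intro order_trans[OF W_lip] mult_mono) auto
          then show ?thesis using \<delta> by (simp add: mult_left_mono)
        qed
        ultimately show "norm (p' t - W (- (u + \<delta> *\<^sub>R w)) (p t)) \<le> \<delta>\<^sup>2 * (M * r * G\<^sup>2 + M * r * (G + Q))"
          unfolding eq by (intro norm_triangle_le) (simp add: power2_eq_square algebra_simps)
      qed (use G0 Q0 r M_nonneg in auto)
      also have "p 0 = y + \<delta> *\<^sub>R W w y"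
        by (simp add: p_def h_def Y_def e(1) flow_solves)
      also have "p 1 = E (- u) y + \<delta> *\<^sub>R e 1"
        by (simp add: p_def h_def Y_def E_def)
      finally have "norm (E (- u) y + \<delta> *\<^sub>R e 1 - E (- (u + \<delta> *\<^sub>R w)) (y + \<delta> *\<^sub>R W w y))
          \<le> \<delta>\<^sup>2 * (M * r * G\<^sup>2 + M * r * (G + Q)) * exp (M * norm (- (u + \<delta> *\<^sub>R w)) + 1)" by simp
      also have "\<dots> \<le> \<delta>\<^sup>2 * (M * r * G\<^sup>2 + M * r * (G + Q)) * exp (M * (2 * r) + 1)"
      proof -
        have "\<delta> * norm w \<le> 1 * r" using \<delta> w by (intro mult_mono) auto
        then have "norm (u + \<delta> *\<^sub>R w) \<le> 2 * r"
          using u \<delta> by (intro norm_triangle_le) simp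
        then have "exp (M * norm (- (u + \<delta> *\<^sub>R w)) + 1) \<le> exp (M * (2 * r) + 1)"
          using M_nonneg by (simp add: norm_minus_cancel del: minus_add_distrib) (metis mult_left_mono)
        then show ?thesis using G0 Q0 r M_nonneg by (intro mult_left_mono) auto
      qed
      finally show ?thesis by (simp add: C_def mult_ac norm_minus_commute algebra_simps)
    qed
    then show ?thesis by blast
  qed
  show thesis by (rule that[OF C0 main])
qed

lemma flow_expansion:
  assumes "norm u \<le> r" "norm y \<le> R"
  defines "G \<equiv> M * ((R + r * N) * exp (M * r + 1)) + N"
  shows "\<And>s t. s \<in> {0..1} \<Longrightarrow> t \<in> {0..1} \<Longrightarrow> norm (flow u y t - flow u y s) \<le> norm u * G * \<bar>t - s\<bar>"
    and "\<And>s t. 0 \<le> s \<Longrightarrow> s \<le> t \<Longrightarrow> t \<le> 1 \<Longrightarrow>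
      norm (flow u y t - flow u y s - (t - s) *\<^sub>R W u (flow u y s)) \<le> M * G * (norm u)\<^sup>2 * (t - s)\<^sup>2"
proof -
  show inc: "norm (flow u y t - flow u y s) \<le> norm u * G * \<bar>t - s\<bar>" if "s \<in> {0..1}" "t \<in> {0..1}" for s t
    by (rule norm_increment_le[OF flow_deriv _ that]) (use flow_speed assms in auto)
  fix s t :: real assume st: "0 \<le> s" "s \<le> t" "t \<le> 1"
  let ?Y = "flow u y"
  have "norm ((?Y t - t *\<^sub>R W u (?Y s)) - (?Y s - s *\<^sub>R W u (?Y s))) \<le> (M * norm u * (norm u * G * (t - s))) * \<bar>t - s\<bar>"
  proof (rule norm_increment_le[where a = s and b = t])
    fix \<tau> assume \<tau>: "\<tau> \<in> {s..t}"
    then have "(?Y has_vector_derivative W u (?Y \<tau>)) (at \<tau> within {s..t})"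
      using st by (intro has_vector_derivative_within_subset[OF flow_deriv]) auto
    then show "((\<lambda>\<tau>. ?Y \<tau> - \<tau> *\<^sub>R W u (?Y s)) has_vector_derivative W u (?Y \<tau>) - W u (?Y s)) (at \<tau> within {s..t})"
      by (auto intro!: derivative_eq_intros)
    have "norm (?Y \<tau> - ?Y s) \<le> norm u * G * (t - s)"
      using inc[of s \<tau>] \<tau> st order_trans[OF norm_ge_zero, of "W u (?Y s)" "norm u * G"] flow_speed[of s u r y R u] assms
      by (intro order_trans[OF inc] mult_left_mono) auto
    then show "norm (W u (?Y \<tau>) - W u (?Y s)) \<le> M * norm u * (norm u * G * (t - s))"
      using M_nonneg by (intro order_trans[OF W_lip] mult_left_mono) auto
  qed (use st in auto)
  then show "norm (?Y t - ?Y s - (t - s) *\<^sub>R W u (?Y s)) \<le> M * G * (norm u)\<^sup>2 * (t - s)\<^sup>2"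
    using st by (simp add: power2_eq_square algebra_simps)
qed

text \<open>Switch \<open>w\<close> on gradually: follow \<open>flow w\<close> up to time t and undo
  u + t w. By \<open>E_step\<close> a short time step moves the images of \<open>y\<close> and of
  \<open>z\<close> by the same vector up to a quadratic error, so the difference of the images has
  quadratic increments and is constant in t.\<close>

lemma E_compose_diff:
  "E (- (u + w)) (E w y) - E (- (u + w)) (E w z) = E (- u) y - E (- u) z"
proof -
  define r where "r = norm u + norm w"
  define S where "S = max (norm y) (norm z)"
  \<comment> \<open>Bounds both trajectories on all of [0,1], so that \<open>E_step\<close> gives a
    single shift valid for both.\<close>
  define R where "R = (S + r * N) * exp (M * r + 1)"
  define G where "G = M * R + N"
  obtain C where C: "0 \<le> C" "\<And>u w \<delta>. norm u \<le> r \<Longrightarrow> norm w \<le> r \<Longrightarrow> 0 \<le> \<delta> \<Longrightarrow> \<delta> \<le> 1 \<Longrightarrow>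
    \<exists>k. \<forall>y. norm y \<le> R \<longrightarrow> norm (E (- (u + \<delta> *\<^sub>R w)) (y + \<delta> *\<^sub>R W w y) - E (- u) y - k) \<le> C * \<delta>\<^sup>2"
    using E_step[of r R] by (auto simp: r_def)
  define D where "D t = E (- (u + t *\<^sub>R w)) (flow w y t) - E (- (u + t *\<^sub>R w)) (flow w z t)" for t
  define C' where "C' = M * G * r\<^sup>2 * exp (M * r + 1) + C"
  have G0: "0 \<le> G"
    using M_nonneg N_nonneg
    by (auto simp: G_def R_def S_def r_def le_max_iff_disj intro!: add_nonneg_nonneg mult_nonneg_nonneg)
  have "D 1 = D 0"
  proof (rule quadratic_increments_const)
    fix s t :: real assume st: "0 \<le> s" "s \<le> t" "t \<le> 1"
    define \<delta> where "\<delta> = t - s"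
    define v where "v = u + s *\<^sub>R w"
    have \<delta>: "0 \<le> \<delta>" "\<delta> \<le> 1" using st by (auto simp: \<delta>_def)
    have le1: "norm (c *\<^sub>R w) \<le> norm w" if "0 \<le> c" "c \<le> 1" for c :: real
      using that by (simp add: mult_left_le_one_le)
    have v: "norm v \<le> r" "norm (- (v + \<delta> *\<^sub>R w)) \<le> r"
    proof -
      show "norm v \<le> r" unfolding v_def r_def using st le1[of s] by (intro norm_triangle_le) auto
      have "v + \<delta> *\<^sub>R w = u + t *\<^sub>R w" by (simp add: v_def \<delta>_def algebra_simps)
      then have "norm (- (v + \<delta> *\<^sub>R w)) = norm (u + t *\<^sub>R w)" by (simp only: norm_minus_cancel)
      then show "norm (- (v + \<delta> *\<^sub>R w)) \<le> r"
        unfolding r_def using st le1[of t] norm_triangle_ineq[of u "t *\<^sub>R w"] by linarith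
    qed
    have w: "norm w \<le> r" by (simp add: r_def)
    obtain k where k: "\<And>y. norm y \<le> R \<Longrightarrow> norm (E (- (v + \<delta> *\<^sub>R w)) (y + \<delta> *\<^sub>R W w y) - E (- v) y - k) \<le> C * \<delta>\<^sup>2"
      using C(2)[OF v(1) w \<delta>] by blast
    have one: "norm (E (- (v + \<delta> *\<^sub>R w)) (flow w x t) - E (- v) (flow w x s) - k) \<le> C' * \<delta>\<^sup>2"
      if x: "norm x \<le> S" for x
    proof -
      let ?Y = "flow w x"
      have Y: "norm (?Y s) \<le> R" unfolding R_def using st by (intro flow_bound w x) auto
      have "norm (?Y t - (?Y s + \<delta> *\<^sub>R W w (?Y s))) \<le> M * G * (norm w)\<^sup>2 * \<delta>\<^sup>2"
        using flow_expansion(2)[OF w x st] unfolding G_def R_def \<delta>_def by (simp add: algebra_simps)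
      also have "\<dots> \<le> M * G * r\<^sup>2 * \<delta>\<^sup>2"
        using w M_nonneg G0 by (intro mult_right_mono mult_left_mono power_mono) auto
      finally have "norm (?Y t - (?Y s + \<delta> *\<^sub>R W w (?Y s))) * exp (M * norm (- (v + \<delta> *\<^sub>R w)) + 1)
          \<le> M * G * r\<^sup>2 * \<delta>\<^sup>2 * exp (M * r + 1)"
        using v M_nonneg G0 by (intro mult_mono) (auto intro!: mult_left_mono simp del: norm_minus_cancel minus_add_distrib)
      then have "norm (E (- (v + \<delta> *\<^sub>R w)) (?Y t) - E (- (v + \<delta> *\<^sub>R w)) (?Y s + \<delta> *\<^sub>R W w (?Y s)))
          \<le> M * G * r\<^sup>2 * \<delta>\<^sup>2 * exp (M * r + 1)"
        using E_lip order_trans by blast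
      from norm_triangle_le[OF add_mono[OF this k[OF Y]]]
      show ?thesis by (simp add: C'_def algebra_simps)
    qed
    have vt: "v + \<delta> *\<^sub>R w = u + t *\<^sub>R w" by (simp add: v_def \<delta>_def algebra_simps)
    have "norm (D t - D s) \<le> C' * \<delta>\<^sup>2 + C' * \<delta>\<^sup>2"
      unfolding D_def v_def[symmetric] vt[symmetric]
      using norm_triangle_ineq4[of "E (- (v + \<delta> *\<^sub>R w)) (flow w y t) - E (- v) (flow w y s) - k" "E (- (v + \<delta> *\<^sub>R w)) (flow w z t) - E (- v) (flow w z s) - k"]
        one[of y] one[of z]
      by (simp add: S_def algebra_simps)
    then show "norm (D t - D s) \<le> 2 * C' * (t - s)\<^sup>2" by (simp add: \<delta>_def)
  qed
  then show ?thesis by (simp add: D_def E_def flow_solves)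
qed

text \<open>The quadratic term is exactly the contribution of a symmetric second level u u / 2 to
  the Davie expansion; the cubic remainder is what later requires an exponent above 1/3.\<close>

lemma E_taylor:
  assumes "0 \<le> r" "0 \<le> R"
  obtains C where "0 \<le> C" and "\<And>u y. norm u \<le> r \<Longrightarrow> norm y \<le> R \<Longrightarrow>
    norm (E u y - (y + W u y + (1/2) *\<^sub>R DW u y (W u y))) \<le> C * norm u ^ 3"
proof -
  define G where "G = M * ((R + r * N) * exp (M * r + 1)) + N"
  have G0: "0 \<le> G" using M_nonneg N_nonneg assms by (simp add: G_def)
  have main: "norm (E u y - (y + W u y + (1/2) *\<^sub>R DW u y (W u y))) \<le> (M * G\<^sup>2 + M * (M * G)) * norm u ^ 3"
    if u: "norm u \<le> r" and y: "norm y \<le> R" for u y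
  proof -
    let ?Y = "flow u y"
    let ?f = "\<lambda>t. ?Y t - t *\<^sub>R W u y - (t\<^sup>2 / 2) *\<^sub>R DW u y (W u y)"
    have "norm (?f 1 - ?f 0) \<le> ((M * G\<^sup>2 + M * (M * G)) * norm u ^ 3) * \<bar>1 - 0\<bar>"
    proof (rule norm_increment_le[where a = 0 and b = 1])
      fix t :: real assume t: "t \<in> {0..1}"
      show "(?f has_vector_derivative W u (?Y t) - W u y - t *\<^sub>R DW u y (W u y)) (at t within {0..1})"
        by (auto intro!: derivative_eq_intros flow_deriv[OF t])
      have 1: "norm (?Y t - y) \<le> norm u * G"
        using flow_expansion(1)[OF u y, of 0 t] t mult_left_le[of t "norm u * G"] G0
        by (simp add: flow_solves G_def)
      have 2: "norm (?Y t - y - t *\<^sub>R W u y) \<le> M * G * (norm u)\<^sup>2"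
      proof -
        have "t\<^sup>2 \<le> 1" using t by (simp add: power_le_one)
        then have "M * G * (norm u)\<^sup>2 * t\<^sup>2 \<le> M * G * (norm u)\<^sup>2"
          using G0 M_nonneg mult_left_le[of "t\<^sup>2" "M * G * (norm u)\<^sup>2"] by simp
        then show ?thesis using flow_expansion(2)[OF u y, of 0 t] t by (simp add: flow_solves G_def)
      qed
      have eq: "W u (?Y t) - W u y - t *\<^sub>R DW u y (W u y) =
        (W u (y + (?Y t - y)) - W u y - DW u y (?Y t - y)) + DW u y (?Y t - y - t *\<^sub>R W u y)"
        by (simp add: linear_diff[OF linear_DW] linear_cmul[OF linear_DW])
      have "norm (W u (y + (?Y t - y)) - W u y - DW u y (?Y t - y)) \<le> M * norm u * (norm u * G)\<^sup>2"
        using M_nonneg 1 by (intro order_trans[OF W_taylor] mult_left_mono power_mono) auto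
      moreover have "norm (DW u y (?Y t - y - t *\<^sub>R W u y)) \<le> M * norm u * (M * G * (norm u)\<^sup>2)"
        using M_nonneg 2 by (intro order_trans[OF DW_bound] mult_left_mono) auto
      ultimately show "norm (W u (?Y t) - W u y - t *\<^sub>R DW u y (W u y)) \<le> (M * G\<^sup>2 + M * (M * G)) * norm u ^ 3"
        unfolding eq by (intro norm_triangle_le) (simp add: power2_eq_square power3_eq_cube algebra_simps)
    qed auto
    then show ?thesis by (simp add: E_def flow_solves algebra_simps)
  qed
  show thesis by (rule that[of "M * G\<^sup>2 + M * (M * G)"]) (use main G0 M_nonneg in auto)
qed

end

subsection \<open>Differences of solutions along dyadic partitions\<close>

lemma dyadic_powr_tendsto_0:
  fixes c \<theta> :: real
  assumes "\<theta> > 1" "c > 0"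
  shows "(\<lambda>n. 2 ^ n * (c / 2 ^ n) powr \<theta>) \<longlonglongrightarrow> 0"
proof -
  have "2 ^ n * (c / 2 ^ n) powr \<theta> = c powr \<theta> * (2 powr (1 - \<theta>)) ^ n" for n
    using assms by (simp add: powr_divide powr_realpow[symmetric] powr_powr powr_diff field_simps powr_add[symmetric])
  moreover have "(\<lambda>n. c powr \<theta> * (2 powr (1 - \<theta>)) ^ n) \<longlonglongrightarrow> c powr \<theta> * 0"
    using powr_less_one[of 2 "1 - \<theta>"] assms
    by (intro tendsto_intros LIMSEQ_realpow_zero) auto
  ultimately show ?thesis by simp
qed

lemma dyad_pt_mono: "0 < T \<Longrightarrow> k \<le> l \<Longrightarrow> dyad_pt n T k \<le> dyad_pt n T l"
  by (simp add: dyad_pt_def divide_right_mono mult_right_mono)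

lemma dyad_pt_Suc: "dyad_pt n T (Suc k) - dyad_pt n T k = T / 2 ^ n"
  by (simp add: dyad_pt_def field_simps)

lemma dyad_pt_mem:
  assumes "0 < T" "k \<le> 2 ^ n"
  shows "dyad_pt n T k \<in> {0..T}"
proof -
  have "real k \<le> 2 ^ n" using assms(2) by (metis of_nat_le_iff of_nat_numeral of_nat_power)
  then show ?thesis using assms(1) by (simp add: dyad_pt_def field_simps)
qed

lemma dyad_pt_refine: "dyad_pt (n + m) T (k * 2 ^ m) = dyad_pt n T k"
  by (simp add: dyad_pt_def power_add field_simps)

lemma dyad_pt_tendsto:
  assumes "0 < T" "t \<in> {0..T}"
  obtains k where "\<And>n. k n \<le> 2 ^ n" "(\<lambda>n. dyad_pt n T (k n)) \<longlonglongrightarrow> t"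
proof -
  define k where "k n = nat \<lfloor>t * 2 ^ n / T\<rfloor>" for n :: nat
  have nn: "0 \<le> t * 2 ^ n / T" for n :: nat using assms by simp
  have k: "real (k n) \<le> t * 2 ^ n / T" "t * 2 ^ n / T < real (k n) + 1" for n
    using nn[of n] unfolding k_def by linarith+
  have "k n \<le> 2 ^ n" for n
  proof -
    have "t * 2 ^ n / T \<le> 2 ^ n" using assms by (simp add: field_simps)
    then have "real (k n) \<le> 2 ^ n" using k(1)[of n] by linarith
    then show ?thesis by (metis of_nat_le_iff of_nat_numeral of_nat_power)
  qed
  moreover have "(\<lambda>n. dyad_pt n T (k n)) \<longlonglongrightarrow> t"
  proof (rule real_tendsto_sandwich[OF _ _ _ tendsto_const])
    show "eventually (\<lambda>n. t - T * (1/2) ^ n \<le> dyad_pt n T (k n)) sequentially"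
    proof (rule always_eventually, rule allI)
      fix n
      have "t * 2 ^ n < (real (k n) + 1) * T" using k(2)[of n] assms by (simp add: field_simps)
      then have "t < (real (k n) + 1) * T / 2 ^ n" by (simp add: field_simps)
      then show "t - T * (1/2) ^ n \<le> dyad_pt n T (k n)"
        by (simp add: dyad_pt_def power_one_over add_divide_distrib distrib_right)
    qed
    show "eventually (\<lambda>n. dyad_pt n T (k n) \<le> t) sequentially"
    proof (rule always_eventually, rule allI)
      fix n
      have "real (k n) * T \<le> t * 2 ^ n" using k(1)[of n] assms by (simp add: field_simps)
      then show "dyad_pt n T (k n) \<le> t" by (simp add: dyad_pt_def field_simps)
    qed
    have "(\<lambda>n. t - T * (1/2) ^ n) \<longlonglongrightarrow> t - T * 0"
      by (intro tendsto_intros LIMSEQ_realpow_zero) auto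
    then show "(\<lambda>n. t - T * (1/2) ^ n) \<longlonglongrightarrow> t" by simp
  qed
  ultimately show thesis using that by blast
qed

context constant_bracket_fields begin

text \<open>The contribution of the antisymmetric part of \<open>X\<close>, i.e. of the Levy area, to the second
  order Davie expansion. No size estimate for it is ever needed: being independent of the
  base point, it cancels in differences of solutions.\<close>

definition area_term :: "('d \<Rightarrow> 'd \<Rightarrow> real \<Rightarrow> real \<Rightarrow> real) \<Rightarrow> real \<Rightarrow> real \<Rightarrow> 'a" where
  "area_term X s t = (\<Sum>i\<in>UNIV. \<Sum>j\<in>UNIV. ((X i j s t - X j i s t) / 4) *\<^sub>R (V' j 0 (V i 0) - V' i 0 (V j 0)))"

lemma area_term_K: "area_term X s t \<in> K"
  unfolding area_term_def by (intro subspace_sum subspace_scale subspace_K bracket_in_K)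

text \<open>Split \<open>X\<close> into symmetric and antisymmetric parts. The symmetric part is u u
  / 2. The antisymmetric part (X i j - X j i) / 2 sees only the antisymmetrisation of the derivative
  terms, and this second halving explains the 4 in \<open>area_term\<close>.\<close>

lemma second_order_term:
  assumes "\<And>i j. X i j s t + X j i s t = u $ i * u $ j"
  shows "(\<Sum>i\<in>UNIV. \<Sum>j\<in>UNIV. X i j s t *\<^sub>R V' j x (V i x)) = (1/2) *\<^sub>R DW u x (W u x) + area_term X s t"
proof -
  let ?B = "\<lambda>i j. V' j x (V i x)"
  have "area_term X s t = (\<Sum>i\<in>UNIV. \<Sum>j\<in>UNIV. ((X i j s t - X j i s t) / 4) *\<^sub>R (?B i j - ?B j i))"
    unfolding area_term_def
    by (intro sum.cong refl arg_cong[where f = "scaleR _"] bracket_const[symmetric])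
  also have "\<dots> = (\<Sum>i\<in>UNIV. \<Sum>j\<in>UNIV. ((X i j s t - X j i s t) / 4) *\<^sub>R ?B i j)
      - (\<Sum>i\<in>UNIV. \<Sum>j\<in>UNIV. ((X i j s t - X j i s t) / 4) *\<^sub>R ?B j i)"
    by (simp add: scaleR_diff_right sum_subtractf)
  also have "(\<Sum>i\<in>UNIV. \<Sum>j\<in>UNIV. ((X i j s t - X j i s t) / 4) *\<^sub>R ?B j i)
      = (\<Sum>i\<in>UNIV. \<Sum>j\<in>UNIV. ((X j i s t - X i j s t) / 4) *\<^sub>R ?B i j)"
    by (rule sum.swap)
  finally have "(1/2) *\<^sub>R DW u x (W u x) + area_term X s t =
      (\<Sum>i\<in>UNIV. \<Sum>j\<in>UNIV. ((u $ i * u $ j) / 2 + (X i j s t - X j i s t) / 4 - (X j i s t - X i j s t) / 4) *\<^sub>R ?B i j)"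
    unfolding DW_W_expand
    by (simp add: scaleR_sum_right scaleR_add_left scaleR_diff_left sum.distrib sum_subtractf)
  also have "\<dots> = (\<Sum>i\<in>UNIV. \<Sum>j\<in>UNIV. X i j s t *\<^sub>R ?B i j)"
    by (intro sum.cong refl arg_cong2[where f = scaleR]) (simp add: assms[symmetric] field_simps)
  finally show ?thesis by simp
qed

text \<open>The condition of \<open>rde_solution\<close> freed from the initial value, because
  solutions with different starting points are compared.\<close>

definition davie :: "real \<Rightarrow> (real \<Rightarrow> real^'d) \<Rightarrow> ('d \<Rightarrow> 'd \<Rightarrow> real \<Rightarrow> real \<Rightarrow> real) \<Rightarrow> (real \<Rightarrow> 'a) \<Rightarrow> bool" where
  "davie T x X y \<longleftrightarrow> continuous_on {0..T} y \<and>
     (\<exists>\<theta>>1. \<exists>C. \<forall>s t. 0 \<le> s \<and> s \<le> t \<and> t \<le> T \<longrightarrow>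
        norm (y t - y s - W (x t - x s) (y s) - (\<Sum>i\<in>UNIV. \<Sum>j\<in>UNIV. X i j s t *\<^sub>R V' j (y s) (V i (y s))))
        \<le> C * (t - s) powr \<theta>)"

text \<open>The expansions from \<open>E_taylor\<close> and \<open>second_order_term\<close> match
  Davie's expansion term by term, leaving his error and the cubic remainder. The symmetry of
  \<open>X\<close> is asked for at the given pair of times alone, since almost surely it is at hand
  for dyadic neighbours only.\<close>

lemma davie_local_flow:
  assumes "davie T x X y" and r: "0 \<le> r" and xr: "\<And>s t. s \<in> {0..T} \<Longrightarrow> t \<in> {0..T} \<Longrightarrow> norm (x t - x s) \<le> r"
  obtains C \<theta> where "1 < \<theta>" "0 \<le> C" and "\<And>s t. 0 \<le> s \<Longrightarrow> s \<le> t \<Longrightarrow> t \<le> T \<Longrightarrow>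
      \<forall>i j. X i j s t + X j i s t = (x t - x s) $ i * (x t - x s) $ j \<Longrightarrow>
      norm (y t - (E (x t - x s) (y s) + area_term X s t)) \<le> C * ((t - s) powr \<theta> + norm (x t - x s) ^ 3)"
proof -
  obtain \<theta> C1 where \<theta>: "\<theta> > 1" and C1: "\<And>s t. 0 \<le> s \<Longrightarrow> s \<le> t \<Longrightarrow> t \<le> T \<Longrightarrow>
        norm (y t - y s - W (x t - x s) (y s) - (\<Sum>i\<in>UNIV. \<Sum>j\<in>UNIV. X i j s t *\<^sub>R V' j (y s) (V i (y s))))
        \<le> C1 * (t - s) powr \<theta>"
    using assms(1) unfolding davie_def by blast
  have "bounded (y ` {0..T})"
    using assms(1) by (auto simp: davie_def intro!: compact_imp_bounded compact_continuous_image)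
  then obtain R where R: "0 < R" "\<And>s. s \<in> {0..T} \<Longrightarrow> norm (y s) \<le> R"
    by (auto simp: bounded_pos)
  obtain C2 where C2: "0 \<le> C2" "\<And>u y. norm u \<le> r \<Longrightarrow> norm y \<le> R \<Longrightarrow>
    norm (E u y - (y + W u y + (1/2) *\<^sub>R DW u y (W u y))) \<le> C2 * norm u ^ 3"
    using E_taylor[of r R] r R(1) by auto
  define C where "C = max (\<bar>C1\<bar>) C2"
  have "norm (y t - (E (x t - x s) (y s) + area_term X s t)) \<le> C * ((t - s) powr \<theta> + norm (x t - x s) ^ 3)"
    if st: "0 \<le> s" "s \<le> t" "t \<le> T" and sym: "\<forall>i j. X i j s t + X j i s t = (x t - x s) $ i * (x t - x s) $ j" for s t
  proof -
    define u where "u = x t - x s"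
    have 1: "norm (y t - y s - W u (y s) - ((1/2) *\<^sub>R DW u (y s) (W u (y s)) + area_term X s t)) \<le> \<bar>C1\<bar> * (t - s) powr \<theta>"
      using C1[OF st] mult_right_mono[OF abs_ge_self[of C1] powr_ge_zero[of "t - s" \<theta>]]
      unfolding u_def second_order_term[of X s t "x t - x s" "y s", OF sym[rule_format]] by linarith
    have 2: "norm (E u (y s) - (y s + W u (y s) + (1/2) *\<^sub>R DW u (y s) (W u (y s)))) \<le> C2 * norm u ^ 3"
      unfolding u_def using st by (intro C2 xr R) auto
    have "norm (y t - (E u (y s) + area_term X s t)) \<le> \<bar>C1\<bar> * (t - s) powr \<theta> + C2 * norm u ^ 3"
      using norm_triangle_ineq4[of "y t - y s - W u (y s) - ((1/2) *\<^sub>R DW u (y s) (W u (y s)) + area_term X s t)"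
          "E u (y s) - (y s + W u (y s) + (1/2) *\<^sub>R DW u (y s) (W u (y s)))"] 1 2
      by (simp add: algebra_simps)
    also have "\<dots> \<le> C * (t - s) powr \<theta> + C * norm u ^ 3"
      by (intro add_mono mult_right_mono) (auto simp: C_def)
    finally show ?thesis by (simp add: u_def distrib_left)
  qed
  then show thesis using that[OF \<theta>, of C] C2(1) by (simp add: C_def)
qed

text \<open>The quantity compared over one time step is E(-x)(y) - E(-x)(z) for two solutions y, z; it
  would be exactly conserved if the solutions moved by E(u) plus a common shift in \<^term>\<open>K\<close>.\<close>

lemma transport_step:
  fixes a g p q p' q' :: 'a
  assumes "g \<in> K" and p: "norm (p' - (E u p + g)) \<le> e1" and q: "norm (q' - (E u q + g)) \<le> e2"
  shows "norm ((E (- (v + u)) p' - E (- (v + u)) q') - (E (- v) p - E (- v) q))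
     \<le> (e1 + e2) * exp (M * norm (v + u) + 1)"
proof -
  obtain k where k: "\<And>y. E (- (v + u)) (y + g) = E (- (v + u)) y + k"
    using E_shift[OF assms(1)] by metis
  have *: "norm (E (- (v + u)) p' - (E (- (v + u)) (E u p) + k)) \<le> e1 * exp (M * norm (v + u) + 1)"
    if "norm (p' - (E u p + g)) \<le> e1" for p p' e1
    using E_lip[of "- (v + u)" p' "E u p + g"] mult_right_mono[OF that exp_ge_zero[of "M * norm (v + u) + 1"]]
    unfolding k norm_minus_cancel by linarith
  have "(E (- (v + u)) p' - E (- (v + u)) q') - (E (- v) p - E (- v) q)
    = (E (- (v + u)) p' - (E (- (v + u)) (E u p) + k)) - (E (- (v + u)) q' - (E (- (v + u)) (E u q) + k))"
    using E_compose_diff[of v u p q] by (simp add: algebra_simps)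
  then show ?thesis
    using norm_triangle_ineq4[of "E (- (v + u)) p' - (E (- (v + u)) (E u p) + k)" "E (- (v + u)) q' - (E (- (v + u)) (E u q) + k)"]
      *[OF p] *[OF q] by (simp only: distrib_right)
qed

text \<open>The time is fixed while the partition is refined: a dyadic point of level n lies on
  every level n + m. Telescoping over at most 2^(n+m) steps leaves a total error that tends to 0,
  because every error exponent exceeds 1, including 3 \<alpha>.\<close>

lemma davie_transport_dyadic:
  assumes T: "0 < T" and x: "continuous_on {0..T} x"
    and sym: "\<And>n k i j. k < 2 ^ n \<Longrightarrow>
      X i j (dyad_pt n T k) (dyad_pt n T (Suc k)) + X j i (dyad_pt n T k) (dyad_pt n T (Suc k))
        = (x (dyad_pt n T (Suc k)) - x (dyad_pt n T k)) $ i * (x (dyad_pt n T (Suc k)) - x (dyad_pt n T k)) $ j"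
    and hold: "\<And>n k. k < 2 ^ n \<Longrightarrow> norm (x (dyad_pt n T (Suc k)) - x (dyad_pt n T k)) \<le> B * (1 / 2 ^ n) powr \<alpha>"
    and \<alpha>: "\<alpha> > 1/3"
    and y: "davie T x X y" and z: "davie T x X z" and kn: "k \<le> 2 ^ n"
  shows "E (- (x (dyad_pt n T k) - x 0)) (y (dyad_pt n T k)) - E (- (x (dyad_pt n T k) - x 0)) (z (dyad_pt n T k)) = y 0 - z 0"
proof -
  have "bounded (x ` {0..T})"
    using x by (auto intro!: compact_imp_bounded compact_continuous_image)
  then obtain r0 where r0: "0 < r0" "\<And>s. s \<in> {0..T} \<Longrightarrow> norm (x s) \<le> r0"
    by (auto simp: bounded_pos)
  define r where "r = 2 * r0"
  have r: "0 \<le> r" "\<And>s t. s \<in> {0..T} \<Longrightarrow> t \<in> {0..T} \<Longrightarrow> norm (x t - x s) \<le> r"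
    using r0 norm_triangle_ineq4 unfolding r_def by (auto, smt (verit) atLeastAtMost_iff norm_triangle_ineq4)
  obtain C\<^sub>y \<theta>\<^sub>y where y: "1 < \<theta>\<^sub>y" "0 \<le> C\<^sub>y" "\<And>s t. 0 \<le> s \<Longrightarrow> s \<le> t \<Longrightarrow> t \<le> T \<Longrightarrow>
      \<forall>i j. X i j s t + X j i s t = (x t - x s) $ i * (x t - x s) $ j \<Longrightarrow>
      norm (y t - (E (x t - x s) (y s) + area_term X s t)) \<le> C\<^sub>y * ((t - s) powr \<theta>\<^sub>y + norm (x t - x s) ^ 3)"
    using davie_local_flow[OF y r] by metis
  obtain C\<^sub>z \<theta>\<^sub>z where z: "1 < \<theta>\<^sub>z" "0 \<le> C\<^sub>z" "\<And>s t. 0 \<le> s \<Longrightarrow> s \<le> t \<Longrightarrow> t \<le> T \<Longrightarrow>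
      \<forall>i j. X i j s t + X j i s t = (x t - x s) $ i * (x t - x s) $ j \<Longrightarrow>
      norm (z t - (E (x t - x s) (z s) + area_term X s t)) \<le> C\<^sub>z * ((t - s) powr \<theta>\<^sub>z + norm (x t - x s) ^ 3)"
    using davie_local_flow[OF z r] by metis
  define D where "D t = E (- (x t - x 0)) (y t) - E (- (x t - x 0)) (z t)" for t
  \<comment> \<open>Local errors of both solutions over one step of level m, multiplied by the
    Lipschitz constant of the time-one map that carries them back.\<close>
  define c where "c m = (C\<^sub>y * ((T / 2 ^ m) powr \<theta>\<^sub>y + \<bar>B\<bar> ^ 3 * (1 / 2 ^ m) powr (3 * \<alpha>))
      + C\<^sub>z * ((T / 2 ^ m) powr \<theta>\<^sub>z + \<bar>B\<bar> ^ 3 * (1 / 2 ^ m) powr (3 * \<alpha>))) * exp (M * r + 1)" for m :: nat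
  have c_nonneg: "0 \<le> c m" for m using y(2) z(2) by (simp add: c_def)
  have step: "norm (D (dyad_pt m T (Suc l)) - D (dyad_pt m T l)) \<le> c m" if l: "l < 2 ^ m" for m l
  proof -
    define s t where "s = dyad_pt m T l" and "t = dyad_pt m T (Suc l)"
    have st: "0 \<le> s" "s \<le> t" "t \<le> T" "t - s = T / 2 ^ m"
      using dyad_pt_mem[OF T, of l m] dyad_pt_mem[OF T, of "Suc l" m] dyad_pt_mono[OF T, of l "Suc l" m] dyad_pt_Suc[of m T l] l
      by (auto simp: s_def t_def)
    have sym': "\<forall>i j. X i j s t + X j i s t = (x t - x s) $ i * (x t - x s) $ j"
      unfolding s_def t_def by (intro allI sym[OF l])
    have "norm (x t - x s) \<le> \<bar>B\<bar> * (1 / 2 ^ m) powr \<alpha>"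
      unfolding s_def t_def by (rule order_trans[OF hold[OF l]]) (intro mult_right_mono, auto)
    then have "norm (x t - x s) ^ 3 \<le> (\<bar>B\<bar> * (1 / 2 ^ m) powr \<alpha>) ^ 3"
      by (intro power_mono) auto
    also have "\<dots> = \<bar>B\<bar> ^ 3 * (1 / 2 ^ m) powr (3 * \<alpha>)"
      by (simp add: power_mult_distrib powr_power mult.commute)
    finally have x3: "norm (x t - x s) ^ 3 \<le> \<bar>B\<bar> ^ 3 * (1 / 2 ^ m) powr (3 * \<alpha>)" .
    define u v where "u = x t - x s" and "v = x s - x 0"
    have uv: "v + u = x t - x 0" by (simp add: u_def v_def)
    have "norm (D t - D s) \<le> (C\<^sub>y * ((t - s) powr \<theta>\<^sub>y + norm u ^ 3) + C\<^sub>z * ((t - s) powr \<theta>\<^sub>z + norm u ^ 3)) * exp (M * norm (v + u) + 1)"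
      unfolding D_def uv[symmetric] v_def[symmetric]
      by (rule transport_step[OF area_term_K[of X s t]])
        (use y(3)[OF st(1-3) sym'] z(3)[OF st(1-3) sym'] in \<open>auto simp: u_def\<close>)
    also have "\<dots> \<le> c m"
      unfolding c_def
    proof (rule mult_mono)
      show "exp (M * norm (v + u) + 1) \<le> exp (M * r + 1)"
        unfolding uv using r(2)[of 0 t] st T M_nonneg by (simp add: mult_left_mono)
    qed (use x3 y(2) z(2) in \<open>auto simp: st(4) u_def intro!: add_mono mult_left_mono add_nonneg_nonneg mult_nonneg_nonneg\<close>)
    finally show ?thesis by (simp add: s_def t_def)
  qed
  have "norm (D (dyad_pt n T k) - D 0) \<le> 2 ^ (n + m) * c (n + m)" for m
  proof -
    have le: "k * 2 ^ m \<le> 2 ^ (n + m)" using kn by (simp add: power_add)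
    have "norm (D (dyad_pt (n + m) T (k * 2 ^ m)) - D (dyad_pt (n + m) T 0)) \<le> real (k * 2 ^ m) * c (n + m)"
      by (rule norm_telescope_le[where f = "\<lambda>l. D (dyad_pt (n + m) T l)"]) (use le step in auto)
    also have "\<dots> \<le> real (2 ^ (n + m)) * c (n + m)"
      using le c_nonneg by (intro mult_right_mono) (simp_all only: of_nat_le_iff)
    finally show ?thesis by (simp add: dyad_pt_refine) (simp add: dyad_pt_def)
  qed
  moreover have "(\<lambda>m. 2 ^ (n + m) * c (n + m)) \<longlonglongrightarrow> 0"
  proof -
    let ?h = "\<lambda>c \<theta> m. 2 ^ m * (c / 2 ^ m) powr \<theta> :: real"
    have "(\<lambda>m. (C\<^sub>y * (?h T \<theta>\<^sub>y m + \<bar>B\<bar> ^ 3 * ?h 1 (3 * \<alpha>) m) + C\<^sub>z * (?h T \<theta>\<^sub>z m + \<bar>B\<bar> ^ 3 * ?h 1 (3 * \<alpha>) m)) * exp (M * r + 1))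
       \<longlonglongrightarrow> (C\<^sub>y * (0 + \<bar>B\<bar> ^ 3 * 0) + C\<^sub>z * (0 + \<bar>B\<bar> ^ 3 * 0)) * exp (M * r + 1)"
      using y(1) z(1) \<alpha> T by (intro tendsto_intros dyadic_powr_tendsto_0) auto
    then have "(\<lambda>m. 2 ^ m * c m) \<longlonglongrightarrow> 0"
      by (simp add: c_def algebra_simps)
    then show ?thesis using LIMSEQ_ignore_initial_segment[of "\<lambda>m. 2 ^ m * c m" 0 n] by (simp add: add.commute)
  qed
  ultimately have "norm (D (dyad_pt n T k) - D 0) \<le> 0"
    by (intro LIMSEQ_le_const) auto
  then show ?thesis by (simp add: D_def E_zero)
qed

text \<open>At a dyadic time the conserved difference is squeezed between \<open>E_lip\<close> and
  \<open>E_lower\<close>; both sides are continuous in time, so the inequalities extend to all times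
  by density.\<close>

lemma davie_bilipschitz:
  assumes T: "0 < T" and x: "continuous_on {0..T} x"
    and sym: "\<And>n k i j. k < 2 ^ n \<Longrightarrow>
      X i j (dyad_pt n T k) (dyad_pt n T (Suc k)) + X j i (dyad_pt n T k) (dyad_pt n T (Suc k))
        = (x (dyad_pt n T (Suc k)) - x (dyad_pt n T k)) $ i * (x (dyad_pt n T (Suc k)) - x (dyad_pt n T k)) $ j"
    and hold: "\<And>n k. k < 2 ^ n \<Longrightarrow> norm (x (dyad_pt n T (Suc k)) - x (dyad_pt n T k)) \<le> B * (1 / 2 ^ n) powr \<alpha>"
    and \<alpha>: "\<alpha> > 1/3"
    and y: "davie T x X y" and z: "davie T x X z" and t: "t \<in> {0..T}"
  shows "norm (y t - z t) \<le> norm (y 0 - z 0) * exp (M * norm (x t - x 0) + 1)"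
    and "norm (y 0 - z 0) \<le> norm (y t - z t) * exp (M * norm (x t - x 0) + 1)"
proof -
  have dy: "norm (y t - z t) \<le> norm (y 0 - z 0) * exp (M * norm (x t - x 0) + 1)"
    "norm (y 0 - z 0) \<le> norm (y t - z t) * exp (M * norm (x t - x 0) + 1)"
    if "k \<le> 2 ^ n" "t = dyad_pt n T k" for k n t
    using davie_transport_dyadic[OF T x sym hold \<alpha> y z that(1), folded that(2)]
      E_lip[of "- (x t - x 0)" "y t" "z t"] E_lower[of "y t" "z t" "- (x t - x 0)"]
    unfolding norm_minus_cancel by simp_all
  obtain k where k: "\<And>n. k n \<le> 2 ^ n" and lim: "(\<lambda>n. dyad_pt n T (k n)) \<longlonglongrightarrow> t"
    using dyad_pt_tendsto[OF T t] by blast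
  have ev: "eventually (\<lambda>n. dyad_pt n T (k n) \<in> {0..T}) sequentially"
    using dyad_pt_mem[OF T k] by (intro always_eventually allI)
  have cont: "continuous_on {0..T} y" "continuous_on {0..T} z"
    using y z by (auto simp: davie_def)
  note L = continuous_on_tendsto_compose[OF x lim t ev] continuous_on_tendsto_compose[OF cont(1) lim t ev]
    continuous_on_tendsto_compose[OF cont(2) lim t ev]
  have L1: "(\<lambda>n. norm (y (dyad_pt n T (k n)) - z (dyad_pt n T (k n)))) \<longlonglongrightarrow> norm (y t - z t)"
    and L2: "(\<lambda>n. exp (M * norm (x (dyad_pt n T (k n)) - x 0) + 1)) \<longlonglongrightarrow> exp (M * norm (x t - x 0) + 1)"
    by (intro tendsto_intros L)+
  show "norm (y t - z t) \<le> norm (y 0 - z 0) * exp (M * norm (x t - x 0) + 1)"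
    by (rule LIMSEQ_le[OF L1 tendsto_mult[OF tendsto_const L2]]) (use dy(1)[OF k refl] in blast)
  show "norm (y 0 - z 0) \<le> norm (y t - z t) * exp (M * norm (x t - x 0) + 1)"
    by (rule LIMSEQ_le_const[OF tendsto_mult[OF L1 L2]]) (use dy(2)[OF k refl] in blast)
qed

end

subsection \<open>Fourth moments of Gaussian increments\<close>

text \<open>The density sees the deviation only through its square, and \<open>sqrt\<close> of a
  negative real is minus the root of its absolute value. This serves a quadratic form
  \<open>Q S c c\<close> about which only nonvanishing is known at that point.\<close>

lemma normal_density_abs: "normal_density 0 (sqrt v) = normal_density 0 (sqrt \<bar>v\<bar>)"
proof -
  have "(sqrt v)\<^sup>2 = (sqrt \<bar>v\<bar>)\<^sup>2"
    by (simp add: real_sqrt_power[symmetric])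
  then show ?thesis by (intro ext) (simp only: normal_density_def)
qed

lemma normal_fourth_moment:
  assumes "distributed M lborel X (\<lambda>x. ennreal (normal_density 0 \<sigma> x))" "0 < \<sigma>"
  shows "has_bochner_integral M (\<lambda>\<omega>. X \<omega> ^ 4) (3 * \<sigma> ^ 4)"
proof -
  have *: "has_bochner_integral lborel (\<lambda>x. normal_density 0 \<sigma> x * x ^ 4) (3 * \<sigma> ^ 4)"
    using normal_moment_even[OF assms(2), of 0 2] assms(2)
    by (simp add: fact_numeral field_simps power2_eq_square power4_eq_xxxx)
  show ?thesis
    using distributed_integrable[OF assms(1), of "\<lambda>x. x ^ 4"] distributed_integral[OF assms(1), of "\<lambda>x. x ^ 4"] *
    by (simp add: has_bochner_integral_iff)
qed

text \<open>Bound the exponential of the absolute value by the sum over both signs; completing the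
  square turns each tilted density into a shifted one of total mass 1.\<close>

lemma normal_exp_moment:
  assumes D: "distributed M lborel X (\<lambda>x. ennreal (normal_density 0 \<sigma> x))" and \<sigma>: "0 < \<sigma>"
  shows "(\<integral>\<^sup>+\<omega>. ennreal (exp (c * \<bar>X \<omega>\<bar>)) \<partial>M) \<le> ennreal (2 * exp (c\<^sup>2 * \<sigma>\<^sup>2 / 2))"
proof -
  have shift: "normal_density 0 \<sigma> x * exp (c * x) = exp (c\<^sup>2 * \<sigma>\<^sup>2 / 2) * normal_density (c * \<sigma>\<^sup>2) \<sigma> x" for c x
  proof -
    have "- x\<^sup>2 / (2 * \<sigma>\<^sup>2) + c * x = c\<^sup>2 * \<sigma>\<^sup>2 / 2 - (x - c * \<sigma>\<^sup>2)\<^sup>2 / (2 * \<sigma>\<^sup>2)"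
      using \<sigma> by (simp add: field_simps power2_eq_square)
    then show ?thesis by (simp add: normal_density_def exp_add[symmetric])
  qed
  have one: "(\<integral>\<^sup>+x. ennreal (normal_density \<mu> \<sigma> x) \<partial>lborel) = 1" for \<mu>
    using \<sigma> by (subst nn_integral_eq_integral) auto
  have int: "(\<integral>\<^sup>+x. ennreal (normal_density 0 \<sigma> x * exp (c * x)) \<partial>lborel) = ennreal (exp (c\<^sup>2 * \<sigma>\<^sup>2 / 2))" for c
    unfolding shift by (simp add: ennreal_mult nn_integral_cmult one)
  have "(\<integral>\<^sup>+\<omega>. ennreal (exp (c * \<bar>X \<omega>\<bar>)) \<partial>M) = (\<integral>\<^sup>+x. ennreal (normal_density 0 \<sigma> x) * ennreal (exp (c * \<bar>x\<bar>)) \<partial>lborel)"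
    by (rule distributed_nn_integral[OF D, symmetric]) simp
  also have "\<dots> \<le> (\<integral>\<^sup>+x. ennreal (normal_density 0 \<sigma> x * exp (c * x)) + ennreal (normal_density 0 \<sigma> x * exp ((- c) * x)) \<partial>lborel)"
  proof (rule nn_integral_mono)
    fix x
    have "exp (c * \<bar>x\<bar>) \<le> exp (c * x) + exp ((- c) * x)"
      by (cases "0 \<le> x") (auto simp: abs_if)
    then show "ennreal (normal_density 0 \<sigma> x) * ennreal (exp (c * \<bar>x\<bar>)) \<le>
        ennreal (normal_density 0 \<sigma> x * exp (c * x)) + ennreal (normal_density 0 \<sigma> x * exp ((- c) * x))"
      by (simp add: ennreal_mult[symmetric] ennreal_plus[symmetric] distrib_left[symmetric] mult_left_mono del: ennreal_plus)
  qed
  also have "\<dots> = ennreal (exp (c\<^sup>2 * \<sigma>\<^sup>2 / 2)) + ennreal (exp (c\<^sup>2 * \<sigma>\<^sup>2 / 2))"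
    using int[of c] int[of "- c"] by (subst nn_integral_add) auto
  also have "\<dots> = ennreal (2 * exp (c\<^sup>2 * \<sigma>\<^sup>2 / 2))"
    by (simp add: ennreal_plus[symmetric] del: ennreal_plus)
  finally show ?thesis .
qed

text \<open>Alternating over the signs of x, y, z kills every monomial but wxyz, which has
  coefficient 4! = 24 in each of the 8 powers; hence 192.\<close>

lemma polarisation_fourth:
  fixes w x y z :: real
  shows "(w + x + y + z) ^ 4 - (w + x + y - z) ^ 4 - (w + x - y + z) ^ 4 + (w + x - y - z) ^ 4
    - (w - x + y + z) ^ 4 + (w - x + y - z) ^ 4 + (w - x - y + z) ^ 4 - (w - x - y - z) ^ 4 = 192 * (w * x * y * z)"
  by algebra

text \<open>The same alternation applied to squared variances: \<open>d\<close> is the sum of the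
  four variances and the other letters are the six covariances. The surviving products are the three
  pairings of Wick's formula.\<close>

lemma polarisation_square:
  fixes d a b c e f g :: real
  shows "(d + 2*a + 2*b + 2*c + 2*e + 2*f + 2*g)\<^sup>2 - (d + 2*a + 2*b - 2*c + 2*e - 2*f - 2*g)\<^sup>2
    - (d + 2*a - 2*b + 2*c - 2*e + 2*f - 2*g)\<^sup>2 + (d + 2*a - 2*b - 2*c - 2*e - 2*f + 2*g)\<^sup>2
    - (d - 2*a + 2*b + 2*c - 2*e - 2*f + 2*g)\<^sup>2 + (d - 2*a + 2*b - 2*c - 2*e + 2*f - 2*g)\<^sup>2
    + (d - 2*a - 2*b + 2*c + 2*e - 2*f - 2*g)\<^sup>2 - (d - 2*a - 2*b - 2*c + 2*e + 2*f + 2*g)\<^sup>2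
    = 64 * (a * g + b * f + c * e)"
  by algebra

locale fractional_brownian =
  fixes M :: "'w measure" and H :: real and B :: "'d::finite \<Rightarrow> real \<Rightarrow> 'w \<Rightarrow> real"
  assumes fbm: "fbm M H B" and H_pos: "0 < H" and H_half: "H < 1/2"
begin

lemma prob_space_M: "prob_space M" using fbm by (simp add: fbm_def)
lemma B_measurable [measurable]: "B i t \<in> borel_measurable M" using fbm by (simp add: fbm_def)
lemma B_continuous: "\<omega> \<in> space M \<Longrightarrow> continuous_on {0..} (\<lambda>t. B i t \<omega>)" using fbm by (simp add: fbm_def)

definition cov :: "'d \<times> real \<Rightarrow> 'd \<times> real \<Rightarrow> real" where
  "cov p p' = (if fst p = fst p' then R_H H (snd p) (snd p') else 0)"
text \<open>Elements of the Gaussian space are represented by coefficient functions on one finite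
  index set; \<open>Q\<close> is then their covariance form, and sums of variables become sums of
  functions.\<close>

definition lin :: "('d \<times> real) set \<Rightarrow> ('d \<times> real \<Rightarrow> real) \<Rightarrow> 'w \<Rightarrow> real" where
  "lin S c \<omega> = (\<Sum>p\<in>S. c p * B (fst p) (snd p) \<omega>)"
definition Q :: "('d \<times> real) set \<Rightarrow> ('d \<times> real \<Rightarrow> real) \<Rightarrow> ('d \<times> real \<Rightarrow> real) \<Rightarrow> real" where
  "Q S c c' = (\<Sum>p\<in>S. \<Sum>p'\<in>S. c p * c' p' * cov p p')"

lemma lin_gaussian:
  assumes "finite S" "S \<subseteq> UNIV \<times> {0..}"
  shows "Q S c c = 0 \<Longrightarrow> AE \<omega> in M. lin S c \<omega> = 0"
    and "Q S c c \<noteq> 0 \<Longrightarrow> distributed M lborel (lin S c) (\<lambda>x. ennreal (normal_density 0 (sqrt (Q S c c)) x))"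
  using fbm assms unfolding fbm_def Let_def Q_def lin_def[abs_def] cov_def
  by (auto split: if_splits)

lemma lin_measurable [measurable]: "lin S c \<in> borel_measurable M"
  unfolding lin_def[abs_def] by measurable

lemma lin_fourth_moment:
  assumes S: "finite S" "S \<subseteq> UNIV \<times> {0..}"
  shows "has_bochner_integral M (\<lambda>\<omega>. lin S c \<omega> ^ 4) (3 * (Q S c c)\<^sup>2)"
proof (cases "Q S c c = 0")
  case True
  have "has_bochner_integral M (\<lambda>\<omega>. 0) (0::real)" by (rule has_bochner_integral_zero)
  moreover have "AE \<omega> in M. 0 = lin S c \<omega> ^ 4" using lin_gaussian(1)[OF S True] by auto
  ultimately have "has_bochner_integral M (\<lambda>\<omega>. lin S c \<omega> ^ 4) 0"
    by (subst has_bochner_integral_cong_AE[symmetric]) auto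
  then show ?thesis by (simp add: True)
next
  case False
  have "distributed M lborel (lin S c) (\<lambda>x. ennreal (normal_density 0 (sqrt \<bar>Q S c c\<bar>) x))"
    using lin_gaussian(2)[OF S False] by (simp only: normal_density_abs[symmetric])
  then have "has_bochner_integral M (\<lambda>\<omega>. lin S c \<omega> ^ 4) (3 * sqrt \<bar>Q S c c\<bar> ^ 4)"
    using False by (intro normal_fourth_moment) auto
  moreover have "sqrt \<bar>Q S c c\<bar> ^ 4 = (Q S c c)\<^sup>2"
    using power_mult[of "sqrt \<bar>Q S c c\<bar>" 2 2] by simp
  ultimately show ?thesis by simp
qed

lemma R_H_commute: "R_H H s t = R_H H t s"
  by (simp add: R_H_def abs_minus_commute)

lemma Q_commute: "Q S c c' = Q S c' c"
proof -
  have "cov p p' = cov p' p" for p p' by (simp add: cov_def R_H_commute)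
  then show ?thesis unfolding Q_def
    by (subst sum.swap) (auto intro!: sum.cong simp: mult_ac)
qed

lemma Q_linear: "Q S (\<lambda>p. c p + c' p) d = Q S c d + Q S c' d" "Q S (\<lambda>p. c p - c' p) d = Q S c d - Q S c' d"
  "Q S d (\<lambda>p. c p + c' p) = Q S d c + Q S d c'" "Q S d (\<lambda>p. c p - c' p) = Q S d c - Q S d c'"
  by (simp_all add: Q_def algebra_simps sum.distrib sum_subtractf)

lemma lin_linear: "lin S (\<lambda>p. c p + c' p) \<omega> = lin S c \<omega> + lin S c' \<omega>" "lin S (\<lambda>p. c p - c' p) \<omega> = lin S c \<omega> - lin S c' \<omega>"
  by (simp_all add: lin_def algebra_simps sum.distrib sum_subtractf)

text \<open>The definition of the process gives the law of single linear combinations only. Their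
  fourth moments are 3 \<open>Q\<close>^2, and polarisation recovers the mixed moment.\<close>

lemma isserlis:
  assumes S: "finite S" "S \<subseteq> UNIV \<times> {0..}"
  shows "has_bochner_integral M (\<lambda>\<omega>. lin S a \<omega> * lin S b \<omega> * lin S c \<omega> * lin S d \<omega>)
    (Q S a b * Q S c d + Q S a c * Q S b d + Q S a d * Q S b c)"
proof -
  note F = lin_fourth_moment[OF S]
  have I: "has_bochner_integral M (\<lambda>\<omega>. (lin S a \<omega> + lin S b \<omega> + lin S c \<omega> + lin S d \<omega>) ^ 4 - (lin S a \<omega> + lin S b \<omega> + lin S c \<omega> - lin S d \<omega>) ^ 4
     - (lin S a \<omega> + lin S b \<omega> - lin S c \<omega> + lin S d \<omega>) ^ 4 + (lin S a \<omega> + lin S b \<omega> - lin S c \<omega> - lin S d \<omega>) ^ 4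
     - (lin S a \<omega> - lin S b \<omega> + lin S c \<omega> + lin S d \<omega>) ^ 4 + (lin S a \<omega> - lin S b \<omega> + lin S c \<omega> - lin S d \<omega>) ^ 4
     + (lin S a \<omega> - lin S b \<omega> - lin S c \<omega> + lin S d \<omega>) ^ 4 - (lin S a \<omega> - lin S b \<omega> - lin S c \<omega> - lin S d \<omega>) ^ 4)
    (3 * (Q S (\<lambda>p. a p + b p + c p + d p) (\<lambda>p. a p + b p + c p + d p))\<^sup>2 - 3 * (Q S (\<lambda>p. a p + b p + c p - d p) (\<lambda>p. a p + b p + c p - d p))\<^sup>2
     - 3 * (Q S (\<lambda>p. a p + b p - c p + d p) (\<lambda>p. a p + b p - c p + d p))\<^sup>2 + 3 * (Q S (\<lambda>p. a p + b p - c p - d p) (\<lambda>p. a p + b p - c p - d p))\<^sup>2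
     - 3 * (Q S (\<lambda>p. a p - b p + c p + d p) (\<lambda>p. a p - b p + c p + d p))\<^sup>2 + 3 * (Q S (\<lambda>p. a p - b p + c p - d p) (\<lambda>p. a p - b p + c p - d p))\<^sup>2
     + 3 * (Q S (\<lambda>p. a p - b p - c p + d p) (\<lambda>p. a p - b p - c p + d p))\<^sup>2 - 3 * (Q S (\<lambda>p. a p - b p - c p - d p) (\<lambda>p. a p - b p - c p - d p))\<^sup>2)"
    unfolding lin_linear[symmetric]
    by (intro has_bochner_integral_add has_bochner_integral_diff F)
  let ?D = "Q S a a + Q S b b + Q S c c + Q S d d"
  have P: "Q S (\<lambda>p. a p + b p + c p + d p) (\<lambda>p. a p + b p + c p + d p) = ?D + 2 * Q S a b + 2 * Q S a c + 2 * Q S a d + 2 * Q S b c + 2 * Q S b d + 2 * Q S c d"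
    "Q S (\<lambda>p. a p + b p + c p - d p) (\<lambda>p. a p + b p + c p - d p) = ?D + 2 * Q S a b + 2 * Q S a c - 2 * Q S a d + 2 * Q S b c - 2 * Q S b d - 2 * Q S c d"
    "Q S (\<lambda>p. a p + b p - c p + d p) (\<lambda>p. a p + b p - c p + d p) = ?D + 2 * Q S a b - 2 * Q S a c + 2 * Q S a d - 2 * Q S b c + 2 * Q S b d - 2 * Q S c d"
    "Q S (\<lambda>p. a p + b p - c p - d p) (\<lambda>p. a p + b p - c p - d p) = ?D + 2 * Q S a b - 2 * Q S a c - 2 * Q S a d - 2 * Q S b c - 2 * Q S b d + 2 * Q S c d"
    "Q S (\<lambda>p. a p - b p + c p + d p) (\<lambda>p. a p - b p + c p + d p) = ?D - 2 * Q S a b + 2 * Q S a c + 2 * Q S a d - 2 * Q S b c - 2 * Q S b d + 2 * Q S c d"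
    "Q S (\<lambda>p. a p - b p + c p - d p) (\<lambda>p. a p - b p + c p - d p) = ?D - 2 * Q S a b + 2 * Q S a c - 2 * Q S a d - 2 * Q S b c + 2 * Q S b d - 2 * Q S c d"
    "Q S (\<lambda>p. a p - b p - c p + d p) (\<lambda>p. a p - b p - c p + d p) = ?D - 2 * Q S a b - 2 * Q S a c + 2 * Q S a d + 2 * Q S b c - 2 * Q S b d - 2 * Q S c d"
    "Q S (\<lambda>p. a p - b p - c p - d p) (\<lambda>p. a p - b p - c p - d p) = ?D - 2 * Q S a b - 2 * Q S a c - 2 * Q S a d + 2 * Q S b c + 2 * Q S b d + 2 * Q S c d"
    unfolding Q_linear using Q_commute[of S b a] Q_commute[of S c a] Q_commute[of S d a] Q_commute[of S c b] Q_commute[of S d b] Q_commute[of S d c]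
    by linarith+
  have "has_bochner_integral M (\<lambda>\<omega>. 192 * (lin S a \<omega> * lin S b \<omega> * lin S c \<omega> * lin S d \<omega>))
      (3 * (64 * (Q S a b * Q S c d + Q S a c * Q S b d + Q S a d * Q S b c)))"
  proof (rule back_subst[where P = "has_bochner_integral M _", OF I[unfolded polarisation_fourth P]])
  qed (use polarisation_square[of ?D "Q S a b" "Q S a c" "Q S a d" "Q S b c" "Q S b d" "Q S c d"] in linarith)
  from has_bochner_integral_mult_right[OF this, of "1/192"]
  show ?thesis by (simp add: add_divide_distrib)
qed

section \<open>Increments over a uniform grid\<close>

definition point :: "'d \<Rightarrow> real \<Rightarrow> 'd \<times> real \<Rightarrow> real" where "point i t p = of_bool (p = (i, t))"

lemma lin_point:
  assumes "finite S" "(i, s) \<in> S" "(i, t) \<in> S"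
  shows "lin S (\<lambda>p. point i t p - point i s p) \<omega> = B i t \<omega> - B i s \<omega>"
proof -
  have "lin S (point i r) \<omega> = B i r \<omega>" if "(i, r) \<in> S" for r
    unfolding lin_def point_def using assms(1) that
    by (simp add: of_bool_def if_distrib[of "\<lambda>c. c * _"] cong: if_cong)
  then show ?thesis using assms by (simp add: lin_linear)
qed

lemma Q_point:
  assumes "finite S" "(i, s) \<in> S" "(j, t) \<in> S"
  shows "Q S (point i s) (point j t) = cov (i, s) (j, t)"
proof -
  have "Q S (point i s) (point j t) = (\<Sum>p\<in>S. if p = (i, s) then (\<Sum>p'\<in>S. if p' = (j, t) then cov p p' else 0) else 0)"
    unfolding Q_def point_def by (intro sum.cong refl) (auto intro!: sum.neutral sum.cong)
  then show ?thesis using assms by simp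
qed

text \<open>Autocovariance of fractional Gaussian noise, the unit-step increments of the process, at
  lag \<open>d\<close>.\<close>

definition fgn :: "real \<Rightarrow> real" where
  "fgn d = (\<bar>d + 1\<bar> powr (2*H) + \<bar>d - 1\<bar> powr (2*H) - 2 * \<bar>d\<bar> powr (2*H)) / 2"

definition incr :: "real \<Rightarrow> 'd \<Rightarrow> nat \<Rightarrow> 'w \<Rightarrow> real" where
  "incr h i k \<omega> = B i (real (Suc k) * h) \<omega> - B i (real k * h) \<omega>"

text \<open>The terms of \<open>R_H\<close> in one variable cancel in the mixed second difference,
  so only the lag matters; self-similarity extracts the power of \<open>h\<close>.\<close>

lemma incr_cov:
  assumes "0 < h"
  shows "cov (i, real (Suc k) * h) (j, real (Suc l) * h) - cov (i, real (Suc k) * h) (j, real l * h)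
    - cov (i, real k * h) (j, real (Suc l) * h) + cov (i, real k * h) (j, real l * h)
    = (if i = j then h powr (2*H) * fgn (real k - real l) else 0)"
proof -
  have *: "\<bar>a * h - b * h\<bar> powr (2*H) = \<bar>b - a\<bar> powr (2*H) * h powr (2*H)" for a b :: real
  proof -
    have "\<bar>a * h - b * h\<bar> = \<bar>b - a\<bar> * h"
      using assms by (simp add: left_diff_distrib[symmetric] abs_mult abs_minus_commute)
    then show ?thesis using assms by (simp add: powr_mult)
  qed
  have "real (Suc k) - real (Suc l) = real k - real l" "real (Suc k) - real l = (real k - real l) + 1"
    "real k - real (Suc l) = (real k - real l) - 1" by simp_all
  then show ?thesis
    unfolding cov_def R_H_def fst_conv snd_conv * fgn_def by (simp add: field_simps)
qed

text \<open>Two of the three Wick pairings match the component \<open>i\<close> with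
  \<open>j\<close> and vanish.\<close>

lemma incr_product_moment:
  assumes h: "0 < h" and ij: "i \<noteq> j"
  shows "has_bochner_integral M (\<lambda>\<omega>. incr h i k \<omega> * incr h j l \<omega> * incr h i k' \<omega> * incr h j l' \<omega>)
    ((h powr (2*H))\<^sup>2 * (fgn (real k - real k') * fgn (real l - real l')))"
proof -
  \<comment> \<open>Large enough for the endpoints of all four increments to lie in one common index
    set.\<close>
  define n where "n = Suc (k + l + k' + l')"
  define S :: "('d \<times> real) set" where "S = UNIV \<times> (\<lambda>m. real m * h) ` {..n}"
  have S: "finite S" "S \<subseteq> UNIV \<times> {0..}" using h by (auto simp: S_def)
  define c where "c i m = (\<lambda>p. point i (real (Suc m) * h) p - point i (real m * h) p)" for i m
  have mem: "(i, real m * h) \<in> S" if "m \<le> n" for i m using that by (auto simp: S_def)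
  have lin: "lin S (c i m) = incr h i m" if "m < n" for i m
    unfolding c_def incr_def[abs_def] using that by (intro ext lin_point S mem) auto
  have QQ: "Q S (c i m) (c j m') = (if i = j then h powr (2*H) * fgn (real m - real m') else 0)" if "m < n" "m' < n" for i j m m'
    unfolding c_def Q_linear incr_cov[OF h, symmetric]
    using that by (simp add: Q_point[OF S(1) mem mem] del: of_nat_Suc)
  have "has_bochner_integral M (\<lambda>\<omega>. lin S (c i k) \<omega> * lin S (c j l) \<omega> * lin S (c i k') \<omega> * lin S (c j l') \<omega>)
    (Q S (c i k) (c j l) * Q S (c i k') (c j l') + Q S (c i k) (c i k') * Q S (c j l) (c j l')
      + Q S (c i k) (c j l') * Q S (c j l) (c i k'))"
    by (rule isserlis[OF S])
  then show ?thesis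
    using ij by (simp add: lin QQ n_def power2_eq_square mult_ac)
qed

lemma incr_exp_moment:
  assumes h: "0 < h"
  shows "(\<integral>\<^sup>+\<omega>. ennreal (exp (c * \<bar>incr h i k \<omega>\<bar>)) \<partial>M) \<le> ennreal (2 * exp (c\<^sup>2 * h powr (2*H) / 2))"
proof -
  define S where "S = {(i, real (Suc k) * h), (i, real k * h)}"
  have S: "finite S" "S \<subseteq> UNIV \<times> {0..}" using h by (auto simp: S_def)
  have mem: "(i, real (Suc k) * h) \<in> S" "(i, real k * h) \<in> S" by (auto simp: S_def)
  define c' where "c' = (\<lambda>p. point i (real (Suc k) * h) p - point i (real k * h) p)"
  have "Q S c' c' = h powr (2*H) * fgn (real k - real k)"
    unfolding c'_def Q_linear using incr_cov[OF h, of i k i k]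
    by (simp add: Q_point[OF S(1)] mem del: of_nat_Suc)
  also have "\<dots> = h powr (2*H)" by (simp add: fgn_def)
  finally have Q: "Q S c' c' = h powr (2*H)" .
  have L: "lin S c' = incr h i k"
    unfolding c'_def incr_def[abs_def] by (intro ext lin_point S) (auto simp: S_def)
  have "(\<integral>\<^sup>+\<omega>. ennreal (exp (c * \<bar>lin S c' \<omega>\<bar>)) \<partial>M) \<le> ennreal (2 * exp (c\<^sup>2 * (sqrt (Q S c' c'))\<^sup>2 / 2))"
    by (rule normal_exp_moment[OF lin_gaussian(2)[OF S]]) (use h in \<open>auto simp: Q\<close>)
  then show ?thesis by (simp add: L Q)
qed

lemma incr_measurable [measurable]: "incr h i k \<in> borel_measurable M"
  unfolding incr_def[abs_def] by measurable

end

subsection \<open>Convergence of the approximate Levy areas\<close>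

text \<open>The iterated integral of two piecewise linear functions between grid points
  \<open>a\<close> and \<open>b\<close>; the halved product is the contribution from within a single
  cell.\<close>

definition trapezoid :: "(nat \<Rightarrow> real) \<Rightarrow> (nat \<Rightarrow> real) \<Rightarrow> nat \<Rightarrow> nat \<Rightarrow> real" where
  "trapezoid u v a b = (\<Sum>l=a..<b. (u l - u a) * (v (Suc l) - v l) + (u (Suc l) - u l) * (v (Suc l) - v l) / 2)"

text \<open>Discrete integration by parts, made exact by the half weight on the diagonal.\<close>

lemma trapezoid_sym:
  assumes "a \<le> b"
  shows "trapezoid u v a b + trapezoid v u a b = (u b - u a) * (v b - v a)"
  using assms by (induction b rule: dec_induct) (auto simp: trapezoid_def algebra_simps)

text \<open>Replacing a chord by two shorter ones changes the area by the signed triangle between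
  them, which is half the determinant of the two fine increments.\<close>

lemma trapezoid_refine:
  assumes "a \<le> b"
  shows "trapezoid u v (2 * a) (2 * b) - trapezoid (\<lambda>l. u (2 * l)) (\<lambda>l. v (2 * l)) a b =
    (\<Sum>l=a..<b. (u (2*l+1) - u (2*l)) * (v (2*l+2) - v (2*l+1)) - (u (2*l+2) - u (2*l+1)) * (v (2*l+1) - v (2*l))) / 2"
  using assms
proof (induction b rule: dec_induct)
  case base
  then show ?case by (simp add: trapezoid_def)
next
  case (step b)
  have "trapezoid u v (2 * a) (2 * Suc b) = trapezoid u v (2 * a) (2 * b)
     + ((u (2*b) - u (2*a)) * (v (2*b+1) - v (2*b)) + (u (2*b+1) - u (2*b)) * (v (2*b+1) - v (2*b)) / 2)
     + ((u (2*b+1) - u (2*a)) * (v (2*b+2) - v (2*b+1)) + (u (2*b+2) - u (2*b+1)) * (v (2*b+2) - v (2*b+1)) / 2)"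
    using step(1) by (simp add: trapezoid_def)
  moreover have "trapezoid (\<lambda>l. u (2 * l)) (\<lambda>l. v (2 * l)) a (Suc b) = trapezoid (\<lambda>l. u (2 * l)) (\<lambda>l. v (2 * l)) a b
     + ((u (2*b) - u (2*a)) * (v (2*b+2) - v (2*b)) + (u (2*b+2) - u (2*b)) * (v (2*b+2) - v (2*b)) / 2)"
    using step(1) by (simp add: trapezoid_def)
  ultimately show ?case using step(1,3) by (simp add: field_simps)
qed

lemma dyad_idx_eq:
  assumes "0 < T" "l < 2 ^ n" "dyad_pt n T l \<le> r" "r < dyad_pt n T (Suc l)"
  shows "dyad_idx n T r = l"
proof -
  have "real l \<le> r * 2 ^ n / T" "r * 2 ^ n / T < real l + 1"
    using assms by (simp_all add: dyad_pt_def field_simps)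
  then have "\<lfloor>r * 2 ^ n / T\<rfloor> = int l" by (simp add: floor_eq_iff)
  then show ?thesis using assms(2) by (simp add: dyad_idx_def)
qed

lemma iter_int_pl_dyadic:
  assumes T: "0 < T" and ab: "a < b" "b \<le> 2 ^ n"
  shows "iter_int_pl n T x1 x2 (dyad_pt n T a) (dyad_pt n T b)
    = trapezoid (\<lambda>l. x1 (dyad_pt n T l)) (\<lambda>l. x2 (dyad_pt n T l)) a b"
proof -
  define t where "t = dyad_pt n T"
  have t_less: "t l < t (Suc l)" for l using T by (simp add: t_def dyad_pt_def field_simps)
  have t_mono: "t l \<le> t l'" if "l \<le> l'" for l l'
    using T that by (simp add: t_def dyad_pt_def divide_right_mono mult_right_mono)
  have h: "t (Suc l) - t l = T / 2 ^ n" for l by (simp add: t_def dyad_pt_def field_simps)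
  have base: "pl_interp n T x1 (t a) = x1 (t a)"
    using dyad_idx_eq[of T a n "t a"] T ab t_less[of a] by (simp add: pl_interp_def t_def)
  have cell: "((\<lambda>r. (pl_interp n T x1 r - pl_interp n T x1 (t a)) * pl_slope n T x2 r) has_integral
      (x1 (t l) - x1 (t a)) * (x2 (t (Suc l)) - x2 (t l)) + (x1 (t (Suc l)) - x1 (t l)) * (x2 (t (Suc l)) - x2 (t l)) / 2)
      {t l..t (Suc l)}" if l: "l < b" for l
  proof -
    define m1 m2 where "m1 = (x1 (t (Suc l)) - x1 (t l)) * 2 ^ n / T" and "m2 = (x2 (t (Suc l)) - x2 (t l)) * 2 ^ n / T"
    define G where "G r = ((x1 (t l) - x1 (t a)) * (r - t l) + (r - t l)\<^sup>2 / 2 * m1) * m2" for r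
    have "((\<lambda>r. (x1 (t l) + (r - t l) * m1 - x1 (t a)) * m2) has_integral G (t (Suc l)) - G (t l)) {t l..t (Suc l)}"
      using t_less[of l] unfolding G_def
      by (intro fundamental_theorem_of_calculus)
        (auto intro!: derivative_eq_intros simp: has_real_derivative_iff_has_vector_derivative[symmetric] field_simps)
    moreover have "G (t (Suc l)) - G (t l) = (x1 (t l) - x1 (t a)) * (x2 (t (Suc l)) - x2 (t l))
        + (x1 (t (Suc l)) - x1 (t l)) * (x2 (t (Suc l)) - x2 (t l)) / 2"
      using T unfolding G_def h m1_def m2_def by (simp add: field_simps power2_eq_square)
    \<comment> \<open>The right endpoint is left out because \<open>dyad_idx\<close> jumps there;
      one point does not change the integral.\<close>
    moreover have "(pl_interp n T x1 r - pl_interp n T x1 (t a)) * pl_slope n T x2 r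
        = (x1 (t l) + (r - t l) * m1 - x1 (t a)) * m2" if r: "r \<in> {t l..t (Suc l)} - {t (Suc l)}" for r
    proof -
      have "dyad_idx n T r = l" using r l ab T unfolding t_def by (intro dyad_idx_eq) auto
      then show ?thesis unfolding base by (simp add: pl_interp_def pl_slope_def m1_def m2_def t_def)
    qed
    ultimately show ?thesis
      using has_integral_spike_finite[of "{t (Suc l)}"] by (metis (no_types, lifting) finite.emptyI finite.insertI)
  qed
  have "((\<lambda>r. (pl_interp n T x1 r - pl_interp n T x1 (t a)) * pl_slope n T x2 r) has_integral
      trapezoid (\<lambda>l. x1 (t l)) (\<lambda>l. x2 (t l)) a b') {t a..t b'}" if "a \<le> b'" "b' \<le> b" for b'
    using that
  proof (induction b' rule: dec_induct)
    case base
    then show ?case using has_integral_refl(2) by (simp add: trapezoid_def)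
  next
    case (step m)
    have "trapezoid (\<lambda>l. x1 (t l)) (\<lambda>l. x2 (t l)) a (Suc m) = trapezoid (\<lambda>l. x1 (t l)) (\<lambda>l. x2 (t l)) a m
      + ((x1 (t m) - x1 (t a)) * (x2 (t (Suc m)) - x2 (t m)) + (x1 (t (Suc m)) - x1 (t m)) * (x2 (t (Suc m)) - x2 (t m)) / 2)"
      using step by (simp add: trapezoid_def)
    then show ?case
      using has_integral_combine[OF t_mono[OF step(1)] t_mono step(3) cell[of m]] step by simp
  qed
  from this[of b] show ?thesis
    unfolding iter_int_pl_def using ab by (simp add: t_def integral_unique)
qed

lemma iter_int_pl_sym:
  assumes T: "0 < T" and k: "k < 2 ^ N" and n: "N \<le> n"
  shows "iter_int_pl n T x1 x2 (dyad_pt N T k) (dyad_pt N T (Suc k)) + iter_int_pl n T x2 x1 (dyad_pt N T k) (dyad_pt N T (Suc k))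
    = (x1 (dyad_pt N T (Suc k)) - x1 (dyad_pt N T k)) * (x2 (dyad_pt N T (Suc k)) - x2 (dyad_pt N T k))"
proof -
  obtain m where m: "n = N + m" using n le_Suc_ex by blast
  have r: "dyad_pt N T l = dyad_pt n T (l * 2 ^ m)" for l
    by (simp add: m dyad_pt_def power_add field_simps)
  have "Suc k * 2 ^ m \<le> 2 ^ N * 2 ^ m" using k by (intro mult_right_mono) auto
  then have le: "k * 2 ^ m < Suc k * 2 ^ m" "Suc k * 2 ^ m \<le> 2 ^ n" by (simp_all add: m power_add)
  show ?thesis
    unfolding r iter_int_pl_dyadic[OF T le] using trapezoid_sym le by auto
qed

text \<open>From level \<open>N\<close> on the two approximate areas add up to a constant, so
  convergence for (i, j) carries over to (j, i). The hypothesis \<open>conv\<close> is what gives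
  \<open>lim\<close> its meaning as a limit.\<close>

lemma levy_lift_sym:
  assumes T: "0 < T" and k: "k < 2 ^ N"
    and conv: "convergent (\<lambda>n. iter_int_pl n T (\<lambda>r. B i r \<omega>) (\<lambda>r. B j r \<omega>) (dyad_pt N T k) (dyad_pt N T (Suc k)))"
  shows "levy_lift T B i j (dyad_pt N T k) (dyad_pt N T (Suc k)) \<omega> + levy_lift T B j i (dyad_pt N T k) (dyad_pt N T (Suc k)) \<omega>
    = (B i (dyad_pt N T (Suc k)) \<omega> - B i (dyad_pt N T k) \<omega>) * (B j (dyad_pt N T (Suc k)) \<omega> - B j (dyad_pt N T k) \<omega>)"
proof -
  let ?A = "\<lambda>i j n. iter_int_pl n T (\<lambda>r. B i r \<omega>) (\<lambda>r. B j r \<omega>) (dyad_pt N T k) (dyad_pt N T (Suc k))"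
  let ?c = "(B i (dyad_pt N T (Suc k)) \<omega> - B i (dyad_pt N T k) \<omega>) * (B j (dyad_pt N T (Suc k)) \<omega> - B j (dyad_pt N T k) \<omega>)"
  have lim: "?A i j \<longlonglongrightarrow> lim (?A i j)" using conv by (simp add: convergent_LIMSEQ_iff)
  have "(\<lambda>n. ?c - ?A i j n) \<longlonglongrightarrow> ?c - lim (?A i j)"
    by (intro tendsto_intros lim)
  moreover have "eventually (\<lambda>n. ?c - ?A i j n = ?A j i n) sequentially"
    using eventually_ge_at_top[of N]
  proof eventually_elim
    case (elim n)
    then show ?case using iter_int_pl_sym[OF T k elim, of "\<lambda>r. B i r \<omega>" "\<lambda>r. B j r \<omega>"] by linarith
  qed
  ultimately have "?A j i \<longlonglongrightarrow> ?c - lim (?A i j)" by (rule Lim_transform_eventually)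
  then have "lim (?A j i) = ?c - lim (?A i j)" by (rule limI)
  then show ?thesis by (simp add: levy_lift_def)
qed

text \<open>The series of absolute values has finite expectation by monotone convergence, hence it
  is finite almost surely.\<close>

lemma AE_summable_geometric:
  fixes X :: "nat \<Rightarrow> 'w \<Rightarrow> real"
  assumes [measurable]: "\<And>n. X n \<in> borel_measurable M"
    and le: "\<And>n. (\<integral>\<^sup>+\<omega>. ennreal \<bar>X n \<omega>\<bar> \<partial>M) \<le> ennreal (C * s ^ n)" and s: "0 \<le> s" "s < 1" and C: "0 \<le> C"
  shows "AE \<omega> in M. summable (\<lambda>n. X n \<omega>)"
proof -
  have "(\<integral>\<^sup>+\<omega>. (\<Sum>n. ennreal \<bar>X n \<omega>\<bar>) \<partial>M) = (\<Sum>n. \<integral>\<^sup>+\<omega>. ennreal \<bar>X n \<omega>\<bar> \<partial>M)"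
    by (rule nn_integral_suminf) simp
  also have "\<dots> \<le> (\<Sum>n. ennreal (C * s ^ n))"
    by (intro suminf_le le) auto
  also have "\<dots> = ennreal (\<Sum>n. C * s ^ n)"
    by (rule suminf_ennreal2) (use s C in \<open>auto intro!: summable_mult summable_geometric\<close>)
  also have "\<dots> < \<infinity>" by simp
  finally have "AE \<omega> in M. (\<Sum>n. ennreal \<bar>X n \<omega>\<bar>) \<noteq> \<infinity>"
    by (intro nn_integral_PInf_AE) auto
  then show ?thesis
  proof (rule AE_mp, intro AE_I2 impI)
    fix \<omega> assume "(\<Sum>n. ennreal \<bar>X n \<omega>\<bar>) \<noteq> \<infinity>"
    then have "summable (\<lambda>n. \<bar>X n \<omega>\<bar>)" by (intro summable_suminf_not_top) auto
    then show "summable (\<lambda>n. X n \<omega>)" by (rule summable_rabs_cancel)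
  qed
qed

section \<open>Summability of the increment correlations\<close>

context fractional_brownian begin

text \<open>Negative correlation of disjoint increments: the power function with exponent 2H < 1 is
  concave.\<close>

lemma fgn_nonpos:
  assumes "1 \<le> d"
  shows "fgn d \<le> 0"
proof -
  define p where "p = 2 * H"
  have p: "0 < p" "p < 1" using H_pos H_half by (auto simp: p_def)
  have "(d + 1) powr p + (d - 1) powr p \<le> 2 * d powr p"
  proof (cases "d = 1")
    \<comment> \<open>Treated apart because the power function is not differentiable at 0, the left
      end of the interval for lag 1.\<close>
    case True
    have "2 powr p \<le> 2 powr (1::real)" using p by (intro powr_mono) auto
    then show ?thesis using True by simp
  next
    case False
    then have d: "1 < d" using assms by simp
    have der: "DERIV (\<lambda>x. x powr p) x :> p * x powr (p - 1)" if "0 < x" for x :: real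
      using that by (rule has_real_derivative_powr)
    obtain z where z: "d < z" "z < d + 1" "(d + 1) powr p - d powr p = (d + 1 - d) * (p * z powr (p - 1))"
      using MVT2[of d "d + 1" "\<lambda>x. x powr p" "\<lambda>x. p * x powr (p - 1)"] der d by auto
    obtain w where w: "d - 1 < w" "w < d" "d powr p - (d - 1) powr p = (d - (d - 1)) * (p * w powr (p - 1))"
      using MVT2[of "d - 1" d "\<lambda>x. x powr p" "\<lambda>x. p * x powr (p - 1)"] der d by auto
    have "z powr (p - 1) \<le> w powr (p - 1)"
      using z w d p by (intro powr_mono2') auto
    then have "p * z powr (p - 1) \<le> p * w powr (p - 1)" using p by simp
    then show ?thesis using z(3) w(3) by simp
  qed
  then show ?thesis using assms by (simp add: fgn_def p_def)
qed

text \<open>All terms have the same sign and are second differences, so the sum telescopes to a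
  first difference.\<close>

lemma sum_abs_fgn_right: "(\<Sum>d<m. \<bar>fgn (real (Suc d))\<bar>) \<le> 1/2"
proof -
  have "(\<Sum>d<m. \<bar>fgn (real (Suc d))\<bar>) = (1 - (real (Suc m) powr (2*H) - real m powr (2*H))) / 2"
  proof (induction m)
    case 0
    then show ?case by simp
  next
    case (Suc m)
    have "\<bar>fgn (real (Suc m))\<bar> = - fgn (real (Suc m))"
      using fgn_nonpos[of "real (Suc m)"] by (simp del: of_nat_Suc)
    also have "\<dots> = - (real (Suc (Suc m)) powr (2*H) + real m powr (2*H) - 2 * real (Suc m) powr (2*H)) / 2"
      by (simp add: fgn_def add.commute field_simps)
    finally show ?case using Suc by (simp add: field_simps)
  qed
  also have "\<dots> \<le> 1/2" using powr_mono2[of "2*H" "real m" "real (Suc m)"] H_pos by simp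
  finally show ?thesis .
qed

lemma fgn_minus: "fgn (- d) = fgn d"
  by (simp add: fgn_def) (simp add: abs_minus_commute add.commute minus_diff_commute)

text \<open>At most 1/2 from the lags on either side, and 1 from lag zero. The bound is uniform in
  the length of the row.\<close>

lemma sum_abs_fgn: "(\<Sum>r<n. \<bar>fgn (real k - real r)\<bar>) \<le> 2"
proof -
  let ?n = "Suc (k + n)"
  have "(\<Sum>r<n. \<bar>fgn (real k - real r)\<bar>) \<le> (\<Sum>r<?n. \<bar>fgn (real k - real r)\<bar>)"
    by (rule sum_mono2) auto
  also have "{..<?n} = {..<k} \<union> {k} \<union> {Suc k..<?n}" by auto
  also have "(\<Sum>r\<in>{..<k} \<union> {k} \<union> {Suc k..<?n}. \<bar>fgn (real k - real r)\<bar>)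
     = (\<Sum>r<k. \<bar>fgn (real k - real r)\<bar>) + \<bar>fgn 0\<bar> + (\<Sum>r=Suc k..<?n. \<bar>fgn (real k - real r)\<bar>)"
    by (subst sum.union_disjoint; (subst sum.union_disjoint)?) auto
  also have "(\<Sum>r<k. \<bar>fgn (real k - real r)\<bar>) = (\<Sum>d<k. \<bar>fgn (real (Suc d))\<bar>)"
    by (subst sum.nat_diff_reindex[symmetric]) (auto intro!: sum.cong simp: of_nat_diff)
  also have "(\<Sum>r=Suc k..<?n. \<bar>fgn (real k - real r)\<bar>) = (\<Sum>d<n. \<bar>fgn (real (Suc d))\<bar>)"
  proof (rule sum.reindex_bij_witness[of _ "\<lambda>d. k + Suc d" "\<lambda>r. r - Suc k"])
    fix r assume r: "r \<in> {Suc k..<?n}"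
    have "real (Suc (r - Suc k)) = - (real k - real r)" using r by (simp add: of_nat_diff)
    then show "\<bar>fgn (real (Suc (r - Suc k)))\<bar> = \<bar>fgn (real k - real r)\<bar>" by (simp only: fgn_minus)
  qed auto
  also have "(\<Sum>d<k. \<bar>fgn (real (Suc d))\<bar>) + \<bar>fgn 0\<bar> + (\<Sum>d<n. \<bar>fgn (real (Suc d))\<bar>) \<le> 1/2 + 1 + 1/2"
    by (intro add_mono sum_abs_fgn_right) (simp add: fgn_def)
  finally show ?thesis by simp
qed

lemma abs_fgn_le: "\<bar>fgn (real k - real r)\<bar> \<le> 2"
  using order_trans[OF member_le_sum[of r "{..<Suc r}" "\<lambda>r. \<bar>fgn (real k - real r)\<bar>"] sum_abs_fgn[of k "Suc r"]] by simp

text \<open>The change of area from \<open>trapezoid_refine\<close>, written in increments over the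
  finer mesh \<open>h\<close>.\<close>

definition area_diff :: "real \<Rightarrow> 'd \<Rightarrow> 'd \<Rightarrow> nat \<Rightarrow> nat \<Rightarrow> 'w \<Rightarrow> real" where
  "area_diff h i j a b \<omega> = (\<Sum>l=a..<b. incr h i (2*l) \<omega> * incr h j (2*l+1) \<omega> - incr h i (2*l+1) \<omega> * incr h j (2*l) \<omega>) / 2"

lemma area_diff_measurable [measurable]: "area_diff h i j a b \<in> borel_measurable M"
  unfolding area_diff_def[abs_def] by measurable

text \<open>Wick's formula turns the double sum into products of two correlations. Bounding one
  factor and summing the other over a row makes the result linear, rather than quadratic, in the
  number of cells.\<close>

lemma area_diff_second_moment:
  assumes h: "0 < h" and ij: "i \<noteq> j"
  shows "(\<integral>\<^sup>+\<omega>. ennreal ((area_diff h i j a b \<omega>)\<^sup>2) \<partial>M) \<le> ennreal (2 * real (b - a) * (h powr (2*H))\<^sup>2)"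
proof -
  define g where "g p q = fgn (real p - real q)" for p q :: nat
  define e where "e p q r s \<omega> = incr h i p \<omega> * incr h j q \<omega> * incr h i r \<omega> * incr h j s \<omega>" for p q r s \<omega>
  have e: "has_bochner_integral M (e p q r s) ((h powr (2*H))\<^sup>2 * (g p r * g q s))" for p q r s
    unfolding e_def[abs_def] g_def by (rule incr_product_moment[OF h ij])
  define F where "F l m \<omega> = e (2*l) (2*l+1) (2*m) (2*m+1) \<omega> - e (2*l) (2*l+1) (2*m+1) (2*m) \<omega>
     - e (2*l+1) (2*l) (2*m) (2*m+1) \<omega> + e (2*l+1) (2*l) (2*m+1) (2*m) \<omega>" for l m \<omega>
  define f where "f l m = g (2*l) (2*m) * g (2*l+1) (2*m+1) - g (2*l) (2*m+1) * g (2*l+1) (2*m)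
     - g (2*l+1) (2*m) * g (2*l) (2*m+1) + g (2*l+1) (2*m+1) * g (2*l) (2*m)" for l m
  have F: "has_bochner_integral M (F l m) ((h powr (2*H))\<^sup>2 * f l m)" for l m
    unfolding F_def[abs_def] f_def right_diff_distrib distrib_left
    by (intro has_bochner_integral_add has_bochner_integral_diff e)
  have "(area_diff h i j a b \<omega>)\<^sup>2 = (\<Sum>l=a..<b. \<Sum>m=a..<b. F l m \<omega>) / 4" for \<omega>
    unfolding area_diff_def power2_eq_square times_divide_times_eq sum_product F_def e_def
    by (simp add: algebra_simps)
  moreover have "has_bochner_integral M (\<lambda>\<omega>. (\<Sum>l=a..<b. \<Sum>m=a..<b. F l m \<omega>) / 4)
      ((\<Sum>l=a..<b. \<Sum>m=a..<b. (h powr (2*H))\<^sup>2 * f l m) / 4)"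
    by (intro has_bochner_integral_divide_zero has_bochner_integral_sum F)
  ultimately have I: "has_bochner_integral M (\<lambda>\<omega>. (area_diff h i j a b \<omega>)\<^sup>2)
      ((\<Sum>l=a..<b. \<Sum>m=a..<b. (h powr (2*H))\<^sup>2 * f l m) / 4)" by (simp only:)
  \<comment> \<open>Each of the four products keeps one correlation and bounds the other by 2. The
    kept ones occur twice each, which gives the 4.\<close>
  have f_le: "f l m \<le> 4 * (\<bar>g (2*l) (2*m)\<bar> + \<bar>g (2*l) (2*m+1)\<bar>)" for l m
  proof -
    have *: "g p q * y \<le> 2 * \<bar>y\<bar> \<and> - (g p q * y) \<le> 2 * \<bar>y\<bar>" for p q y
      using mult_right_mono[OF abs_fgn_le[of p q] abs_ge_zero[of y]]
      by (simp add: g_def abs_mult[symmetric] abs_le_iff)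
    show ?thesis
      using *[of "2*l+1" "2*m+1" "g (2*l) (2*m)"] *[of "2*l+1" "2*m" "g (2*l) (2*m+1)"]
      unfolding f_def by (simp add: mult.commute)
  qed
  have row: "(\<Sum>m=a..<b. f l m) \<le> 8" for l
  proof -
    \<comment> \<open>Even and odd columns together form one complete row of correlations, to which
      \<open>sum_abs_fgn\<close> applies.\<close>
    have pairs: "(\<Sum>m<b. \<phi> (2*m) + \<phi> (2*m+1)) = (\<Sum>r<2*b. \<phi> r)" for \<phi> :: "nat \<Rightarrow> real"
      by (induction b) auto
    have "(\<Sum>m=a..<b. f l m) \<le> (\<Sum>m=a..<b. 4 * (\<bar>g (2*l) (2*m)\<bar> + \<bar>g (2*l) (2*m+1)\<bar>))"
      by (intro sum_mono f_le)
    also have "\<dots> \<le> (\<Sum>m<b. 4 * (\<bar>g (2*l) (2*m)\<bar> + \<bar>g (2*l) (2*m+1)\<bar>))"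
      by (rule sum_mono2) auto
    also have "\<dots> = 4 * (\<Sum>r<2*b. \<bar>g (2*l) r\<bar>)"
      by (simp only: sum_distrib_left[symmetric] pairs[of "\<lambda>r. \<bar>g (2*l) r\<bar>"])
    also have "\<dots> \<le> 4 * 2"
      unfolding g_def by (intro mult_left_mono sum_abs_fgn) auto
    finally show ?thesis by simp
  qed
  have "(\<integral>\<^sup>+\<omega>. ennreal ((area_diff h i j a b \<omega>)\<^sup>2) \<partial>M) = ennreal ((\<Sum>l=a..<b. \<Sum>m=a..<b. (h powr (2*H))\<^sup>2 * f l m) / 4)"
    using I nn_integral_eq_integral[of M "\<lambda>\<omega>. (area_diff h i j a b \<omega>)\<^sup>2"]
    unfolding has_bochner_integral_iff by (metis (no_types, lifting) AE_I2 zero_le_power2)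
  also have "\<dots> \<le> ennreal (2 * real (b - a) * (h powr (2*H))\<^sup>2)"
  proof (rule ennreal_leI)
    have "(\<Sum>l=a..<b. \<Sum>m=a..<b. (h powr (2*H))\<^sup>2 * f l m) \<le> (\<Sum>l=a..<b. (h powr (2*H))\<^sup>2 * 8)"
      unfolding sum_distrib_left[symmetric] by (intro sum_mono mult_left_mono row) auto
    then show "(\<Sum>l=a..<b. \<Sum>m=a..<b. (h powr (2*H))\<^sup>2 * f l m) / 4 \<le> 2 * real (b - a) * (h powr (2*H))\<^sup>2"
      by simp
  qed
  finally show ?thesis .
qed

end

subsection \<open>Exponential moments of the supremum\<close>

text \<open>A point with even index belongs to the previous generation, and one with odd index is a
  single increment away from such a point. Each generation is thus charged once, which leaves a
  geometric series of ratio 2^(-\<alpha>).\<close>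

lemma dyadic_chaining:
  fixes f :: "real \<Rightarrow> real"
  assumes T: "0 < T" and \<alpha>: "0 < \<alpha>" and K: "0 \<le> K"
    and inc: "\<And>n k. k < 2 ^ n \<Longrightarrow> \<bar>f (dyad_pt n T (Suc k)) - f (dyad_pt n T k)\<bar> \<le> K * (1 / 2 ^ n) powr \<alpha>"
    and k: "k \<le> 2 ^ n"
  shows "\<bar>f (dyad_pt n T k) - f 0\<bar> \<le> K * (1 / (1 - 2 powr (- \<alpha>)))"
proof -
  define \<rho> where "\<rho> = 2 powr (- \<alpha>)"
  have \<rho>: "0 < \<rho>" "\<rho> < 1" using \<alpha> powr_less_one[of 2 "- \<alpha>"] by (auto simp: \<rho>_def)
  have pw: "(1 / 2 ^ n) powr \<alpha> = \<rho> ^ n" for n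
    by (simp add: \<rho>_def powr_divide powr_minus powr_realpow[symmetric] powr_powr mult.commute field_simps)
  have "\<bar>f (dyad_pt n T k) - f 0\<bar> \<le> K * (\<Sum>m\<le>n. \<rho> ^ m)"
    using k
  proof (induction n arbitrary: k)
    case 0
    then consider "k = 0" | "k = 1" by fastforce
    then show ?case
    proof cases
      case 1
      then show ?thesis using K by (simp add: dyad_pt_def)
    next
      case 2
      then show ?thesis using inc[of 0 0] by (simp add: dyad_pt_def)
    qed
  next
    case (Suc n)
    have half: "dyad_pt (Suc n) T (2 * l) = dyad_pt n T l" for l by (simp add: dyad_pt_def)
    have IH: "\<bar>f (dyad_pt (Suc n) T (2 * l)) - f 0\<bar> \<le> K * (\<Sum>m\<le>n. \<rho> ^ m)" if "l \<le> 2 ^ n" for l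
      unfolding half by (rule Suc.IH[OF that])
    have pos: "0 \<le> K * \<rho> ^ Suc n" using K \<rho> by simp
    have split: "K * (\<Sum>m\<le>Suc n. \<rho> ^ m) = K * (\<Sum>m\<le>n. \<rho> ^ m) + K * \<rho> ^ Suc n"
      by (simp add: distrib_left)
    show ?case
    proof (cases "even k")
      case True
      then obtain l where k: "k = 2 * l" by blast
      then have "l \<le> 2 ^ n" using Suc.prems by simp
      then show ?thesis unfolding k split using IH[of l] pos by linarith
    next
      case False
      then obtain l where l: "k = Suc (2 * l)" using oddE by fastforce
      then have "2 * l < 2 ^ Suc n" "l \<le> 2 ^ n" using Suc.prems by auto
      then show ?thesis using inc[of "2 * l" "Suc n"] IH[of l] unfolding l pw split by linarith
    qed
  qed
  also have "(\<Sum>m\<le>n. \<rho> ^ m) \<le> 1 / (1 - \<rho>)"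
    using \<rho> sum_gp0[of \<rho> n] by (simp add: divide_right_mono)
  finally show ?thesis using K by (simp add: \<rho>_def mult_left_mono)
qed

section \<open>Almost sure convergence of the approximate areas\<close>

context fractional_brownian begin

text \<open>In place of Cauchy-Schwarz, |x| \<le> w/2 + x^2/(2w) is integrated with \<open>w\<close>
  of the order of the standard deviation. At most 2^n cells, each of variance of order 2^(-4Hn),
  give a ratio below 1 exactly when H > 1/4.\<close>

lemma area_diff_first_moment:
  assumes T: "0 < T" and ij: "i \<noteq> j" and H4: "1/4 < H" and h: "0 < h" "h \<le> T / 2 ^ n" and ab: "b - a \<le> 2 ^ n"
  shows "(\<integral>\<^sup>+\<omega>. ennreal \<bar>area_diff h i j a b \<omega>\<bar> \<partial>M) \<le> ennreal ((1/2 + T powr (4*H)) * sqrt (2 powr (1 - 4*H)) ^ n)"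
proof -
  interpret prob_space M by (rule prob_space_M)
  \<comment> \<open>The square root of the ratio by which the variance bound changes from one
    generation to the next.\<close>
  define s where "s = sqrt (2 powr (1 - 4*H))"
  define w where "w = s ^ n"
  have s: "0 < s" "s\<^sup>2 = 2 powr (1 - 4*H)" by (simp_all add: s_def)
  have w: "0 < w" using s by (simp add: w_def)
  have "(h powr (2*H))\<^sup>2 = h powr (4*H)"
    by (simp add: power2_eq_square powr_add[symmetric])
  also have "\<dots> \<le> (T / 2 ^ n) powr (4*H)" using h H_pos by (intro powr_mono2) auto
  finally have hH: "(h powr (2*H))\<^sup>2 \<le> (T / 2 ^ n) powr (4*H)" .
  have "real (b - a) \<le> 2 ^ n" using ab by (metis of_nat_le_iff of_nat_numeral of_nat_power)
  then have "2 * real (b - a) * (h powr (2*H))\<^sup>2 \<le> 2 * 2 ^ n * (T / 2 ^ n) powr (4*H)"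
    using hH by (intro mult_mono) auto
  also have "\<dots> = 2 * T powr (4*H) * (2 powr (1 - 4*H)) ^ n"
    using T by (simp add: powr_divide powr_realpow[symmetric] powr_powr powr_diff field_simps powr_add[symmetric])
  also have "\<dots> = 2 * T powr (4*H) * w\<^sup>2"
    unfolding s(2)[symmetric] w_def by (simp add: power_mult[symmetric] mult.commute)
  finally have m2: "(\<integral>\<^sup>+\<omega>. ennreal ((area_diff h i j a b \<omega>)\<^sup>2) \<partial>M) \<le> ennreal (2 * T powr (4*H) * w\<^sup>2)"
    using order_trans[OF area_diff_second_moment[OF h(1) ij] ennreal_leI] by blast
  have "(\<integral>\<^sup>+\<omega>. ennreal \<bar>area_diff h i j a b \<omega>\<bar> \<partial>M)
      \<le> (\<integral>\<^sup>+\<omega>. ennreal (w / 2) + ennreal (1 / (2 * w)) * ennreal ((area_diff h i j a b \<omega>)\<^sup>2) \<partial>M)"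
  proof (rule nn_integral_mono)
    fix \<omega>
    let ?x = "area_diff h i j a b \<omega>"
    have "2 * w * \<bar>?x\<bar> \<le> w\<^sup>2 + ?x\<^sup>2" using sum_squares_bound[of w "\<bar>?x\<bar>"] by simp
    then have "\<bar>?x\<bar> \<le> w / 2 + 1 / (2 * w) * ?x\<^sup>2" using w by (simp add: field_simps power2_eq_square)
    then have "ennreal \<bar>?x\<bar> \<le> ennreal (w / 2 + 1 / (2 * w) * ?x\<^sup>2)" by (rule ennreal_leI)
    also have "\<dots> = ennreal (w / 2) + ennreal (1 / (2 * w)) * ennreal (?x\<^sup>2)"
      using w by (simp add: ennreal_plus ennreal_mult[symmetric])
    finally show "ennreal \<bar>?x\<bar> \<le> ennreal (w / 2) + ennreal (1 / (2 * w)) * ennreal (?x\<^sup>2)" .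
  qed
  also have "\<dots> = ennreal (w / 2) + ennreal (1 / (2 * w)) * (\<integral>\<^sup>+\<omega>. ennreal ((area_diff h i j a b \<omega>)\<^sup>2) \<partial>M)"
    by (simp add: nn_integral_add nn_integral_cmult emeasure_space_1)
  also have "\<dots> \<le> ennreal (w / 2) + ennreal (1 / (2 * w)) * ennreal (2 * T powr (4*H) * w\<^sup>2)"
    by (intro add_left_mono mult_left_mono m2) auto
  also have "\<dots> = ennreal (w / 2 + 1 / (2 * w) * (2 * T powr (4*H) * w\<^sup>2))"
    using w by (simp add: ennreal_plus ennreal_mult[symmetric])
  also have "w / 2 + 1 / (2 * w) * (2 * T powr (4*H) * w\<^sup>2) = (1/2 + T powr (4*H)) * s ^ n"
    using w by (simp add: w_def field_simps power2_eq_square)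
  finally show ?thesis by (simp add: s_def)
qed

lemma iter_int_pl_Suc:
  assumes T: "0 < T" and ab: "a < b" "b \<le> 2 ^ n"
  shows "iter_int_pl (Suc n) T (\<lambda>r. B i r \<omega>) (\<lambda>r. B j r \<omega>) (dyad_pt n T a) (dyad_pt n T b)
     - iter_int_pl n T (\<lambda>r. B i r \<omega>) (\<lambda>r. B j r \<omega>) (dyad_pt n T a) (dyad_pt n T b)
     = area_diff (T / 2 ^ Suc n) i j a b \<omega>"
proof -
  have half: "dyad_pt n T l = dyad_pt (Suc n) T (2 * l)" for l by (simp add: dyad_pt_def)
  have h: "dyad_pt (Suc n) T l = real l * (T / 2 ^ Suc n)" for l by (simp add: dyad_pt_def)
  have "2 * a < 2 * b" "2 * b \<le> 2 ^ Suc n" using ab by auto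
  then have "iter_int_pl (Suc n) T (\<lambda>r. B i r \<omega>) (\<lambda>r. B j r \<omega>) (dyad_pt n T a) (dyad_pt n T b)
     = trapezoid (\<lambda>l. B i (dyad_pt (Suc n) T l) \<omega>) (\<lambda>l. B j (dyad_pt (Suc n) T l) \<omega>) (2 * a) (2 * b)"
    unfolding half by (rule iter_int_pl_dyadic[OF T])
  moreover have "iter_int_pl n T (\<lambda>r. B i r \<omega>) (\<lambda>r. B j r \<omega>) (dyad_pt n T a) (dyad_pt n T b)
     = trapezoid (\<lambda>l. B i (dyad_pt (Suc n) T (2 * l)) \<omega>) (\<lambda>l. B j (dyad_pt (Suc n) T (2 * l)) \<omega>) a b"
    using iter_int_pl_dyadic[OF T ab] unfolding half .
  ultimately show ?thesis
    using trapezoid_refine[of a b "\<lambda>l. B i (dyad_pt (Suc n) T l) \<omega>" "\<lambda>l. B j (dyad_pt (Suc n) T l) \<omega>"] ab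
    unfolding area_diff_def incr_def h[symmetric] by (simp add: Suc_eq_plus1[symmetric] del: One_nat_def)
qed

lemma AE_convergent_iter_int_pl:
  assumes T: "0 < T" and H4: "1/4 < H"
  shows "AE \<omega> in M. \<forall>N k i j. k < 2 ^ N \<longrightarrow>
    convergent (\<lambda>n. iter_int_pl n T (\<lambda>r. B i r \<omega>) (\<lambda>r. B j r \<omega>) (dyad_pt N T k) (dyad_pt N T (Suc k)))"
proof -
  have "AE \<omega> in M. convergent (\<lambda>n. iter_int_pl n T (\<lambda>r. B i r \<omega>) (\<lambda>r. B j r \<omega>) (dyad_pt N T k) (dyad_pt N T (Suc k)))"
    if k: "k < 2 ^ N" for N k i j
  proof (cases "i = j")
    \<comment> \<open>On the diagonal the symmetry identity fixes every approximation from level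
      \<open>N\<close> on: it equals half the squared increment.\<close>
    case True
    show ?thesis
    proof (rule AE_I2)
      fix \<omega>
      let ?A = "\<lambda>n. iter_int_pl n T (\<lambda>r. B i r \<omega>) (\<lambda>r. B i r \<omega>) (dyad_pt N T k) (dyad_pt N T (Suc k))"
      have "eventually (\<lambda>n. (B i (dyad_pt N T (Suc k)) \<omega> - B i (dyad_pt N T k) \<omega>)\<^sup>2 / 2 = ?A n) sequentially"
        using eventually_ge_at_top[of N]
      proof eventually_elim
        case (elim n)
        then show ?case using iter_int_pl_sym[OF T k elim, of "\<lambda>r. B i r \<omega>" "\<lambda>r. B i r \<omega>"]
          by (simp add: power2_eq_square)
      qed
      then have "?A \<longlonglongrightarrow> (B i (dyad_pt N T (Suc k)) \<omega> - B i (dyad_pt N T k) \<omega>)\<^sup>2 / 2"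
        by (rule Lim_transform_eventually[OF tendsto_const])
      then show "convergent (\<lambda>n. iter_int_pl n T (\<lambda>r. B i r \<omega>) (\<lambda>r. B j r \<omega>) (dyad_pt N T k) (dyad_pt N T (Suc k)))"
        using True by (auto simp: convergent_def)
    qed
  next
    case False
    \<comment> \<open>The refinement from level N + n to N + n + 1; a dyadic interval of level
      \<open>N\<close> contains 2^n cells of level N + n.\<close>
    define X where "X n = area_diff (T / 2 ^ Suc (N + n)) i j (k * 2 ^ n) (Suc k * 2 ^ n)" for n
    have "(\<integral>\<^sup>+\<omega>. ennreal \<bar>X n \<omega>\<bar> \<partial>M) \<le> ennreal ((1/2 + T powr (4*H)) * sqrt (2 powr (1 - 4*H)) ^ n)" for n
    proof -
      have "(2::real) ^ n \<le> 2 ^ Suc (N + n)" by (rule power_increasing) auto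
      then have "T / 2 ^ Suc (N + n) \<le> T / 2 ^ n" using T by (intro divide_left_mono) auto
      then show ?thesis
        unfolding X_def using T by (intro area_diff_first_moment False H4) auto
    qed
    moreover have "sqrt (2 powr (1 - 4*H)) < 1"
      using powr_less_one[of 2 "1 - 4*H"] H4 by simp
    moreover have "X n \<in> borel_measurable M" for n unfolding X_def by measurable
    ultimately have "AE \<omega> in M. summable (\<lambda>n. X n \<omega>)"
      using T by (intro AE_summable_geometric[where C = "1/2 + T powr (4*H)" and s = "sqrt (2 powr (1 - 4*H))"]) auto
    then show ?thesis
    proof (rule AE_mp, intro AE_I2 impI)
      fix \<omega> assume sm: "summable (\<lambda>n. X n \<omega>)"
      let ?A = "\<lambda>n. iter_int_pl n T (\<lambda>r. B i r \<omega>) (\<lambda>r. B j r \<omega>) (dyad_pt N T k) (dyad_pt N T (Suc k))"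
      have step: "?A (Suc (N + n)) - ?A (N + n) = X n \<omega>" for n
      proof -
        have r: "dyad_pt N T l = dyad_pt (N + n) T (l * 2 ^ n)" for l
          by (simp add: dyad_pt_def power_add field_simps)
        have "Suc k * 2 ^ n \<le> 2 ^ N * 2 ^ n" using k by (intro mult_right_mono) auto
        then have le: "k * 2 ^ n < Suc k * 2 ^ n" "Suc k * 2 ^ n \<le> 2 ^ (N + n)" by (simp_all add: power_add)
        show ?thesis unfolding r X_def by (rule iter_int_pl_Suc[OF T le])
      qed
      have "?A (m + N) = ?A N + (\<Sum>n<m. X n \<omega>)" for m
      proof (induction m)
        case (Suc m)
        then show ?case using step[of m] by (simp add: add.commute)
      qed simp
      moreover have "convergent (\<lambda>m. ?A N + (\<Sum>n<m. X n \<omega>))"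
        using sm by (intro convergent_add convergent_const) (simp add: summable_iff_convergent)
      ultimately have "convergent (\<lambda>m. ?A (m + N))" by simp
      then show "convergent ?A" by (rule iffD1[OF convergent_ignore_initial_segment])
    qed
  qed
  then show ?thesis
    by (simp add: AE_all_countable)
qed

section \<open>Exponential moments of all dyadic increments at once\<close>

text \<open>A single random variable dominating all dyadic increments. The shift 2n in the exponent pays
  for the union over the \<open>2 ^ n\<close> increments of generation n; it is harmless because
  it only matters when the normalised increment exceeds 1.\<close>

definition exp_sum :: "real \<Rightarrow> real \<Rightarrow> real \<Rightarrow> 'w \<Rightarrow> ennreal" where
  "exp_sum T \<mu> \<alpha> \<omega> = (\<Sum>n. \<Sum>k<2^n. \<Sum>i\<in>UNIV.
     ennreal (exp ((\<mu> + 2 * real n) * (2 powr (\<alpha> * real n) * \<bar>incr (T / 2 ^ n) i k \<omega>\<bar>) - 2 * real n)))"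

lemma exp_sum_measurable [measurable]: "exp_sum T \<mu> \<alpha> \<in> borel_measurable M"
  unfolding exp_sum_def[abs_def] by measurable

text \<open>Scaled by 2^(\<alpha>n), the increments of generation n have variance of order
  2^(-2(H-\<alpha>)n), which beats the squared factor (\<mu> + 2n)^2. The expectations of the
  exponentials without the shift are therefore bounded uniformly in n, and the shift leaves exp(-2n)
  against 2^n increments.\<close>

lemma exp_sum_integrable:
  assumes T: "0 < T" and \<mu>: "0 < \<mu>" and \<alpha>: "\<alpha> < H"
  shows "(\<integral>\<^sup>+\<omega>. exp_sum T \<mu> \<alpha> \<omega> \<partial>M) < \<infinity>"
proof -
  \<comment> \<open>Half the exponential decay rate of the variance of the scaled
    increments.\<close>
  define g where "g = (H - \<alpha>) * ln 2"
  have g: "0 < g" using \<alpha> by (simp add: g_def)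
  define D where "D = (\<mu> + 2 / g)\<^sup>2 * T powr (2*H) / 2"
  have var: "((\<mu> + 2 * real n) * 2 powr (\<alpha> * real n))\<^sup>2 * (T / 2 ^ n) powr (2*H) / 2 \<le> D" for n
  proof -
    have "g * real n \<le> exp (g * real n)" using exp_ge_add_one_self[of "g * real n"] by linarith
    then have "2 * real n \<le> 2 / g * exp (g * real n)" using g by (simp add: field_simps)
    moreover have "\<mu> * 1 \<le> \<mu> * exp (g * real n)" using \<mu> g by (intro mult_left_mono) auto
    ultimately have "\<mu> + 2 * real n \<le> (\<mu> + 2 / g) * exp (g * real n)" by (simp add: distrib_right)
    then have "(\<mu> + 2 * real n)\<^sup>2 \<le> ((\<mu> + 2 / g) * exp (g * real n))\<^sup>2"
      using \<mu> by (intro power_mono) auto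
    then have "(\<mu> + 2 * real n)\<^sup>2 * ((2 powr (\<alpha> * real n))\<^sup>2 * (T / 2 ^ n) powr (2*H))
      \<le> ((\<mu> + 2 / g) * exp (g * real n))\<^sup>2 * ((2 powr (\<alpha> * real n))\<^sup>2 * (T / 2 ^ n) powr (2*H))"
      by (intro mult_right_mono) auto
    also have "\<dots> = (\<mu> + 2 / g)\<^sup>2 * T powr (2*H)"
    proof -
      have "exp (g * real n) = 2 powr ((H - \<alpha>) * real n)" by (simp add: g_def powr_def mult_ac)
      then have "(exp (g * real n))\<^sup>2 * ((2 powr (\<alpha> * real n))\<^sup>2 * (T / 2 ^ n) powr (2*H)) = T powr (2*H)"
        using T by (simp add: powr_power powr_divide powr_realpow[symmetric] powr_powr powr_add[symmetric] field_simps)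
      then show ?thesis by (simp add: power_mult_distrib mult.assoc)
    qed
    finally show ?thesis by (simp add: D_def power_mult_distrib mult.assoc)
  qed
  have term_le: "(\<integral>\<^sup>+\<omega>. ennreal (exp ((\<mu> + 2 * real n) * (2 powr (\<alpha> * real n) * \<bar>incr (T / 2 ^ n) i k \<omega>\<bar>) - 2 * real n)) \<partial>M)
      \<le> ennreal (exp (- 2 * real n) * (2 * exp D))" for n i k
  proof -
    let ?c = "(\<mu> + 2 * real n) * 2 powr (\<alpha> * real n)"
    have "(\<integral>\<^sup>+\<omega>. ennreal (exp ((\<mu> + 2 * real n) * (2 powr (\<alpha> * real n) * \<bar>incr (T / 2 ^ n) i k \<omega>\<bar>) - 2 * real n)) \<partial>M)
      = (\<integral>\<^sup>+\<omega>. ennreal (exp (- 2 * real n)) * ennreal (exp (?c * \<bar>incr (T / 2 ^ n) i k \<omega>\<bar>)) \<partial>M)"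
      by (intro nn_integral_cong) (simp add: ennreal_mult[symmetric] exp_add[symmetric] algebra_simps)
    also have "\<dots> = ennreal (exp (- 2 * real n)) * (\<integral>\<^sup>+\<omega>. ennreal (exp (?c * \<bar>incr (T / 2 ^ n) i k \<omega>\<bar>)) \<partial>M)"
      by (rule nn_integral_cmult) measurable
    also have "\<dots> \<le> ennreal (exp (- 2 * real n)) * ennreal (2 * exp D)"
      using var[of n] T by (intro mult_left_mono order_trans[OF incr_exp_moment] ennreal_leI) auto
    finally show ?thesis by (simp add: ennreal_mult)
  qed
  define C where "C = real CARD('d) * (2 * exp D)"
  let ?t = "\<lambda>n k i \<omega>. ennreal (exp ((\<mu> + 2 * real n) * (2 powr (\<alpha> * real n) * \<bar>incr (T / 2 ^ n) i k \<omega>\<bar>) - 2 * real n))"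
  have "(\<integral>\<^sup>+\<omega>. exp_sum T \<mu> \<alpha> \<omega> \<partial>M) = (\<Sum>n. \<integral>\<^sup>+\<omega>. (\<Sum>k<2^n. \<Sum>i\<in>UNIV. ?t n k i \<omega>) \<partial>M)"
    unfolding exp_sum_def by (rule nn_integral_suminf) measurable
  also have "\<dots> = (\<Sum>n. \<Sum>k<2^n. \<Sum>i\<in>UNIV. \<integral>\<^sup>+\<omega>. ?t n k i \<omega> \<partial>M)"
    by (intro suminf_cong trans[OF nn_integral_sum] sum.cong refl nn_integral_sum) measurable
  also have "\<dots> \<le> (\<Sum>n. \<Sum>k<(2::nat)^n. \<Sum>i\<in>(UNIV::'d set). ennreal (exp (- 2 * real n) * (2 * exp D)))"
    by (intro suminf_le sum_mono term_le) auto
  also have "\<dots> = (\<Sum>n. ennreal (C * (2 * exp (- 2)) ^ n))"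
  proof (intro suminf_cong)
    fix n :: nat
    have "exp (- 2 * real n) = exp (- 2) ^ n" by (simp add: exp_of_nat2_mult[symmetric])
    then have "(\<Sum>k<(2::nat)^n. \<Sum>i\<in>(UNIV::'d set). exp (- 2 * real n) * (2 * exp D)) = C * (2 * exp (- 2)) ^ n"
      by (simp add: C_def power_mult_distrib)
    then show "(\<Sum>k<(2::nat)^n. \<Sum>i\<in>(UNIV::'d set). ennreal (exp (- 2 * real n) * (2 * exp D))) = ennreal (C * (2 * exp (- 2)) ^ n)"
      by (simp add: sum_ennreal sum_nonneg del: sum_constant)
  qed
  also have "\<dots> = ennreal (\<Sum>n. C * (2 * exp (- 2)) ^ n)"
  proof (rule suminf_ennreal2)
    \<comment> \<open>Why the shift by 2n outweighs the number of increments.\<close>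
    have "2 < exp (2::real)" using exp_ge_add_one_self[of "2::real"] by linarith
    then have "norm (2 * exp (- 2 :: real)) < 1" by (simp add: exp_minus field_simps)
    then show "summable (\<lambda>n. C * (2 * exp (- 2)) ^ n)"
      by (intro summable_mult summable_geometric)
  qed (simp add: C_def)
  also have "\<dots> < \<infinity>" by simp
  finally show ?thesis .
qed

text \<open>One constant \<open>K\<close> serves as dyadic Hoelder constant and, through chaining,
  as bound for the supremum, while its exponential is expressed by an integrable variable.\<close>

lemma exp_sum_controls_path:
  assumes T: "0 < T" and \<mu>: "0 < \<mu>" and \<alpha>: "0 < \<alpha>" and \<omega>: "\<omega> \<in> space M" and fin: "exp_sum T \<mu> \<alpha> \<omega> < \<infinity>"
  obtains K where "0 \<le> K" "ennreal (exp (\<mu> * K)) = ennreal (exp \<mu>) + exp_sum T \<mu> \<alpha> \<omega>"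
    "\<And>i n k. k < 2 ^ n \<Longrightarrow> \<bar>B i (dyad_pt n T (Suc k)) \<omega> - B i (dyad_pt n T k) \<omega>\<bar> \<le> K * (1 / 2 ^ n) powr \<alpha>"
    "\<And>i t. t \<in> {0..T} \<Longrightarrow> \<bar>B i t \<omega> - B i 0 \<omega>\<bar> \<le> K * (1 / (1 - 2 powr (- \<alpha>)))"
proof -
  define Z where "Z = enn2real (exp_sum T \<mu> \<alpha> \<omega>)"
  have Z: "exp_sum T \<mu> \<alpha> \<omega> = ennreal Z" "0 \<le> Z" using fin by (auto simp: Z_def less_top)
  \<comment> \<open>Solves exp(\<mu> K) = exp \<mu> + \<open>Z\<close>. The summand exp \<mu> covers
    normalised increments up to 1, and \<open>Z\<close> covers the larger ones.\<close>
  define K where "K = ln (exp \<mu> + Z) / \<mu>"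
  have pos: "0 < exp \<mu> + Z" using Z(2) by (simp add: add_pos_nonneg)
  have eK: "exp (\<mu> * K) = exp \<mu> + Z" using \<mu> pos by (simp add: K_def)
  have K: "0 \<le> K" unfolding K_def using \<mu> Z(2) one_le_exp_iff[of \<mu>] by (intro divide_nonneg_pos ln_ge_zero) linarith+
  have inc: "\<bar>B i (dyad_pt n T (Suc k)) \<omega> - B i (dyad_pt n T k) \<omega>\<bar> \<le> K * (1 / 2 ^ n) powr \<alpha>" if k: "k < 2 ^ n" for i n k
  proof -
    define Y where "Y = 2 powr (\<alpha> * real n) * \<bar>incr (T / 2 ^ n) i k \<omega>\<bar>"
    let ?t = "\<lambda>n k i. ennreal (exp ((\<mu> + 2 * real n) * (2 powr (\<alpha> * real n) * \<bar>incr (T / 2 ^ n) i k \<omega>\<bar>) - 2 * real n))"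
    have "?t n k i \<le> (\<Sum>i\<in>UNIV. ?t n k i)" by (rule member_le_sum) auto
    also have "\<dots> \<le> (\<Sum>k<2^n. \<Sum>i\<in>UNIV. ?t n k i)" using k by (intro member_le_sum[of k "{..<2^n}" "\<lambda>k. \<Sum>i\<in>UNIV. ?t n k i"]) auto
    also have "\<dots> \<le> exp_sum T \<mu> \<alpha> \<omega>"
      unfolding exp_sum_def using sum_le_suminf[of "\<lambda>n. \<Sum>k<2^n. \<Sum>i\<in>UNIV. ?t n k i" "{n}"] by simp
    finally have t: "exp ((\<mu> + 2 * real n) * Y - 2 * real n) \<le> Z"
      using Z by (simp add: Y_def ennreal_le_iff)
    have "exp (\<mu> * Y) \<le> exp \<mu> + Z"
    proof (cases "Y \<le> 1")
      case True
      then have "\<mu> * Y \<le> \<mu> * 1" using \<mu> by (intro mult_left_mono) auto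
      then have "exp (\<mu> * Y) \<le> exp \<mu>" by simp
      then show ?thesis using Z(2) by linarith
    next
      case False
      then have "2 * real n * 1 \<le> 2 * real n * Y" by (intro mult_left_mono) auto
      then have "exp (\<mu> * Y) \<le> exp ((\<mu> + 2 * real n) * Y - 2 * real n)" by (simp add: distrib_right)
      then show ?thesis using t exp_gt_zero[of \<mu>] by linarith
    qed
    then have "Y \<le> K" using \<mu> unfolding eK[symmetric] by simp
    then have "\<bar>incr (T / 2 ^ n) i k \<omega>\<bar> \<le> K * (1 / 2 ^ n) powr \<alpha>"
      by (simp add: Y_def powr_divide powr_realpow[symmetric] powr_powr field_simps)
    then show ?thesis by (simp add: incr_def dyad_pt_def)
  qed
  have sup: "\<bar>B i t \<omega> - B i 0 \<omega>\<bar> \<le> K * (1 / (1 - 2 powr (- \<alpha>)))" if t: "t \<in> {0..T}" for i t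
  proof -
    obtain k where k: "\<And>n. k n \<le> 2 ^ n" "(\<lambda>n. dyad_pt n T (k n)) \<longlonglongrightarrow> t"
      using dyad_pt_tendsto[OF T t] by blast
    have "(\<lambda>n. B i (dyad_pt n T (k n)) \<omega>) \<longlonglongrightarrow> B i t \<omega>"
      by (rule continuous_on_tendsto_compose[OF B_continuous[OF \<omega>] k(2)])
        (use t T in \<open>auto simp: dyad_pt_def\<close>)
    then have "(\<lambda>n. \<bar>B i (dyad_pt n T (k n)) \<omega> - B i 0 \<omega>\<bar>) \<longlonglongrightarrow> \<bar>B i t \<omega> - B i 0 \<omega>\<bar>"
      by (intro tendsto_intros)
    then show ?thesis
      by (rule LIMSEQ_le_const2)
        (use dyadic_chaining[OF T \<alpha> K, of "\<lambda>t. B i t \<omega>", OF inc k(1)] in blast)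
  qed
  show thesis
    by (rule that[OF K _ inc sup]) (use Z in \<open>auto simp: eK\<close>)
qed

end

subsection \<open>Moments of the Jacobian\<close>

text \<open>For a fixed direction v the derivative is the map \<open>iter_dderiv f [v]\<close>,
  whose own derivative along w is \<open>iter_dderiv f [w, v]\<close>; the bound of order two
  therefore gives the Lipschitz estimate.\<close>

lemma smooth_bdd_derivs_bounds:
  fixes f :: "'a::euclidean_space \<Rightarrow> 'b::real_normed_vector"
  assumes f: "smooth_bdd_derivs f"
  obtains L where "\<And>x. (f has_derivative frechet_derivative f (at x)) (at x)"
    "\<And>x v. norm (frechet_derivative f (at x) v) \<le> L * norm v"
    "\<And>x z v. norm (frechet_derivative f (at x) v - frechet_derivative f (at z) v) \<le> L * norm (x - z) * norm v"
proof -
  have diff: "iter_dderiv f vs differentiable (at x)" for vs x using f by (simp add: smooth_bdd_derivs_def)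
  obtain C1 where C1: "\<And>vs x. length vs = 1 \<Longrightarrow> norm (iter_dderiv f vs x) \<le> C1 * (\<Prod>v\<leftarrow>vs. norm v)"
    using f unfolding smooth_bdd_derivs_def by (metis order_refl)
  obtain C2 where C2: "\<And>vs x. length vs = 2 \<Longrightarrow> norm (iter_dderiv f vs x) \<le> C2 * (\<Prod>v\<leftarrow>vs. norm v)"
    using f unfolding smooth_bdd_derivs_def by (metis one_le_numeral)
  define L where "L = max C1 C2"
  show thesis
  proof (rule that[of L])
    show "(f has_derivative frechet_derivative f (at x)) (at x)" for x
      using diff[of "[]" x] by (simp add: frechet_derivative_works[symmetric])
    show "norm (frechet_derivative f (at x) v) \<le> L * norm v" for x v
    proof -
      have "C1 * norm v \<le> L * norm v" by (intro mult_right_mono) (auto simp: L_def)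
      then show ?thesis using C1[of "[v]" x] by simp
    qed
    show "norm (frechet_derivative f (at x) v - frechet_derivative f (at z) v) \<le> L * norm (x - z) * norm v" for x z v
    proof -
      let ?g = "iter_dderiv f [v]"
      have "norm (?g x - ?g z) \<le> (C2 * norm v) * norm (x - z)"
      proof (rule differentiable_bound[of UNIV])
        fix x
        show "(?g has_derivative frechet_derivative ?g (at x)) (at x within UNIV)"
          using diff[of "[v]" x] by (simp add: frechet_derivative_works[symmetric])
        show "onorm (frechet_derivative ?g (at x)) \<le> C2 * norm v"
        proof (rule onorm_le)
          show "norm (frechet_derivative ?g (at x) w) \<le> C2 * norm v * norm w" for w
            using C2[of "[w, v]" x] by (simp add: mult_ac)
        qed
      qed auto
      also have "\<dots> \<le> (L * norm v) * norm (x - z)" by (intro mult_right_mono) (auto simp: L_def)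
      finally show ?thesis by (simp add: mult_ac)
    qed
  qed
qed

section \<open>From constant Lie words to the locale assumptions\<close>

lemma lie_word_snoc:
  "is \<noteq> [] \<Longrightarrow> lie_word V (is @ [j]) = lie_bracket (lie_word V is) (V j)"
  by (simp add: lie_word_def)

text \<open>Take for \<open>K\<close> the span of the values of all words of length at least two.
  Appending a letter i to a word with value c gives the field whose value at x is the derivative of
  \<open>V i\<close> at x along c. As the longer word is again constant, this derivative is
  independent of x and is again a value of a word.\<close>

lemma constant_lie_words:
  fixes V :: "'d::finite \<Rightarrow> 'a::euclidean_space \<Rightarrow> 'a"
  assumes smooth: "\<And>i. smooth_bdd_derivs (V i)"
    and const: "\<And>is. length is \<ge> 2 \<Longrightarrow> \<exists>c. \<forall>x. lie_word V is x = c"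
  obtains K L where "constant_bracket_fields V (\<lambda>i x. frechet_derivative (V i) (at x)) K L"
proof -
  let ?D = "\<lambda>i x. frechet_derivative (V i) (at x)"
  have "\<exists>L. (\<forall>x. (V i has_derivative ?D i x) (at x)) \<and> (\<forall>x v. norm (?D i x v) \<le> L * norm v) \<and>
     (\<forall>x z v. norm (?D i x v - ?D i z v) \<le> L * norm (x - z) * norm v)" for i
    using smooth_bdd_derivs_bounds[OF smooth[of i]] by metis
  then obtain l where l: "\<And>i x. (V i has_derivative ?D i x) (at x)" "\<And>i x v. norm (?D i x v) \<le> l i * norm v"
    "\<And>i x z v. norm (?D i x v - ?D i z v) \<le> l i * norm (x - z) * norm v" by metis
  define L where "L = Max (range l)"
  have lL: "l i \<le> L" for i unfolding L_def by (rule Max_ge) auto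
  define S where "S = {c. \<exists>is. length is \<ge> 2 \<and> lie_word V is = (\<lambda>x. c)}"
  have step: "?D i x c = ?D i 0 c \<and> ?D i 0 c \<in> S" if c: "c \<in> S" for c i x
  proof -
    obtain ws where ws: "length ws \<ge> 2" "lie_word V ws = (\<lambda>x. c)" using c by (auto simp: S_def)
    have eq: "lie_word V (ws @ [i]) = (\<lambda>x. ?D i x c)"
      using ws by (subst lie_word_snoc) (auto simp: lie_bracket_def)
    obtain c' where c': "\<And>x. lie_word V (ws @ [i]) x = c'" using const[of "ws @ [i]"] ws by auto
    then have D: "?D i x c = c'" for x using eq by metis
    have "lie_word V (ws @ [i]) = (\<lambda>x. c')" using c' by auto
    then have "c' \<in> S" using ws unfolding S_def by (intro CollectI exI[of _ "ws @ [i]"]) auto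
    then show ?thesis using D by simp
  qed
  \<comment> \<open>The two properties are linear in c, so they pass from the values of words to
    their span.\<close>
  have "subspace {c. (\<forall>x. ?D i x c = ?D i 0 c) \<and> ?D i 0 c \<in> span S}" for i
  proof -
    have lin: "linear (?D i x)" for x using l(1) has_derivative_linear by blast
    show ?thesis
    proof (rule subspaceI, goal_cases)
      case 1
      then show ?case by (simp add: linear_0[OF lin] span_zero)
    next
      case (2 x y)
      then show ?case unfolding mem_Collect_eq linear_add[OF lin] by (metis span_add)
    next
      case (3 c x)
      then show ?case unfolding mem_Collect_eq linear_cmul[OF lin] by (metis span_scale)
    qed
  qed
  then have span: "span S \<subseteq> {c. (\<forall>x. ?D i x c = ?D i 0 c) \<and> ?D i 0 c \<in> span S}" for i
    by (intro span_minimal) (use step span_base in blast)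
  have br: "\<exists>c\<in>S. \<forall>x. ?D j x (V i x) - ?D i x (V j x) = c" for i j
  proof -
    obtain c where c: "\<And>x. lie_word V [i, j] x = c" using const[of "[i, j]"] by auto
    then have "lie_word V [i, j] = (\<lambda>x. c)" by auto
    then have "c \<in> S" unfolding S_def by (intro CollectI exI[of _ "[i, j]"]) auto
    then show ?thesis using c by (auto simp: lie_word_def lie_bracket_def)
  qed
  have "constant_bracket_fields V ?D (span S) L"
  proof
    show "norm (?D i x v) \<le> L * norm v" for i x v
      using mult_right_mono[OF lL[of i] norm_ge_zero[of v]] l(2)[of i x v] by linarith
    show "norm (?D i x v - ?D i z v) \<le> L * norm (x - z) * norm v" for i x z v
      using mult_right_mono[OF mult_right_mono[OF lL[of i] norm_ge_zero[of "x - z"]] norm_ge_zero[of v]] l(3)[of i x v z]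
      by linarith
    show "?D j x (V i x) - ?D i x (V j x) = ?D j 0 (V i 0) - ?D i 0 (V j 0)" for i j x
      using br[of j i] by metis
    show "?D j 0 (V i 0) - ?D i 0 (V j 0) \<in> span S" for i j
      using br[of j i] span_base by metis
    show "?D i x c = ?D i 0 c" "?D i 0 c \<in> span S" if "c \<in> span S" for c i x
      using span[of i] that by blast+
  qed (use l(1) in auto)
  then show thesis by (rule that)
qed

section \<open>Derivatives of bi-Lipschitz maps and their matrices\<close>

lemma has_derivative_bilipschitz:
  fixes f :: "'a::real_normed_vector \<Rightarrow> 'b::real_normed_vector"
  assumes f': "(f has_derivative f') (at a)"
    and lip: "\<And>b. norm (f b - f a) \<le> \<Lambda> * norm (b - a)" and low: "\<And>b. norm (b - a) \<le> \<Lambda> * norm (f b - f a)"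
  shows "norm (f' v) \<le> \<Lambda> * norm v" and "norm v \<le> \<Lambda> * norm (f' v)"
proof -
  \<comment> \<open>Both inequalities hold for every difference quotient along v and define a closed
    set, so they hold for the limit.\<close>
  let ?S = "{w. norm w \<le> \<Lambda> * norm v \<and> norm v \<le> \<Lambda> * norm w}"
  have "f' v \<in> ?S"
  proof (cases "v = 0")
    case True
    then show ?thesis using has_derivative_linear[OF f'] by (simp add: linear_0)
  next
    case False
    have cl: "f' v \<in> closure ?S"
      unfolding closure_approachable
    proof (intro allI impI)
      fix e :: real assume e: "0 < e"
      define e' where "e' = e / (2 * norm v)"
      have e': "0 < e'" using e False by (simp add: e'_def)
      obtain d where d: "0 < d" "\<And>y. norm (y - a) < d \<Longrightarrow> norm (f y - f a - f' (y - a)) \<le> e' * norm (y - a)"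
        using f' e' unfolding has_derivative_at_alt by blast
      define h where "h = d / (2 * norm v)"
      have h: "0 < h" "norm (h *\<^sub>R v) < d" using d(1) False by (auto simp: h_def)
      define w where "w = (1 / h) *\<^sub>R (f (a + h *\<^sub>R v) - f a)"
      have fw: "f (a + h *\<^sub>R v) - f a = h *\<^sub>R w" using h by (simp add: w_def)
      have "norm (h *\<^sub>R w - f' (h *\<^sub>R v)) \<le> e' * norm (h *\<^sub>R v)"
        using d(2)[of "a + h *\<^sub>R v"] h fw by simp
      then have "h * norm (w - f' v) \<le> h * (e' * norm v)"
        using h by (simp add: linear_cmul[OF has_derivative_linear[OF f']] scaleR_diff_right[symmetric] mult_ac)
      then have "norm (w - f' v) \<le> e / 2" using h False by (simp add: e'_def)
      then have "dist w (f' v) < e" using e by (simp add: dist_norm)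
      moreover have "norm w \<le> \<Lambda> * norm v"
      proof -
        have "h * norm w \<le> h * (\<Lambda> * norm v)" using lip[of "a + h *\<^sub>R v"] h fw by (simp add: mult_ac)
        then show ?thesis using h by simp
      qed
      moreover have "norm v \<le> \<Lambda> * norm w"
      proof -
        have "h * norm v \<le> h * (\<Lambda> * norm w)" using low[of "a + h *\<^sub>R v"] h fw by (simp add: mult_ac)
        then show ?thesis using h by simp
      qed
      ultimately show "\<exists>w\<in>?S. dist w (f' v) < e" by blast
    qed
    have closed: "closed ?S"
      by (intro closed_Collect_conj closed_Collect_le continuous_intros)
    show ?thesis using cl unfolding closure_closed[OF closed] .
  qed
  then show "norm (f' v) \<le> \<Lambda> * norm v" "norm v \<le> \<Lambda> * norm (f' v)" by auto
qed

lemma norm_matrix_le: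
  fixes A :: "real^'n^'m"
  assumes "\<And>j. norm (A *v axis j 1) \<le> b"
  shows "norm A \<le> real CARD('m) * real CARD('n) * b"
proof -
  have "\<bar>A $ i $ j\<bar> \<le> b" for i j
    using component_le_norm_cart[of "A *v axis j 1" i] assms[of j]
    by (simp add: matrix_vector_mul_component inner_axis)
  then have "norm (A $ i) \<le> real CARD('n) * b" for i
    using order_trans[OF norm_le_l1_cart sum_bounded_above[of UNIV "\<lambda>j. \<bar>A $ i $ j\<bar>" b]] by simp
  then show ?thesis
    using order_trans[OF L2_set_le_sum sum_bounded_above[of UNIV "\<lambda>i. norm (A $ i)" "real CARD('n) * b"]]
    by (simp add: norm_vec_def mult.assoc)
qed

text \<open>The lower bound makes \<open>A\<close> injective, hence invertible, so that
  \<open>matrix_inv\<close> is a genuine inverse; applied to its columns the same bound estimates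
  them.\<close>

lemma norm_matrix_inv_le:
  fixes A :: "real^'n^'n"
  assumes low: "\<And>v. norm v \<le> b * norm (A *v v)"
  shows "norm (matrix_inv A) \<le> real CARD('n) * real CARD('n) * b"
proof (rule norm_matrix_le)
  fix j
  have "inj ((*v) A)"
  proof (rule injI)
    fix v w assume "A *v v = A *v w"
    then show "v = w" using low[of "v - w"] by (simp add: matrix_vector_mult_diff_distrib)
  qed
  then have "invertible A"
    using matrix_left_invertible_injective invertible_left_inverse by blast
  then have "A ** matrix_inv A = mat 1"
    unfolding matrix_inv_def invertible_def by (metis (mono_tags, lifting) someI_ex)
  then have "A *v (matrix_inv A *v axis j 1) = axis j 1" by (simp add: matrix_vector_mul_assoc)
  then show "norm (matrix_inv A *v axis j 1) \<le> b"
    using low[of "matrix_inv A *v axis j 1"] by (simp add: norm_axis_1)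
qed

text \<open>\<^const>\<open>frechet_derivative\<close> of a map that is not differentiable is a choice from the empty predicate,
  hence one fixed function. The value of \<^const>\<open>jacobian_flow\<close> is then this fixed matrix, which is
  integrable for trivial reasons, so only the bi-Lipschitz property of the flow matters.\<close>

definition junk_matrix :: "real^'m^'m" where
  "junk_matrix = matrix (SOME f'. False)"

lemma jacobian_flow_bounds:
  fixes y :: "real^'m \<Rightarrow> 'w \<Rightarrow> real \<Rightarrow> real^'m"
  assumes lip: "\<And>b. norm (y b \<omega> t - y a \<omega> t) \<le> \<Lambda> * norm (b - a)"
    and low: "\<And>b. norm (b - a) \<le> \<Lambda> * norm (y b \<omega> t - y a \<omega> t)" and \<Lambda>: "1 \<le> \<Lambda>"
  defines "m \<equiv> real CARD('m) * real CARD('m)"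
  shows "norm (jacobian_flow y \<omega> t a) \<le> (m + norm (junk_matrix :: real^'m^'m)) * \<Lambda>"
    and "norm (matrix_inv (jacobian_flow y \<omega> t a)) \<le> (m + norm (matrix_inv (junk_matrix :: real^'m^'m))) * \<Lambda>"
proof -
  have m: "0 \<le> m" by (simp add: m_def)
  have "norm (jacobian_flow y \<omega> t a) \<le> (m + norm (junk_matrix :: real^'m^'m)) * \<Lambda> \<and>
    norm (matrix_inv (jacobian_flow y \<omega> t a)) \<le> (m + norm (matrix_inv (junk_matrix :: real^'m^'m))) * \<Lambda>"
  proof (cases "(\<lambda>b. y b \<omega> t) differentiable (at a)")
    case True
    define f' where "f' = frechet_derivative (\<lambda>b. y b \<omega> t) (at a)"
    have f': "((\<lambda>b. y b \<omega> t) has_derivative f') (at a)"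
      using True by (simp add: f'_def frechet_derivative_works)
    have J: "jacobian_flow y \<omega> t a *v v = f' v" for v
      unfolding jacobian_flow_def f'_def[symmetric] by (rule fun_cong[OF matrix_vector_mul(2)[OF has_derivative_linear[OF f']]])
    note bd = has_derivative_bilipschitz[OF f' lip low]
    have "norm (jacobian_flow y \<omega> t a) \<le> m * \<Lambda>"
      unfolding m_def by (rule norm_matrix_le) (use bd(1)[of "axis _ 1"] in \<open>simp add: J norm_axis_1\<close>)
    moreover have "norm (matrix_inv (jacobian_flow y \<omega> t a)) \<le> m * \<Lambda>"
      unfolding m_def by (rule norm_matrix_inv_le) (use bd(2) in \<open>simp add: J\<close>)
    moreover have "m * \<Lambda> \<le> (m + c) * \<Lambda>" if "0 \<le> c" for c
      using that \<Lambda> by (intro mult_right_mono) auto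
    ultimately show ?thesis by (meson norm_ge_zero order_trans)
  next
    case False
    then have "jacobian_flow y \<omega> t a = junk_matrix"
      unfolding jacobian_flow_def junk_matrix_def frechet_derivative_def differentiable_def by simp
    \<comment> \<open>The assumption that \<Lambda> is at least 1 absorbs the fixed matrix into a
      multiple of \<Lambda>.\<close>
    moreover have "c \<le> (m + c) * \<Lambda>" if "0 \<le> c" for c
      using mult_mono[of c "m + c" 1 \<Lambda>] that m \<Lambda> by simp
    ultimately show ?thesis by simp
  qed
  then show "norm (jacobian_flow y \<omega> t a) \<le> (m + norm (junk_matrix :: real^'m^'m)) * \<Lambda>"
    "norm (matrix_inv (jacobian_flow y \<omega> t a)) \<le> (m + norm (matrix_inv (junk_matrix :: real^'m^'m))) * \<Lambda>" by auto
qed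

theorem theorem4p6:
  fixes M :: "'w measure" and B :: "'d::finite \<Rightarrow> real \<Rightarrow> 'w \<Rightarrow> real"
    and V :: "'d \<Rightarrow> real^'m \<Rightarrow> real^'m"
    and T H q :: real and a :: "real^'m" and n :: nat
    and y :: "real^'m \<Rightarrow> 'w \<Rightarrow> real \<Rightarrow> real^'m"
  assumes "T > 0" and "1/3 < H" and "H < 1/2"
    and "fbm M H B"
    and "\<forall>i. smooth_bdd_derivs (V i)"
    and "n \<ge> 1"
    and "\<forall>is. length is = n \<longrightarrow> lie_word V is = (\<lambda>x. 0)"
    and "\<forall>is. length is \<ge> 2 \<longrightarrow> (\<exists>c. \<forall>x. lie_word V is x = c)"
    and "AE \<omega> in M. \<forall>b. rde_solution T (\<lambda>i t. B i t \<omega>) (\<lambda>i j s t. levy_lift T B i j s t \<omega>) V b (y b \<omega>)"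
    and "q \<ge> 1"
  shows "(\<integral>\<^sup>+\<omega>. (\<Squnion>t\<in>{0..T}. ennreal (norm (jacobian_flow y \<omega> t a) powr q)) \<partial>M) < \<infinity> \<and>
         (\<integral>\<^sup>+\<omega>. (\<Squnion>t\<in>{0..T}. ennreal (norm (matrix_inv (jacobian_flow y \<omega> t a)) powr q)) \<partial>M) < \<infinity>"
proof -
  have T: "0 < T" and q: "1 \<le> q" by fact+
  obtain K L where F: "constant_bracket_fields V (\<lambda>i x. frechet_derivative (V i) (at x)) K L"
    using constant_lie_words[of V] assms(5,8) by blast
  interpret F: constant_bracket_fields V "\<lambda>i x. frechet_derivative (V i) (at x)" K L by (rule F)
  interpret G: fractional_brownian M H B by unfold_locales (use assms in auto)
  \<comment> \<open>The midpoint of 1/3 and H: above 1/3 for the transport along dyadic partitions,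
    below H for the exponential moments.\<close>
  define \<alpha> where "\<alpha> = (1/3 + H) / 2"
  have \<alpha>: "1/3 < \<alpha>" "\<alpha> < H" "0 < \<alpha>" using assms by (auto simp: \<alpha>_def)
  define \<kappa> where "\<kappa> = 1 / (1 - 2 powr (- \<alpha>))"
  have \<kappa>: "0 \<le> \<kappa>" using \<alpha> powr_less_one[of 2 "- \<alpha>"] by (simp add: \<kappa>_def)
  \<comment> \<open>Large enough that \<mu> times the path constant dominates q times the exponent
    of the bi-Lipschitz bound; the added 1 keeps \<mu> positive even if that exponent
    vanishes.\<close>
  define \<mu> where "\<mu> = q * (F.M * (real CARD('d) * \<kappa>)) + 1"
  have \<mu>: "0 < \<mu>" using q \<kappa> F.M_nonneg by (simp add: \<mu>_def add_nonneg_pos)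
  define Z where "Z = G.exp_sum T \<mu> \<alpha>"
  have Z_int: "(\<integral>\<^sup>+\<omega>. Z \<omega> \<partial>M) < \<infinity>" unfolding Z_def by (rule G.exp_sum_integrable[OF T \<mu> \<alpha>(2)])
  have Z_meas [measurable]: "Z \<in> borel_measurable M" by (simp add: Z_def)
  define m where "m = real CARD('m) * real CARD('m)"
  define c1 where "c1 = m + norm (junk_matrix :: real^'m^'m)"
  define c2 where "c2 = m + norm (matrix_inv (junk_matrix :: real^'m^'m))"
  have c: "0 \<le> c1" "0 \<le> c2" by (simp_all add: c1_def c2_def m_def)
  have Zfin: "AE \<omega> in M. Z \<omega> \<noteq> \<infinity>"
    by (rule nn_integral_PInf_AE) (use Z_int in auto)
  have conv: "AE \<omega> in M. \<forall>N k i j. k < 2 ^ N \<longrightarrow>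
    convergent (\<lambda>n. iter_int_pl n T (\<lambda>r. B i r \<omega>) (\<lambda>r. B j r \<omega>) (dyad_pt N T k) (dyad_pt N T (Suc k)))"
    by (rule G.AE_convergent_iter_int_pl[OF T]) (use assms in auto)
  have bound: "AE \<omega> in M. \<forall>t\<in>{0..T}.
      ennreal (norm (jacobian_flow y \<omega> t a) powr q) \<le> ennreal (c1 powr q * exp q) * (ennreal (exp \<mu>) + Z \<omega>) \<and>
      ennreal (norm (matrix_inv (jacobian_flow y \<omega> t a)) powr q) \<le> ennreal (c2 powr q * exp q) * (ennreal (exp \<mu>) + Z \<omega>)"
    using assms(9) Zfin conv AE_space
  proof eventually_elim
    case (elim \<omega>)
    note sol = elim(1)[rule_format] and cv = elim(3)[rule_format] and \<omega> = elim(4)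
    have "G.exp_sum T \<mu> \<alpha> \<omega> < \<infinity>" using elim(2) by (simp add: Z_def less_top)
    then obtain Kp where Kp: "0 \<le> Kp" "ennreal (exp (\<mu> * Kp)) = ennreal (exp \<mu>) + Z \<omega>"
      "\<And>i n k. k < 2 ^ n \<Longrightarrow> \<bar>B i (dyad_pt n T (Suc k)) \<omega> - B i (dyad_pt n T k) \<omega>\<bar> \<le> Kp * (1 / 2 ^ n) powr \<alpha>"
      "\<And>i t. t \<in> {0..T} \<Longrightarrow> \<bar>B i t \<omega> - B i 0 \<omega>\<bar> \<le> Kp * \<kappa>"
      using G.exp_sum_controls_path[OF T \<mu> \<alpha>(3) \<omega>] unfolding Z_def \<kappa>_def by metis
    define x :: "real \<Rightarrow> real^'d" where "x t = (\<chi> i. B i t \<omega>)" for t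
    define X where "X i j s t = levy_lift T B i j s t \<omega>" for i j s t
    have x_cont: "continuous_on {0..T} x"
      unfolding x_def
      by (intro continuous_on_vec_lambda continuous_on_subset[OF G.B_continuous[OF \<omega>]]) auto
    have norm_x: "norm (x t - x s) \<le> real CARD('d) * b" if "\<And>i. \<bar>B i t \<omega> - B i s \<omega>\<bar> \<le> b" for s t b
      using order_trans[OF norm_le_l1_cart[of "x t - x s"] sum_bounded_above[of UNIV "\<lambda>i. \<bar>(x t - x s) $ i\<bar>" b]] that
      by (simp add: x_def)
    have davie: "F.davie T x X (y b \<omega>)" "y b \<omega> 0 = b" for b
      using sol[of b] by (auto simp: rde_solution_def F.davie_def F.W_def x_def X_def)
    have sym: "X i j (dyad_pt n T k) (dyad_pt n T (Suc k)) + X j i (dyad_pt n T k) (dyad_pt n T (Suc k))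
        = (x (dyad_pt n T (Suc k)) - x (dyad_pt n T k)) $ i * (x (dyad_pt n T (Suc k)) - x (dyad_pt n T k)) $ j"
      if "k < 2 ^ n" for n k i j
      using levy_lift_sym[where B = B and i = i and j = j and \<omega> = \<omega>, OF T that cv[OF that]] by (simp add: X_def x_def)
    have hold: "norm (x (dyad_pt n T (Suc k)) - x (dyad_pt n T k)) \<le> (real CARD('d) * Kp) * (1 / 2 ^ n) powr \<alpha>"
      if "k < 2 ^ n" for n k
      using norm_x[OF Kp(3)[OF that]] by (simp add: mult.assoc)
    show ?case
    proof
      fix t assume t: "t \<in> {0..T}"
      define \<Lambda> where "\<Lambda> = exp (F.M * norm (x t - x 0) + 1)"
      have \<Lambda>1: "1 \<le> \<Lambda>" using F.M_nonneg by (simp add: \<Lambda>_def)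
      \<comment> \<open>On this event every starting point b has a solution, so the flow from b is
        compared with the flow from \<open>a\<close> at this \<omega>. The resulting constant does
        not depend on b, as the difference quotients require.\<close>
      note bl = F.davie_bilipschitz[OF T x_cont sym hold \<alpha>(1) davie(1) davie(1) t, unfolded davie(2), folded \<Lambda>_def]
      have J: "norm (jacobian_flow y \<omega> t a) \<le> c1 * \<Lambda>" "norm (matrix_inv (jacobian_flow y \<omega> t a)) \<le> c2 * \<Lambda>"
        unfolding c1_def c2_def m_def
        by (rule jacobian_flow_bounds; use bl \<Lambda>1 in \<open>simp add: mult.commute\<close>)+
      have "\<Lambda> powr q = exp (q * (F.M * norm (x t - x 0) + 1))" by (simp add: \<Lambda>_def powr_def)
      also have "\<dots> \<le> exp (q + \<mu> * Kp)"
      proof -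
        have "F.M * norm (x t - x 0) \<le> F.M * (real CARD('d) * (Kp * \<kappa>))"
          by (intro mult_left_mono norm_x Kp(4) t F.M_nonneg)
        then have "q * (F.M * norm (x t - x 0)) \<le> q * (F.M * (real CARD('d) * (Kp * \<kappa>)))"
          by (rule mult_left_mono) (use q in simp)
        also have "\<dots> \<le> \<mu> * Kp" using Kp(1) by (simp add: \<mu>_def algebra_simps)
        finally show ?thesis by (simp add: distrib_left)
      qed
      finally have \<Lambda>q: "\<Lambda> powr q \<le> exp q * exp (\<mu> * Kp)" by (simp add: exp_add)
      have key: "ennreal (r powr q) \<le> ennreal (c powr q * exp q) * (ennreal (exp \<mu>) + Z \<omega>)"
        if "0 \<le> r" "0 \<le> c" "r \<le> c * \<Lambda>" for r c
      proof -
        have "r powr q \<le> (c * \<Lambda>) powr q" using that q by (intro powr_mono2) auto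
        also have "\<dots> = c powr q * \<Lambda> powr q" using that \<Lambda>1 by (intro powr_mult)
        also have "\<dots> \<le> c powr q * (exp q * exp (\<mu> * Kp))" by (intro mult_left_mono \<Lambda>q) auto
        finally have "ennreal (r powr q) \<le> ennreal ((c powr q * exp q) * exp (\<mu> * Kp))"
          by (intro ennreal_leI) (simp add: mult.assoc)
        also have "\<dots> = ennreal (c powr q * exp q) * ennreal (exp (\<mu> * Kp))" by (rule ennreal_mult) auto
        finally show ?thesis unfolding Kp(2) .
      qed
      show "ennreal (norm (jacobian_flow y \<omega> t a) powr q) \<le> ennreal (c1 powr q * exp q) * (ennreal (exp \<mu>) + Z \<omega>) \<and>
        ennreal (norm (matrix_inv (jacobian_flow y \<omega> t a)) powr q) \<le> ennreal (c2 powr q * exp q) * (ennreal (exp \<mu>) + Z \<omega>)"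
        using key[OF _ c(1) J(1)] key[OF _ c(2) J(2)] by simp
    qed
  qed
  have fin: "(\<integral>\<^sup>+\<omega>. ennreal C * (ennreal (exp \<mu>) + Z \<omega>) \<partial>M) < \<infinity>" for C
  proof -
    interpret prob_space M by (rule G.prob_space_M)
    have "(\<integral>\<^sup>+\<omega>. ennreal C * (ennreal (exp \<mu>) + Z \<omega>) \<partial>M) = ennreal C * (ennreal (exp \<mu>) + (\<integral>\<^sup>+\<omega>. Z \<omega> \<partial>M))"
      by (simp add: nn_integral_cmult nn_integral_add emeasure_space_1)
    also have "\<dots> < \<infinity>" using Z_int by (simp add: ennreal_mult_less_top)
    finally show ?thesis .
  qed
  \<comment> \<open>The supremum runs over uncountably many times. It is dominated pointwise by an
    expression in the measurable \<open>Z\<close> that does not depend on t, and only the integral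
    of that expression is computed.\<close>
  have "(\<integral>\<^sup>+\<omega>. (\<Squnion>t\<in>{0..T}. ennreal (norm (jacobian_flow y \<omega> t a) powr q)) \<partial>M)
      \<le> (\<integral>\<^sup>+\<omega>. ennreal (c1 powr q * exp q) * (ennreal (exp \<mu>) + Z \<omega>) \<partial>M)"
    by (rule nn_integral_mono_AE) (use bound in \<open>eventually_elim, auto intro!: SUP_least\<close>)
  moreover have "(\<integral>\<^sup>+\<omega>. (\<Squnion>t\<in>{0..T}. ennreal (norm (matrix_inv (jacobian_flow y \<omega> t a)) powr q)) \<partial>M)
      \<le> (\<integral>\<^sup>+\<omega>. ennreal (c2 powr q * exp q) * (ennreal (exp \<mu>) + Z \<omega>) \<partial>M)"
    by (rule nn_integral_mono_AE) (use bound in \<open>eventually_elim, auto intro!: SUP_least\<close>)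
  ultimately show ?thesis using fin le_less_trans by blast
qed

end
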